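(* Persistence is neither necessary nor sufficient for local exponential stability of the ($d$-dimensional) directed controller $$\dot p=-\overrightarrow R(p)^\top\bigl(R(p)p-m^*\bigr).$$ Here persistence is a property of the orientation $\overrightarrow{\mathcal G}$ that defines the controller, and local exponential stability is understood at a target configuration $p^*$ with $m^*=F(p^* )$.
   Context: Let $d$ be the ambient dimension and $\mathcal G$ a finite simple undirected graph with vertex set $\{1,\dots,n\}$ and edge set $\mathcal E$. A configuration is $p=(p_1,\dots,p_n)\in\mathbb R^{dn}$ with $p_i\in\mathbb R^d$. The distance map is $F(p)=(\|p_j-p_i\|^2)_{ij\in\mathcal E}\in\mathbb R^{|\mathcal E|}$. The rigidity matrix $R(p)$ has, in the row of edge $ij$, the block $(p_i-p_j)^\top$ at vertex $i$, the block $(p_j-p_i)^\top$ at vertex $j$, and zeros elsewhere, so that $F(p)=R(p)p$ and $\mathrm dF_p=2R(p)$. A point $m$ of the image of $F$ is a regular value if near $m$ the image of $F$ is a smooth embedded submanifold of $\mathbb R^{|\mathcal E|}$ and $\mathrm dF_p$ maps onto its tangent space at $m$ for every $p\in F^{-1}(m)$. Let $\mathcal C$ be the set of configurations $p$ such that $F(p)$ is a regular value. Two configurations are congruent if they differ by a Euclidean isometry of $\mathbb R^d$. The graph $\mathcal G$ is assumed to be $d$-rigid: for generic $p$, every $q$ sufficiently close to $p$ with $F(q)=F(p)$ is congruent to $p$. Directed controller: given an orientation $\overrightarrow{\mathcal G}$ of $\mathcal G$, the matrix $\overrightarrow R(p)$ is obtained from $R(p)$ by setting to zero, in the row of each directed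 edge $\overrightarrow{ij}$ (tail $i$, head $j$), the entries corresponding to the head $j$. Given a target configuration $p^*\in\mathcal C$ and $m^*=F(p^* )$, the directed controller is the system displayed in the claim; equivalently, $\dot p_i=\sum_{\overrightarrow{ij}}(\|p_i-p_j\|^2-m^*_{ij})(p_j-p_i)$, where the sum is over the directed edges with tail $i$. Local exponential stability: the controller is locally exponentially stable at $p^*\in\mathcal C$ if there is a neighborhood $U\ni p^*$ such that, for all $p^0\in U$, the solution with $p(0)=p^0$ converges exponentially to a configuration $q\in U$ congruent to $p^*$ (that is, $\|p(t)-q\|\le Ke^{-ct}$ for all $t\ge 0$, with $K,c>0$ independent of $p^0$). Persistence (the classical notion of Hendrickx, Anderson, Delvenne and Blondel, stated in $\mathbb R^d$): let $p$ be a configuration of the directed graph $\overrightarrow{\mathcal G}$, with induced desired distances $d_{ij}=\|p_i-p_j\|$. A configuration $p'$ is fitting for these distances if, for no vertex $i$, there is a point $x\in\mathbb R^d$ such that the set of directed edges $\overrightarrow{ij}$ out of $i$ with $\|p'_i-p'_j\|=d_{ij}$ is strictly contained in the set of directed edges $\overrightarrow{ij}$ out of $i$ with $\|x-p'_j\|=d_{ij}$. The configuration $p$ is persistent if there is $\varepsilon>0$ such that every configuration $p'$ within distance $\varepsilon$ of $p$ that is fitting for the distances induced by $p$ is congruent to $p$. The directed graph $\overrightarrow{\mathcal G}$ is persistent if almost all of its configurations in $\mathbb R^d$ are persistent. *)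

theory Defs
  imports "HOL-Analysis.Analysis"
begin

section \<open>Graphs, configurations and the distance map\<close>

text \<open>An undirected edge between \<open>i\<close> and \<open>j\<close> is stored as the pair \<open>(i, j)\<close> with \<open>i < j\<close>.\<close>

definition simple_graph :: "nat \<Rightarrow> (nat \<times> nat) set \<Rightarrow> bool" where
  "simple_graph n E \<longleftrightarrow> E \<subseteq> {(i, j). i \<in> {1..n} \<and> j \<in> {1..n} \<and> i < j}"

text \<open>A directed edge is a pair (tail, head).\<close>

definition orientation :: "(nat \<times> nat) set \<Rightarrow> (nat \<times> nat) set \<Rightarrow> bool" where
  "orientation E D \<longleftrightarrow> D \<subseteq> E \<union> E\<inverse> \<and> (\<forall>(i, j)\<in>E. ((i, j) \<in> D) \<noteq> ((j, i) \<in> D))"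

text \<open>
  \<open>\<real>\<^sup>d\<^sup>n\<close> is the set of extensional functions on \<open>{1..n}\<close>, and similarly \<open>\<real>\<^sup>E\<close> below.
  On these sets the product topology of the function type induces the Euclidean topology.
\<close>

type_synonym 'd config = "nat \<Rightarrow> real ^ 'd"

definition configs :: "nat \<Rightarrow> 'd::finite config set" where
  "configs n = {1..n} \<rightarrow>\<^sub>E UNIV"

definition config_dist :: "nat \<Rightarrow> 'd::finite config \<Rightarrow> 'd config \<Rightarrow> real" where
  "config_dist n p q = L2_set (\<lambda>i. dist (p i) (q i)) {1..n}"

definition congruent :: "nat \<Rightarrow> 'd::finite config \<Rightarrow> 'd config \<Rightarrow> bool" where
  "congruent n p q \<longleftrightarrow>
     (\<exists>T :: real ^ 'd \<Rightarrow> real ^ 'd. (\<forall>x y. dist (T x) (T y) = dist x y) \<and> (\<forall>i\<in>{1..n}. q i = T (p i)))"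

definition distance_map :: "(nat \<times> nat) set \<Rightarrow> 'd::finite config \<Rightarrow> (nat \<times> nat \<Rightarrow> real)" where
  "distance_map E p = (\<lambda>(i, j)\<in>E. (norm (p j - p i))\<^sup>2)"

text \<open>\<open>rigidity_matrix p e k\<close> is the block of \<open>R(p)\<close> in row \<open>e\<close> at vertex \<open>k\<close>.\<close>

definition rigidity_matrix :: "'d::finite config \<Rightarrow> nat \<times> nat \<Rightarrow> nat \<Rightarrow> real ^ 'd" where
  "rigidity_matrix p = (\<lambda>(i, j) k. if k = i then p i - p j else if k = j then p j - p i else 0)"

definition rigidity_apply :: "nat \<Rightarrow> 'd::finite config \<Rightarrow> 'd config \<Rightarrow> nat \<times> nat \<Rightarrow> real" where
  "rigidity_apply n p v e = (\<Sum>k\<in>{1..n}. rigidity_matrix p e k \<bullet> v k)"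

definition distance_map_deriv ::
    "nat \<Rightarrow> (nat \<times> nat) set \<Rightarrow> 'd::finite config \<Rightarrow> 'd config \<Rightarrow> (nat \<times> nat \<Rightarrow> real)" where
  "distance_map_deriv n E p v = (\<lambda>e\<in>E. 2 * rigidity_apply n p v e)"

lemma rigidity_apply_edge:
  assumes "simple_graph n E" "(i, j) \<in> E"
  shows "rigidity_apply n p v (i, j) = (p i - p j) \<bullet> (v i - v j)"
proof -
  have ij: "i \<in> {1..n}" "j \<in> {1..n}" "i \<noteq> j"
    using assms by (auto simp: simple_graph_def)
  have "rigidity_apply n p v (i, j) = (\<Sum>k\<in>{i, j}. rigidity_matrix p (i, j) k \<bullet> v k)"
    unfolding rigidity_apply_def
    by (rule sum.mono_neutral_right) (use ij in \<open>auto simp: rigidity_matrix_def\<close>)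
  then show ?thesis
    using ij by (simp add: rigidity_matrix_def inner_diff_left inner_diff_right)
qed

lemma distance_map_eq_rigidity_apply:
  assumes "simple_graph n E" "e \<in> E"
  shows "distance_map E p e = rigidity_apply n p p e"
  using assms
  by (cases e) (simp add: distance_map_def rigidity_apply_edge power2_norm_eq_inner
      inner_diff_left inner_diff_right inner_commute)

lemma distance_map_has_derivative:
  assumes "simple_graph n E" "e \<in> E"
  shows "((\<lambda>t. distance_map E (\<lambda>i\<in>{1..n}. p i + t *\<^sub>R v i) e)
           has_real_derivative distance_map_deriv n E p v e) (at 0)"
proof -
  obtain i j where e: "e = (i, j)" by (cases e)
  have ij: "i \<in> {1..n}" "j \<in> {1..n}"
    using assms by (auto simp: simple_graph_def e)
  define a b where "a = p j - p i" and "b = v j - v i"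
  have eq: "(\<lambda>t. distance_map E (\<lambda>i\<in>{1..n}. p i + t *\<^sub>R v i) e)
      = (\<lambda>t. a \<bullet> a + t * (2 * (a \<bullet> b)) + t\<^sup>2 * (b \<bullet> b))"
  proof
    fix t
    have "distance_map E (\<lambda>i\<in>{1..n}. p i + t *\<^sub>R v i) e = (norm (a + t *\<^sub>R b))\<^sup>2"
      using assms(2) ij by (simp add: distance_map_def e a_def b_def algebra_simps)
    also have "\<dots> = a \<bullet> a + t * (2 * (a \<bullet> b)) + t\<^sup>2 * (b \<bullet> b)"
      unfolding power2_norm_eq_inner
      by (simp add: inner_add_left inner_add_right inner_commute power2_eq_square)
    finally show "distance_map E (\<lambda>i\<in>{1..n}. p i + t *\<^sub>R v i) e
        = a \<bullet> a + t * (2 * (a \<bullet> b)) + t\<^sup>2 * (b \<bullet> b)" .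
  qed
  have "distance_map_deriv n E p v e = 2 * (a \<bullet> b)"
    using assms
    by (simp add: distance_map_deriv_def e rigidity_apply_edge a_def b_def
        inner_diff_left inner_diff_right)
  then show ?thesis
    unfolding eq by (auto intro!: derivative_eq_intros)
qed


section \<open>Regular values\<close>

definition partial :: "'i \<Rightarrow> (('i \<Rightarrow> real) \<Rightarrow> real) \<Rightarrow> ('i \<Rightarrow> real) \<Rightarrow> real" where
  "partial i f x = deriv (\<lambda>t. f (x(i := t))) (x i)"

primrec C_k_on :: "nat \<Rightarrow> 'i set \<Rightarrow> ('i \<Rightarrow> real) set \<Rightarrow> (('i \<Rightarrow> real) \<Rightarrow> real) \<Rightarrow> bool" where
  "C_k_on 0 I W f \<longleftrightarrow> continuous_on W f"
| "C_k_on (Suc k) I W f \<longleftrightarrow> continuous_on W f \<and>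
     (\<forall>i\<in>I. (\<forall>x\<in>W. (\<lambda>t. f (x(i := t))) differentiable at (x i)) \<and> C_k_on k I W (partial i f))"

definition smooth_fun_on :: "'i set \<Rightarrow> ('i \<Rightarrow> real) set \<Rightarrow> (('i \<Rightarrow> real) \<Rightarrow> real) \<Rightarrow> bool" where
  "smooth_fun_on I W f \<longleftrightarrow> (\<forall>k. C_k_on k I W f)"

text \<open>
  \<open>M \<subseteq> \<real>\<^sup>I\<close> is near \<open>m\<close> a smooth embedded submanifold of codimension \<open>c\<close>: in the open
  neighbourhood \<open>W\<close> it is the zero set of \<open>c\<close> smooth functions with independent differentials.
\<close>

definition submanifold_near ::
    "'i set \<Rightarrow> ('i \<Rightarrow> real) set \<Rightarrow> ('i \<Rightarrow> real) \<Rightarrow>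
     ('i \<Rightarrow> real) set \<Rightarrow> nat \<Rightarrow> (nat \<Rightarrow> ('i \<Rightarrow> real) \<Rightarrow> real) \<Rightarrow> bool" where
  "submanifold_near I M m W c g \<longleftrightarrow>
     openin (top_of_set (I \<rightarrow>\<^sub>E UNIV)) W \<and> m \<in> M \<inter> W \<and>
     (\<forall>j<c. smooth_fun_on I W (g j)) \<and>
     M \<inter> W = {y\<in>W. \<forall>j<c. g j y = 0} \<and>
     (\<forall>y\<in>M \<inter> W. \<forall>a :: nat \<Rightarrow> real.
        (\<forall>i\<in>I. (\<Sum>j<c. a j * partial i (g j) y) = 0) \<longrightarrow> (\<forall>j<c. a j = 0))"

definition tangent_space ::
    "'i set \<Rightarrow> nat \<Rightarrow> (nat \<Rightarrow> ('i \<Rightarrow> real) \<Rightarrow> real) \<Rightarrow> ('i \<Rightarrow> real) \<Rightarrow> ('i \<Rightarrow> real) set" where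
  "tangent_space I c g m =
     {v \<in> I \<rightarrow>\<^sub>E UNIV. \<forall>j<c. (\<Sum>i\<in>I. partial i (g j) m * v i) = 0}"

definition regular_value ::
    "'d::finite itself \<Rightarrow> nat \<Rightarrow> (nat \<times> nat) set \<Rightarrow> (nat \<times> nat \<Rightarrow> real) \<Rightarrow> bool" where
  "regular_value T n E m \<longleftrightarrow>
     (\<exists>W c g. submanifold_near E (distance_map E ` (configs n :: 'd config set)) m W c g \<and>
        (\<forall>p\<in>configs n :: 'd config set. distance_map E p = m \<longrightarrow>
           distance_map_deriv n E p ` configs n = tangent_space E c g m))"

definition regular_configs :: "nat \<Rightarrow> (nat \<times> nat) set \<Rightarrow> 'd::finite config set" where
  "regular_configs n E = {p \<in> configs n. regular_value TYPE('d) n E (distance_map E p)}"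


section \<open>Generic rigidity\<close>

inductive config_polynomial :: "nat \<Rightarrow> ('d::finite config \<Rightarrow> real) \<Rightarrow> bool" for n where
  const: "config_polynomial n (\<lambda>p. c)"
| coord: "i \<in> {1..n} \<Longrightarrow> config_polynomial n (\<lambda>p. p i $ k)"
| add: "config_polynomial n f \<Longrightarrow> config_polynomial n g \<Longrightarrow> config_polynomial n (\<lambda>p. f p + g p)"
| mult: "config_polynomial n f \<Longrightarrow> config_polynomial n g \<Longrightarrow> config_polynomial n (\<lambda>p. f p * g p)"

text \<open>Generic means: outside the zero set of some polynomial that does not vanish identically.\<close>

definition generically :: "nat \<Rightarrow> ('d::finite config \<Rightarrow> bool) \<Rightarrow> bool" where
  "generically n P \<longleftrightarrow>
     (\<exists>f. config_polynomial n f \<and> (\<exists>p\<in>configs n. f p \<noteq> 0) \<and>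
          (\<forall>p\<in>configs n. f p \<noteq> 0 \<longrightarrow> P p))"

definition rigid_graph :: "'d::finite itself \<Rightarrow> nat \<Rightarrow> (nat \<times> nat) set \<Rightarrow> bool" where
  "rigid_graph T n E \<longleftrightarrow>
     generically n (\<lambda>p :: 'd config. \<exists>\<epsilon>>0. \<forall>q\<in>configs n.
        config_dist n p q < \<epsilon> \<and> distance_map E q = distance_map E p \<longrightarrow> congruent n p q)"


section \<open>Persistence\<close>

definition fitting :: "nat \<Rightarrow> (nat \<times> nat) set \<Rightarrow> (nat \<Rightarrow> nat \<Rightarrow> real) \<Rightarrow> 'd::finite config \<Rightarrow> bool" where
  "fitting n D \<delta> p' \<longleftrightarrow>
     \<not> (\<exists>i\<in>{1..n}. \<exists>x.
          {(k, j) \<in> D. k = i \<and> dist (p' i) (p' j) = \<delta> i j} \<subset>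
          {(k, j) \<in> D. k = i \<and> dist x (p' j) = \<delta> i j})"

definition persistent_config :: "nat \<Rightarrow> (nat \<times> nat) set \<Rightarrow> 'd::finite config \<Rightarrow> bool" where
  "persistent_config n D p \<longleftrightarrow>
     (\<exists>\<epsilon>>0. \<forall>p'\<in>configs n.
        config_dist n p p' < \<epsilon> \<and> fitting n D (\<lambda>i j. dist (p i) (p j)) p' \<longrightarrow> congruent n p p')"

definition persistent :: "'d::finite itself \<Rightarrow> nat \<Rightarrow> (nat \<times> nat) set \<Rightarrow> bool" where
  "persistent T n D \<longleftrightarrow>
     (AE p in (\<Pi>\<^sub>M i\<in>{1..n}. (lborel :: (real ^ 'd) measure)). persistent_config n D p)"


section \<open>The directed controller and its stability\<close>

definition directed_rigidity_matrix ::
    "(nat \<times> nat) set \<Rightarrow> 'd::finite config \<Rightarrow> nat \<times> nat \<Rightarrow> nat \<Rightarrow> real ^ 'd" where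
  "directed_rigidity_matrix D p = (\<lambda>(i, j) k.
     let head = (if (i, j) \<in> D then j else i)
     in if k = head then 0 else rigidity_matrix p (i, j) k)"

definition controller_field ::
    "nat \<Rightarrow> (nat \<times> nat) set \<Rightarrow> (nat \<times> nat) set \<Rightarrow> (nat \<times> nat \<Rightarrow> real) \<Rightarrow>
     'd::finite config \<Rightarrow> 'd config" where
  "controller_field n E D m p = (\<lambda>k\<in>{1..n}.
     - (\<Sum>e\<in>E. (rigidity_apply n p p e - m e) *\<^sub>R directed_rigidity_matrix D p e k))"

definition controller_solution ::
    "nat \<Rightarrow> (nat \<times> nat) set \<Rightarrow> (nat \<times> nat) set \<Rightarrow> (nat \<times> nat \<Rightarrow> real) \<Rightarrow>
     (real \<Rightarrow> 'd::finite config) \<Rightarrow> bool" where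
  "controller_solution n E D m p \<longleftrightarrow>
     (\<forall>t\<ge>0. p t \<in> configs n \<and>
        (\<forall>k\<in>{1..n}. ((\<lambda>s. p s k) has_vector_derivative controller_field n E D m (p t) k)
           (at t within {0..})))"

text \<open>
  The field is polynomial, so a solution with given initial value is unique; the definition
  asks that it exists for all \<open>t \<ge> 0\<close> and converges.
\<close>

definition locally_exponentially_stable ::
    "nat \<Rightarrow> (nat \<times> nat) set \<Rightarrow> (nat \<times> nat) set \<Rightarrow> 'd::finite config \<Rightarrow> bool" where
  "locally_exponentially_stable n E D ps \<longleftrightarrow>
     (\<exists>U \<subseteq> configs n.
        (\<exists>W. openin (top_of_set (configs n)) W \<and> ps \<in> W \<and> W \<subseteq> U) \<and>
        (\<exists>K>0. \<exists>c>0. \<forall>p0\<in>U. \<exists>p. controller_solution n E D (distance_map E ps) p \<and> p 0 = p0 \<and>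
           (\<exists>q\<in>U. congruent n ps q \<and> (\<forall>t\<ge>0. config_dist n (p t) q \<le> K * exp (- c * t)))))"

end

theory Submission
  imports Defs
begin

text \<open>
  Both counterexamples live on the complete graph with \<open>m + d\<close> vertices, at the target where \<open>m\<close>
  vertices coincide at the origin and the remaining \<open>d\<close> vertices are the standard basis vectors
  (\<open>target\<close>). The complete graph is rigid because all pairwise distances determine a configuration up
  to congruence (\<open>isometry_extension\<close>). The target is regular (\<open>target_regular\<close>) although it has edges
  of length zero: it spans the space, and near it the squared lengths are cut out by the condition
  that the Gram matrix has rank \<open>d\<close>.

  Persistence is not sufficient. Orient every edge towards the smaller vertex. If all constraints of
  the vertices before \<open>i\<close> hold, an isometry carries the prescribed configuration of these vertices to
  the actual one, so \<open>i\<close> can satisfy all its constraints at once; hence fitting configurations are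
  congruent (\<open>fitting_transitive_congruent\<close>). But vertex 2 only follows vertex 1, at target distance
  zero, so its displacement obeys \<open>u' = - |u|\<^sup>2 u\<close>, which decays more slowly than any fixed
  exponential (\<open>not_stable_coincident\<close>).

  Persistence is not necessary. Call vertex 1 and the \<open>d\<close> basis vertices leaders and orient the edges
  between them as above. Every other vertex is a follower: it points to all leaders, and the
  followers are divided into three classes that point cyclically to one another. In a configuration
  in which each class of followers is in general position, every follower is pinned by the followers
  that it points to. Therefore the leaders can be translated while the followers stay where they are:
  the followers cannot gain any constraint without losing another one, and the result is fitting but
  not congruent (\<open>not_persistent_config_cyclic\<close>). These configurations form a set of positive measure
  (\<open>not_persistent_cyclic\<close>).

  The same orientation is exponentially stable at the target, where the followers coincide: the
  edges between followers contribute only cubic terms there, while the leaders pull every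
  follower with full rank (\<open>cyclic_stable\<close>). The leaders form a cascade in which the error of each
  leader decays up to the errors of the leaders before it (\<open>leader_rate_le\<close>), and the followers come
  last (\<open>spread_rate_le\<close>). A weighted sum of these errors is a Lyapunov function (\<open>cascade_decay\<close>)
  whose square root bounds the speed of all vertices. Since the speed is then integrable, the
  solution stays near the target and converges exponentially (\<open>lyapunov_convergence\<close>).
\<close>

section \<open>Isometries and the complete graph\<close>

text \<open>
  The reflection in the perpendicular bisector of \<open>a\<close> and \<open>b\<close> corrects the image of one point
  without moving the points that are equidistant from \<open>a\<close> and \<open>b\<close>.
\<close>

lemma bisector_reflection:
  fixes a b :: "'a::real_inner"
  obtains R where "\<And>x y. dist (R x) (R y) = dist x y" "R a = b" "\<And>x. dist x a = dist x b \<Longrightarrow> R x = x"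
proof (cases "a = b")
  case True
  then show ?thesis using that[of "\<lambda>x. x"] by auto
next
  case False
  define u where "u = a - b"
  have u: "u \<bullet> u \<noteq> 0" using False by (simp add: u_def)
  define s where "s x = 2 * ((x - (1/2) *\<^sub>R (a + b)) \<bullet> u) / (u \<bullet> u)" for x
  define R where "R x = x - s x *\<^sub>R u" for x
  have sd: "s x - s y = 2 * ((x - y) \<bullet> u) / (u \<bullet> u)" for x y
    by (simp add: s_def diff_divide_distrib[symmetric] inner_diff_left algebra_simps)
  have "dist (R x) (R y) = dist x y" for x y
  proof -
    define w t where "w = x - y" and "t = s x - s y"
    have t: "t * (u \<bullet> u) = 2 * (w \<bullet> u)" using u by (simp add: t_def sd w_def)
    have "R x - R y = w - t *\<^sub>R u" by (simp add: R_def w_def t_def algebra_simps)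
    then have "(dist (R x) (R y))\<^sup>2 = (w - t *\<^sub>R u) \<bullet> (w - t *\<^sub>R u)"
      by (simp add: dist_norm power2_norm_eq_inner)
    also have "\<dots> = w \<bullet> w + t * (t * (u \<bullet> u) - 2 * (w \<bullet> u))"
      by (simp add: inner_diff_left inner_diff_right inner_commute algebra_simps)
    also have "\<dots> = (dist x y)\<^sup>2" by (simp add: t w_def dist_norm power2_norm_eq_inner)
    finally show ?thesis by (simp add: power2_eq_iff_nonneg)
  qed
  moreover have "R a = b"
  proof -
    have "a - (1/2) *\<^sub>R (a + b) = (1/2) *\<^sub>R u" by (simp add: u_def algebra_simps flip: scaleR_add_left)
    then have "s a = 1" using u by (simp add: s_def)
    then show ?thesis by (simp add: R_def u_def)
  qed
  moreover have "R x = x" if "dist x a = dist x b" for x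
  proof -
    have "(x - a) \<bullet> (x - a) = (x - b) \<bullet> (x - b)"
      using that by (simp add: dist_norm power2_norm_eq_inner flip: power2_norm_eq_inner)
    then have "(x - (1/2) *\<^sub>R (a + b)) \<bullet> u = 0"
      by (simp add: u_def inner_diff_left inner_diff_right inner_add_left inner_add_right inner_commute algebra_simps)
    then show ?thesis by (simp add: R_def s_def)
  qed
  ultimately show ?thesis using that by blast
qed

text \<open>
  Once an isometry matches the points of \<open>S\<close>, the image of a further point and its required
  position have the same distances from all these matched points, so that one more bisector
  reflection repairs it and spoils nothing.
\<close>

lemma isometry_extension:
  fixes p q :: "'i \<Rightarrow> 'a::real_inner"
  assumes "finite S" "\<And>i j. i \<in> S \<Longrightarrow> j \<in> S \<Longrightarrow> dist (q i) (q j) = dist (p i) (p j)"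
  shows "\<exists>T. (\<forall>x y. dist (T x) (T y) = dist x y) \<and> (\<forall>i\<in>S. q i = T (p i))"
  using assms
proof (induction S rule: finite_induct)
  case empty
  then show ?case by (intro exI[of _ "\<lambda>x. x"]) auto
next
  case (insert k S)
  then obtain T where T: "\<And>x y. dist (T x) (T y) = dist x y" "\<And>i. i \<in> S \<Longrightarrow> q i = T (p i)"
    by (metis insertCI)
  obtain R where R: "\<And>x y. dist (R x) (R y) = dist x y" "R (T (p k)) = q k"
    "\<And>x. dist x (T (p k)) = dist x (q k) \<Longrightarrow> R x = x"
    using bisector_reflection[of "T (p k)" "q k"] by blast
  have "R (T (p i)) = q i" if "i \<in> S" for i
  proof -
    have "dist (T (p i)) (q k) = dist (p i) (p k)"
      using insert.prems[of i k] T(2)[OF that] that by simp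
    then show ?thesis using R(3)[of "T (p i)"] T that by simp
  qed
  then have "\<forall>i\<in>insert k S. q i = R (T (p i))" using R(2) by auto
  moreover have "\<forall>x y. dist (R (T x)) (R (T y)) = dist x y" by (simp add: R(1) T(1))
  ultimately show ?case by (intro exI[of _ "\<lambda>x. R (T x)"]) simp
qed

lemma congruent_iff_dist:
  "congruent n p q \<longleftrightarrow> (\<forall>i\<in>{1..n}. \<forall>j\<in>{1..n}. dist (q i) (q j) = dist (p i) (p j))"
proof
  assume "congruent n p q"
  then show "\<forall>i\<in>{1..n}. \<forall>j\<in>{1..n}. dist (q i) (q j) = dist (p i) (p j)"
    unfolding congruent_def by metis
next
  assume "\<forall>i\<in>{1..n}. \<forall>j\<in>{1..n}. dist (q i) (q j) = dist (p i) (p j)"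
  then show "congruent n p q"
    unfolding congruent_def by (intro isometry_extension) auto
qed

definition complete_edges :: "nat \<Rightarrow> (nat \<times> nat) set" where
  "complete_edges n = {(i, j). i \<in> {1..n} \<and> j \<in> {1..n} \<and> i < j}"

lemma simple_complete: "simple_graph n (complete_edges n)"
  by (simp add: simple_graph_def complete_edges_def)

lemma finite_complete_edges [simp]: "finite (complete_edges n)"
  by (rule finite_subset[of _ "{1..n} \<times> {1..n}"]) (auto simp: complete_edges_def)

lemma distance_map_eq_iff_congruent:
  "distance_map (complete_edges n) q = distance_map (complete_edges n) p \<longleftrightarrow> congruent n p q"
proof -
  have "distance_map (complete_edges n) q = distance_map (complete_edges n) p \<longleftrightarrow>
      (\<forall>(i, j)\<in>complete_edges n. dist (q j) (q i) = dist (p j) (p i))"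
    by (auto simp: distance_map_def fun_eq_iff restrict_def dist_norm)
  also have "\<dots> \<longleftrightarrow> (\<forall>i\<in>{1..n}. \<forall>j\<in>{1..n}. dist (q i) (q j) = dist (p i) (p j))"
    unfolding complete_edges_def
    by (auto simp: dist_commute) (metis dist_commute dist_self linorder_neqE_nat)
  finally show ?thesis by (simp add: congruent_iff_dist)
qed

lemma rigid_complete: "rigid_graph TYPE('d::finite) n (complete_edges n)"
proof -
  have *: "\<exists>\<epsilon>>0. \<forall>q\<in>configs n. config_dist n p q < \<epsilon> \<and>
      distance_map (complete_edges n) q = distance_map (complete_edges n) p \<longrightarrow> congruent n p q"
    for p :: "'d config"
    unfolding distance_map_eq_iff_congruent by (rule exI[of _ 1]) simp
  have "(\<lambda>i\<in>{1..n}. 0) \<in> (configs n :: 'd config set)"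
    by (simp add: configs_def)
  then have "\<exists>p\<in>configs n :: 'd config set. (1::real) \<noteq> 0"
    using one_neq_zero by blast
  moreover have "config_polynomial n (\<lambda>p :: 'd config. 1)" by (rule config_polynomial.const)
  ultimately have "\<exists>f. config_polynomial n f \<and> (\<exists>p\<in>configs n :: 'd config set. f p \<noteq> 0) \<and>
      (\<forall>p\<in>configs n. f p \<noteq> 0 \<longrightarrow> (\<exists>\<epsilon>>0. \<forall>q\<in>configs n. config_dist n p q < \<epsilon> \<and>
        distance_map (complete_edges n) q = distance_map (complete_edges n) p \<longrightarrow> congruent n p q))"
    by (intro exI[of _ "\<lambda>p. 1"]) (simp only: * simp_thms ball_triv)
  then show ?thesis unfolding rigid_graph_def generically_def .
qed

lemma controller_field_out_edges:
  assumes "simple_graph n E" "orientation E D" "k \<in> {1..n}"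
  shows "controller_field n E D (distance_map E ps) p k =
    - (\<Sum>j\<in>{j. (k, j) \<in> D}. ((norm (p k - p j))\<^sup>2 - (norm (ps k - ps j))\<^sup>2) *\<^sub>R (p k - p j))"
proof -
  define h where "h = (\<lambda>j. ((norm (p k - p j))\<^sup>2 - (norm (ps k - ps j))\<^sup>2) *\<^sub>R (p k - p j))"
  define G where "G e = (rigidity_apply n p p e - distance_map E ps e) *\<^sub>R directed_rigidity_matrix D p e k" for e
  have E: "finite E" "\<And>i j. (i, j) \<in> E \<Longrightarrow> i < j"
    using assms(1) finite_subset[OF _ finite_complete_edges, of E n]
    by (auto simp: simple_graph_def complete_edges_def)
  define f where "f j = (if k < j then (k, j) else (j, k))" for j
  have D: "(i, j) \<in> D \<Longrightarrow> (i, j) \<in> E \<or> (j, i) \<in> E" for i j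
    using assms(2) by (auto simp: orientation_def)
  have notboth: "(i, j) \<in> D \<Longrightarrow> (j, i) \<notin> D" for i j
    using assms(2) D[of i j] by (auto simp: orientation_def)
  have inj: "inj_on f {j. (k, j) \<in> D}" by (auto simp: inj_on_def f_def split: if_splits)
  have fE: "f ` {j. (k, j) \<in> D} \<subseteq> E" using D E(2) by (fastforce simp: f_def)
  have "(\<Sum>e\<in>E. G e) = (\<Sum>e\<in>f ` {j. (k, j) \<in> D}. G e)"
  proof (rule sum.mono_neutral_right[OF E(1) fE], safe)
    fix i j assume e: "(i, j) \<in> E" "(i, j) \<notin> f ` {j. (k, j) \<in> D}"
    have "directed_rigidity_matrix D p (i, j) k = 0"
    proof (cases "k = i \<or> k = j")
      case True
      then have "(k, if k = i then j else i) \<notin> D"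
        using e E(2)[OF e(1)] by (force simp: f_def image_iff)
      moreover have "((i, j) \<in> D) \<noteq> ((j, i) \<in> D)" using assms(2) e(1) by (auto simp: orientation_def)
      ultimately show ?thesis using True E(2)[OF e(1)]
        by (auto simp: directed_rigidity_matrix_def Let_def split: if_splits)
    qed (auto simp: directed_rigidity_matrix_def rigidity_matrix_def)
    then show "G (i, j) = 0" by (simp add: G_def)
  qed
  also have "\<dots> = (\<Sum>j\<in>{j. (k, j) \<in> D}. G (f j))" by (simp add: sum.reindex[OF inj])
  also have "\<dots> = (\<Sum>j\<in>{j. (k, j) \<in> D}. h j)"
  proof (rule sum.cong[OF refl], safe)
    fix j assume j: "(k, j) \<in> D"
    have fj: "f j \<in> E" using fE j by auto
    have "rigidity_apply n p p (a, b) = (norm (p a - p b))\<^sup>2" if "(a, b) \<in> E" for a b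
      by (simp add: rigidity_apply_edge[OF assms(1) that] power2_norm_eq_inner)
    then have "rigidity_apply n p p (f j) = (norm (p k - p j))\<^sup>2"
      using fj by (auto simp: f_def norm_minus_commute split: if_splits)
    moreover have "distance_map E ps (f j) = (norm (ps k - ps j))\<^sup>2"
      using fj by (auto simp: distance_map_def f_def norm_minus_commute split: if_splits)
    moreover have "directed_rigidity_matrix D p (f j) k = p k - p j"
    proof (cases "k < j")
      case True
      then show ?thesis using j by (simp add: f_def directed_rigidity_matrix_def rigidity_matrix_def)
    next
      case False
      then have "j < k" using fj E(2) by (auto simp: f_def)
      then show ?thesis using notboth[OF j] by (simp add: f_def directed_rigidity_matrix_def rigidity_matrix_def)
    qed
    ultimately show "G (f j) = h j" by (simp add: G_def h_def)
  qed
  finally show ?thesis using assms(3) by (simp add: controller_field_def G_def h_def)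
qed

section \<open>The transitive orientation: persistent but not stable\<close>

lemma at_within_atLeast: "(0::real) < t \<Longrightarrow> at t within {0..} = at t"
  by (rule at_within_interior) simp

text \<open>
  Solutions of the controller are differentiable only from the right at time 0, which is why the
  derivative is taken within the half-line.
\<close>

lemma decreasing_of_deriv_nonpos:
  fixes f :: "real \<Rightarrow> real"
  assumes "0 \<le> a" "a \<le> b"
    and d: "\<And>t. a \<le> t \<Longrightarrow> t \<le> b \<Longrightarrow> (f has_real_derivative f' t) (at t within {0..})"
    and "\<And>t. a < t \<Longrightarrow> t < b \<Longrightarrow> f' t \<le> 0"
  shows "f b \<le> f a"
proof (rule DERIV_nonpos_imp_decreasing_open[of a b f])
  show "continuous_on {a..b} f"
    by (rule DERIV_continuous_on, rule DERIV_subset[OF d]) (use assms(1) in auto)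
  show "\<exists>y. DERIV f x :> y \<and> y \<le> 0" if "a < x" "x < b" for x
    using d[of x] that assms at_within_atLeast[of x] by auto
qed (use assms in auto)

lemma orientation_transitive: "orientation (complete_edges n) ((complete_edges n)\<inverse>)"
  by (auto simp: orientation_def complete_edges_def)

lemma dist_eq_of_ordered_pairs:
  fixes i j :: "'i::linorder"
  assumes "\<And>i j. i \<in> S \<Longrightarrow> j \<in> S \<Longrightarrow> j < i \<Longrightarrow> dist (q i) (q j) = dist (p i) (p j)"
    and "i \<in> S" "j \<in> S"
  shows "dist (q i) (q j) = dist (p i) (p j)"
proof (cases i j rule: linorder_cases)
  case less
  then show ?thesis using assms(1)[of j i] assms(2,3) by (metis dist_commute)
next
  case equal
  then show ?thesis by simp
next
  case greater
  then show ?thesis using assms by blast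
qed

text \<open>
  Suppose that all constraints among the vertices before \<open>i\<close> hold. An isometry that carries their
  prescribed positions to the actual ones also carries \<open>p i\<close> to a point that satisfies every
  constraint of \<open>i\<close>. Fitting then forces the actual position of \<open>i\<close> to satisfy all of them as well.
\<close>

lemma fitting_transitive_congruent:
  fixes p p' :: "'d::finite config"
  assumes "fitting n ((complete_edges n)\<inverse>) (\<lambda>i j. dist (p i) (p j)) p'"
  shows "congruent n p p'"
proof -
  let ?D = "(complete_edges n)\<inverse>"
  have "\<forall>j. 1 \<le> j \<and> j < i \<longrightarrow> dist (p' i) (p' j) = dist (p i) (p j)" if "i \<le> n" for i
    using that
  proof (induction i rule: less_induct)
    case (less i)
    have "dist (p' k) (p' j) = dist (p k) (p j)" if "k \<in> {1..<i}" "j \<in> {1..<i}" for k j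
      by (rule dist_eq_of_ordered_pairs[of "{1..<i}"]) (use less.IH less.prems that in auto)
    then obtain T where T: "\<And>x y. dist (T x) (T y) = dist x y" "\<And>j. j \<in> {1..<i} \<Longrightarrow> p' j = T (p j)"
      using isometry_extension[of "{1..<i}" p' p] by (metis finite_atLeastLessThan)
    define A where "A x = {(k, j) \<in> ?D. k = i \<and> dist x (p' j) = dist (p i) (p j)}" for x
    have full: "A (T (p i)) = {(k, j) \<in> ?D. k = i}"
    proof -
      have "dist (T (p i)) (p' j) = dist (p i) (p j)" if "(i, j) \<in> ?D" for j
        using that T(1) T(2)[of j] by (simp add: complete_edges_def)
      then show ?thesis unfolding A_def by blast
    qed
    show ?case
    proof (intro allI impI)
      fix j assume j: "1 \<le> j \<and> j < i"
      then have i: "i \<in> {1..n}" using less.prems by auto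
      have "A (p' i) \<subseteq> A (T (p i))" unfolding full by (auto simp: A_def)
      moreover have "\<not> A (p' i) \<subset> A (T (p i))"
      proof
        assume "A (p' i) \<subset> A (T (p i))"
        then have "\<exists>x. A (p' i) \<subset> A x" by (rule exI)
        then show False using assms i unfolding fitting_def A_def by (metis (no_types, lifting))
      qed
      ultimately have "A (p' i) = A (T (p i))" by (metis psubsetI)
      moreover have "(i, j) \<in> A (T (p i))" using j i unfolding full by (simp add: complete_edges_def)
      ultimately have "(i, j) \<in> A (p' i)" by simp
      then show "dist (p' i) (p' j) = dist (p i) (p j)" by (simp add: A_def)
    qed
  qed note * = this
  have "dist (p' i) (p' j) = dist (p i) (p j)" if "i \<in> {1..n}" "j \<in> {1..n}" "j < i" for i j
    using *[of i] that by simp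
  then show ?thesis
    unfolding congruent_iff_dist by (intro ballI) (rule dist_eq_of_ordered_pairs)
qed

lemma persistent_transitive: "persistent TYPE('d::finite) n ((complete_edges n)\<inverse>)"
proof -
  have "persistent_config n ((complete_edges n)\<inverse>) p" for p :: "'d config"
    unfolding persistent_config_def by (rule exI[of _ 1]) (simp add: fitting_transitive_congruent)
  then show ?thesis by (simp add: persistent_def)
qed

lemma norm_le_config_dist:
  "i \<in> {1..n} \<Longrightarrow> norm (p i - q i) \<le> config_dist n p q"
  unfolding config_dist_def dist_norm[symmetric]
  by (rule member_le_L2_set) auto

lemma openin_configs_line:
  fixes ps :: "'d::finite config"
  assumes "openin (top_of_set (configs n)) W" "ps \<in> W" "k \<in> {1..n}"
  obtains \<eta> where "\<eta> > 0" "\<And>s. \<bar>s\<bar> < \<eta> \<Longrightarrow> ps(k := ps k + s *\<^sub>R e) \<in> W"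
proof -
  obtain O' where O: "open O'" "W = configs n \<inter> O'" using assms(1) by (auto simp: openin_open)
  define \<sigma> where "\<sigma> s = ps(k := ps k + s *\<^sub>R e)" for s
  have "continuous_on UNIV \<sigma>"
    unfolding \<sigma>_def
  proof (rule continuous_on_coordinatewise_then_product)
    fix i show "continuous_on UNIV (\<lambda>s. (ps(k := ps k + s *\<^sub>R e)) i)"
      by (cases "i = k") (auto intro!: continuous_intros)
  qed
  then have "open (\<sigma> -` O')" using O(1) by (simp add: continuous_on_open_vimage)
  moreover have "0 \<in> \<sigma> -` O'" using assms(2) O(2) by (simp add: \<sigma>_def)
  ultimately obtain \<eta> where \<eta>: "\<eta> > 0" "\<And>s. dist s 0 < \<eta> \<Longrightarrow> s \<in> \<sigma> -` O'"
    by (metis open_dist)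
  have "\<sigma> s \<in> W" if "\<bar>s\<bar> < \<eta>" for s
    using \<eta>(2)[of s] that assms O(2) by (auto simp: dist_norm \<sigma>_def configs_def PiE_def extensional_def)
  then show ?thesis using that \<eta>(1) by (auto simp: \<sigma>_def)
qed

text \<open>
  The true decay is of order \<open>1 / sqrt t\<close>. An exponential lower bound whose rate is proportional to
  \<open>|u 0|\<^sup>2\<close> is enough to refute a given exponential rate, because the initial value may be taken as
  small as desired.
\<close>

lemma cubic_decay_lower_bound:
  fixes u :: "real \<Rightarrow> 'a::real_inner"
  assumes "\<And>t. t \<ge> 0 \<Longrightarrow> (u has_vector_derivative - ((norm (u t))\<^sup>2 *\<^sub>R u t)) (at t within {0..})" "0 \<le> t"
  shows "(norm (u 0))\<^sup>2 * exp (- 2 * (norm (u 0))\<^sup>2 * t) \<le> (norm (u t))\<^sup>2"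
proof -
  define \<phi> where "\<phi> t = u t \<bullet> u t" for t
  have \<phi>: "(norm (u t))\<^sup>2 = \<phi> t" for t by (simp add: \<phi>_def power2_norm_eq_inner)
  have d: "(\<phi> has_real_derivative - 2 * (\<phi> t)\<^sup>2) (at t within {0..})" if "t \<ge> 0" for t
    unfolding \<phi>_def has_real_derivative_iff_has_vector_derivative
    by (rule has_vector_derivative_eq_rhs[OF bounded_bilinear.has_vector_derivative[OF bounded_bilinear_inner
            assms(1)[OF that] assms(1)[OF that]]])
      (simp add: \<phi> power2_eq_square[of "\<phi> t"] flip: \<phi>_def)
  have le: "\<phi> t \<le> \<phi> 0" if "0 \<le> t" for t
    by (rule decreasing_of_deriv_nonpos[OF _ that d]) auto
  have pos: "0 \<le> \<phi> t" for t by (simp add: \<phi>_def)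
  have "- (\<phi> t * exp (2 * \<phi> 0 * t)) \<le> - (\<phi> 0 * exp (2 * \<phi> 0 * 0))"
  proof (rule decreasing_of_deriv_nonpos[OF _ assms(2)])
    show "((\<lambda>t. - (\<phi> t * exp (2 * \<phi> 0 * t))) has_real_derivative
        - (2 * exp (2 * \<phi> 0 * s) * (\<phi> s * (\<phi> 0 - \<phi> s)))) (at s within {0..})" if "0 \<le> s" for s
      by (auto intro!: derivative_eq_intros d that simp: algebra_simps power2_eq_square)
    show "- (2 * exp (2 * \<phi> 0 * s) * (\<phi> s * (\<phi> 0 - \<phi> s))) \<le> 0" if "0 < s" for s
      using le[of s] pos[of s] that by simp
  qed simp
  then have "\<phi> 0 * exp (- (2 * \<phi> 0 * t)) \<le> \<phi> t * exp (2 * \<phi> 0 * t) * exp (- (2 * \<phi> 0 * t))"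
    by (intro mult_right_mono) auto
  then show ?thesis by (simp add: \<phi> mult.assoc flip: exp_add)
qed

text \<open>
  Vertex 1 never moves, and vertex 2 is displaced by so little that the lower bound above decays
  more slowly than the claimed rate.
\<close>

lemma not_stable_coincident:
  fixes ps :: "'d::finite config"
  assumes n: "2 \<le> n" and coincide: "ps 2 = ps 1"
  shows "\<not> locally_exponentially_stable n (complete_edges n) ((complete_edges n)\<inverse>) ps"
proof
  let ?E = "complete_edges n"
  assume "locally_exponentially_stable n ?E (?E\<inverse>) ps"
  then obtain U W K c where W: "openin (top_of_set (configs n)) W" "ps \<in> W" "W \<subseteq> U"
    and Kc: "K > 0" "c > 0"
    and sol: "\<And>p0. p0 \<in> U \<Longrightarrow> \<exists>p. controller_solution n ?E (?E\<inverse>) (distance_map ?E ps) p \<and> p 0 = p0 \<and>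
           (\<exists>q\<in>U. congruent n ps q \<and> (\<forall>t\<ge>0. config_dist n (p t) q \<le> K * exp (- c * t)))"
    unfolding locally_exponentially_stable_def by metis
  obtain e :: "real ^ 'd" where e: "norm e = 1" by (metis norm_axis_1)
  obtain \<eta> where \<eta>: "\<eta> > 0" "\<And>s. \<bar>s\<bar> < \<eta> \<Longrightarrow> ps(2 := ps 2 + s *\<^sub>R e) \<in> W"
    using openin_configs_line[OF W(1,2), of 2 e] n by auto
  define s where "s = min (\<eta> / 2) (sqrt c / 2)"
  have s: "0 < s" "\<bar>s\<bar> < \<eta>" "s\<^sup>2 < c"
  proof -
    show "0 < s" "\<bar>s\<bar> < \<eta>" using \<eta>(1) Kc by (auto simp: s_def min_def)
    have "s\<^sup>2 \<le> (sqrt c / 2)\<^sup>2" using \<open>0 < s\<close> by (intro power_mono) (auto simp: s_def)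
    then show "s\<^sup>2 < c" using Kc by (simp add: power_divide)
  qed
  obtain p q where p: "controller_solution n ?E (?E\<inverse>) (distance_map ?E ps) p" "p 0 = ps(2 := ps 2 + s *\<^sub>R e)"
    and q: "congruent n ps q" "\<And>t. t \<ge> 0 \<Longrightarrow> config_dist n (p t) q \<le> K * exp (- c * t)"
    using sol[of "ps(2 := ps 2 + s *\<^sub>R e)"] \<eta>(2)[OF s(2)] W(3) by blast
  \<comment> \<open>The displacement of the two vertices that coincide at the target.\<close>
  define u where "u t = p t 2 - p t 1" for t
  have field: "controller_field n ?E (?E\<inverse>) (distance_map ?E ps) x 1 = 0"
      "controller_field n ?E (?E\<inverse>) (distance_map ?E ps) x 2 = - ((norm (x 2 - x 1))\<^sup>2 *\<^sub>R (x 2 - x 1))" for x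
  proof -
    have "{j. (1, j) \<in> ?E\<inverse>} = {}" "{j. (2, j) \<in> ?E\<inverse>} = {1}"
      using n by (auto simp: complete_edges_def)
    then show "controller_field n ?E (?E\<inverse>) (distance_map ?E ps) x 1 = 0"
      "controller_field n ?E (?E\<inverse>) (distance_map ?E ps) x 2 = - ((norm (x 2 - x 1))\<^sup>2 *\<^sub>R (x 2 - x 1))"
      using n by (simp_all add: controller_field_out_edges[OF simple_complete orientation_transitive] coincide)
  qed
  have "(u has_vector_derivative - ((norm (u t))\<^sup>2 *\<^sub>R u t)) (at t within {0..})" if "t \<ge> 0" for t
  proof -
    have "((\<lambda>s. p s k) has_vector_derivative controller_field n ?E (?E\<inverse>) (distance_map ?E ps) (p t) k)
        (at t within {0..})" if "k \<in> {1..n}" for k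
      using p(1) \<open>t \<ge> 0\<close> that unfolding controller_solution_def by blast
    from has_vector_derivative_diff[OF this this, of 2 1] show ?thesis
      unfolding field u_def using n by simp
  qed
  note low = cubic_decay_lower_bound[OF this]
  have u0: "(norm (u 0))\<^sup>2 = s\<^sup>2" by (simp add: u_def p(2) coincide e)
  have up: "norm (u t) \<le> 2 * K * exp (- c * t)" if "t \<ge> 0" for t
  proof -
    have "dist (q 2) (q 1) = dist (ps 2) (ps 1)" using q(1) n by (auto simp: congruent_iff_dist)
    then have "u t = (p t 2 - q 2) - (p t 1 - q 1)" by (simp add: u_def coincide)
    then have "norm (u t) \<le> norm (p t 2 - q 2) + norm (p t 1 - q 1)" by (metis norm_triangle_ineq4)
    also have "\<dots> \<le> config_dist n (p t) q + config_dist n (p t) q"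
      using n by (intro add_mono norm_le_config_dist) auto
    finally show ?thesis using q(2)[OF that] by simp
  qed
  \<comment> \<open>A time at which the two exponential bounds contradict each other.\<close>
  define t where "t = 4 * K\<^sup>2 / s\<^sup>2 / (2 * (c - s\<^sup>2))"
  have t: "t \<ge> 0" "2 * (c - s\<^sup>2) * t = 4 * K\<^sup>2 / s\<^sup>2" using s by (auto simp: t_def)
  have "s\<^sup>2 * exp (- 2 * s\<^sup>2 * t) \<le> (2 * K * exp (- c * t))\<^sup>2"
    using low[of t] up[of t] t(1) u0 power_mono[of "norm (u t)" "2 * K * exp (- c * t)" 2] by simp
  also have "\<dots> = 4 * K\<^sup>2 * exp (- 2 * c * t)"
    using exp_double[of "- c * t"] by (simp add: power_mult_distrib mult.assoc)
  finally have "s\<^sup>2 * exp (- 2 * s\<^sup>2 * t) * exp (2 * c * t) \<le> 4 * K\<^sup>2 * exp (- 2 * c * t) * exp (2 * c * t)"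
    by (rule mult_right_mono) simp
  moreover have "exp (- 2 * s\<^sup>2 * t) * exp (2 * c * t) = exp (2 * (c - s\<^sup>2) * t)"
      "exp (- 2 * c * t) * exp (2 * c * t) = 1"
    by (subst exp_add[symmetric], simp add: algebra_simps)+
  ultimately have "s\<^sup>2 * exp (2 * (c - s\<^sup>2) * t) \<le> 4 * K\<^sup>2"
    by (simp only: mult.assoc mult_1_right)
  then have "exp (2 * (c - s\<^sup>2) * t) \<le> 4 * K\<^sup>2 / s\<^sup>2" using s by (simp add: field_simps)
  then show False using exp_ge_add_one_self[of "2 * (c - s\<^sup>2) * t"] t(2) by linarith
qed

section \<open>Smoothness of polynomial functions\<close>

text \<open>
  All defining functions of the image of the distance map that are used below are polynomials; this
  class is closed under partial derivatives, which makes smoothness immediate.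
\<close>

inductive poly_fun :: "'i set \<Rightarrow> (('i \<Rightarrow> real) \<Rightarrow> real) \<Rightarrow> bool" for I where
  const: "poly_fun I (\<lambda>x. c)"
| coord: "i \<in> I \<Longrightarrow> poly_fun I (\<lambda>x. x i)"
| add: "poly_fun I f \<Longrightarrow> poly_fun I g \<Longrightarrow> poly_fun I (\<lambda>x. f x + g x)"
| mult: "poly_fun I f \<Longrightarrow> poly_fun I g \<Longrightarrow> poly_fun I (\<lambda>x. f x * g x)"

lemma poly_fun_sum:
  assumes "\<And>a. a \<in> A \<Longrightarrow> poly_fun I (f a)"
  shows "poly_fun I (\<lambda>x. \<Sum>a\<in>A. f a x)"
  using assms
  by (induction A rule: infinite_finite_induct) (simp_all add: poly_fun.const poly_fun.add)

lemma poly_fun_prod: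
  assumes "\<And>a. a \<in> A \<Longrightarrow> poly_fun I (f a)"
  shows "poly_fun I (\<lambda>x. \<Prod>a\<in>A. f a x)"
  using assms
  by (induction A rule: infinite_finite_induct) (simp_all add: poly_fun.const poly_fun.mult)

lemma poly_fun_diff: "poly_fun I f \<Longrightarrow> poly_fun I g \<Longrightarrow> poly_fun I (\<lambda>x. f x - g x)"
  using poly_fun.add[OF _ poly_fun.mult[OF poly_fun.const[of I "-1"]], of f g] by simp

lemma poly_fun_det:
  assumes "\<And>a b. poly_fun I (\<lambda>x. M x $ a $ b)"
  shows "poly_fun I (\<lambda>x. det (M x :: real ^ 'd ^ 'd))"
  unfolding det_def by (intro poly_fun_sum poly_fun.mult poly_fun.const poly_fun_prod assms)

lemma poly_fun_continuous: "poly_fun I f \<Longrightarrow> continuous_on S f"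
proof (induction rule: poly_fun.induct)
  case (coord i)
  show ?case by (rule continuous_on_subset[OF continuous_on_product_coordinates]) simp
next
  case (mult f g)
  show ?case by (rule continuous_on_mult[OF mult.IH])
next
  case (add f g)
  show ?case by (rule continuous_on_add[OF add.IH])
qed (rule continuous_on_const)

lemma poly_fun_has_partial:
  "poly_fun I f \<Longrightarrow> \<exists>g. poly_fun I g \<and> (\<forall>x. ((\<lambda>t. f (x(i := t))) has_real_derivative g x) (at (x i)))"
proof (induction rule: poly_fun.induct)
  case (const c)
  show ?case by (rule exI[of _ "\<lambda>x. 0"]) (simp add: poly_fun.const)
next
  case (coord j)
  show ?case
    by (rule exI[of _ "\<lambda>x. if i = j then 1 else 0"]) (auto simp: poly_fun.const)
next
  case (add f g)
  then obtain f' g' where "poly_fun I f'" "poly_fun I g'"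
    and d: "\<And>x. ((\<lambda>t. f (x(i := t))) has_real_derivative f' x) (at (x i))"
      "\<And>x. ((\<lambda>t. g (x(i := t))) has_real_derivative g' x) (at (x i))" by blast
  then show ?case
    by (intro exI[of _ "\<lambda>x. f' x + g' x"] conjI poly_fun.add allI DERIV_add)
next
  case (mult f g)
  then obtain f' g' where p: "poly_fun I f'" "poly_fun I g'"
    and d: "\<And>x. ((\<lambda>t. f (x(i := t))) has_real_derivative f' x) (at (x i))"
      "\<And>x. ((\<lambda>t. g (x(i := t))) has_real_derivative g' x) (at (x i))" by blast
  have "((\<lambda>t. f (x(i := t)) * g (x(i := t))) has_real_derivative f' x * g x + g' x * f x) (at (x i))" for x
    using DERIV_mult[OF d(1)[of x] d(2)[of x]] by simp
  moreover have "poly_fun I (\<lambda>x. f' x * g x + g' x * f x)"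
    by (intro poly_fun.add poly_fun.mult p mult.hyps)
  ultimately show ?case by (intro exI[of _ "\<lambda>x. f' x * g x + g' x * f x"] conjI allI)
qed

lemma poly_fun_partial:
  assumes "poly_fun I f"
  shows "poly_fun I (partial i f)"
    and "((\<lambda>t. f (x(i := t))) has_real_derivative partial i f x) (at (x i))"
proof -
  obtain g where g: "poly_fun I g" "\<And>x. ((\<lambda>t. f (x(i := t))) has_real_derivative g x) (at (x i))"
    using poly_fun_has_partial[OF assms] by blast
  have eq: "partial i f = g" unfolding partial_def using g(2) by (intro ext DERIV_imp_deriv)
  show "poly_fun I (partial i f)"
    "((\<lambda>t. f (x(i := t))) has_real_derivative partial i f x) (at (x i))" unfolding eq by (rule g)+
qed

lemma poly_fun_C_k_on: "poly_fun I f \<Longrightarrow> C_k_on k I W f"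
proof (induction k arbitrary: f)
  case (Suc k)
  have "(\<lambda>t. f (x(i := t))) differentiable at (x i)" for i x
    using poly_fun_partial(2)[OF Suc.prems] real_differentiable_def by blast
  moreover have "C_k_on k I W (partial i f)" for i
    by (rule Suc.IH) (rule poly_fun_partial(1)[OF Suc.prems])
  moreover have "continuous_on W f" using Suc.prems by (rule poly_fun_continuous)
  ultimately show ?case by (simp only: C_k_on.simps simp_thms ball_triv)
qed (simp only: C_k_on.simps poly_fun_continuous)

lemma partial_diff:
  assumes "poly_fun I f" "poly_fun I g"
  shows "partial i (\<lambda>x. f x - g x) x = partial i f x - partial i g x"
  unfolding partial_def[of i "\<lambda>x. f x - g x"]
  by (rule DERIV_imp_deriv, rule DERIV_diff) (rule poly_fun_partial(2), fact)+

lemma partial_mult: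
  assumes "poly_fun I f" "poly_fun I g"
  shows "partial i (\<lambda>x. f x * g x) x = partial i f x * g x + partial i g x * f x"
proof -
  have "((\<lambda>t. f (x(i := t)) * g (x(i := t))) has_real_derivative
      partial i f x * g (x(i := x i)) + partial i g x * f (x(i := x i))) (at (x i))"
    by (rule DERIV_mult) (rule poly_fun_partial(2), fact)+
  then show ?thesis unfolding partial_def[of i "\<lambda>x. f x * g x"] fun_upd_triv by (rule DERIV_imp_deriv)
qed

lemma partial_sum:
  assumes "\<And>a. a \<in> A \<Longrightarrow> poly_fun I (f a)"
  shows "partial i (\<lambda>x. \<Sum>a\<in>A. f a x) x = (\<Sum>a\<in>A. partial i (f a) x)"
  unfolding partial_def[of i "\<lambda>x. \<Sum>a\<in>A. f a x"]
  by (rule DERIV_imp_deriv, rule DERIV_sum, rule poly_fun_partial(2)) (rule assms)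

lemma partial_coord: "partial i (\<lambda>x. x j) x = (if i = j then 1 else 0)"
  by (subst partial_def, rule DERIV_imp_deriv) auto

lemma partial_eq_0: "(\<And>t. f (x(i := t)) = f x) \<Longrightarrow> partial i f x = 0"
  by (simp add: partial_def)

section \<open>Gram matrices\<close>

text \<open>
  The map \<open>N \<mapsto> N N\<^sup>T + (N - N\<^sup>T)\<close> has the derivative \<open>h \<mapsto> 2 h\<close> at the identity, hence its
  range contains a neighbourhood of the identity. The summand \<open>N - N\<^sup>T\<close> only serves to make the
  derivative invertible: if the value is symmetric, this skew part vanishes.
\<close>

lemma symmetric_near_identity_factor:
  obtains r where "r > 0"
    "\<And>A :: real ^ 'd ^ 'd. transpose A = A \<Longrightarrow> dist A (mat 1) < r \<Longrightarrow> \<exists>N :: real ^ 'd ^ 'd. A = N ** transpose N"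
proof -
  define \<Phi> :: "real ^ 'd ^ 'd \<Rightarrow> real ^ 'd ^ 'd" where "\<Phi> N = N ** transpose N + (N - transpose N)" for N
  have trl: "bounded_linear (transpose :: real ^ 'd ^ 'd \<Rightarrow> real ^ 'd ^ 'd)"
    by (intro linear_conv_bounded_linear[THEN iffD1] linearI) (simp_all add: transpose_def vec_eq_iff)
  have mml: "bounded_bilinear ((**) :: real ^ 'd ^ 'd \<Rightarrow> real ^ 'd ^ 'd \<Rightarrow> real ^ 'd ^ 'd)"
    unfolding bilinear_conv_bounded_bilinear[symmetric] bilinear_def linear_iff
    by (simp add: matrix_matrix_mult_def vec_eq_iff sum.distrib sum_distrib_left algebra_simps)
  have d: "(\<Phi> has_derivative (\<lambda>h. h + transpose h + (h - transpose h))) (at (mat 1))"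
    unfolding \<Phi>_def
    by (rule has_derivative_eq_rhs,
        (rule derivative_intros bounded_bilinear.FDERIV[OF mml] bounded_linear.has_derivative[OF trl])+)
      (simp add: fun_eq_iff)
  have "\<Phi> (mat 1) \<in> interior (\<Phi> ` UNIV)"
  proof (rule sussmann_open_mapping[OF open_UNIV _ UNIV_I d])
    show "continuous_on UNIV \<Phi>"
      unfolding \<Phi>_def
      by (intro continuous_intros bounded_bilinear.continuous_on[OF mml] bounded_linear.continuous_on[OF trl])
    show "bounded_linear (\<lambda>h :: real ^ 'd ^ 'd. (1/2) *\<^sub>R h)" by (rule bounded_linear_scaleR_right)
    show "(\<lambda>h. h + transpose h + (h - transpose h)) \<circ> (\<lambda>h. (1/2) *\<^sub>R h) = id"
      by (auto simp: fun_eq_iff simp flip: scaleR_add_left)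
  qed auto
  then obtain r where r: "r > 0" "ball (mat 1) r \<subseteq> range \<Phi>"
    by (auto simp: mem_interior \<Phi>_def)
  have "\<exists>N :: real ^ 'd ^ 'd. A = N ** transpose N" if A: "transpose A = A" "dist A (mat 1) < r" for A :: "real ^ 'd ^ 'd"
  proof -
    have "A \<in> range \<Phi>" using r(2) A(2) by (auto simp: dist_commute)
    then obtain N where N: "A = N ** transpose N + (N - transpose N)"
      unfolding \<Phi>_def by blast
    have tr: "transpose (X + Y) = transpose X + transpose Y" "transpose (X - Y) = transpose X - transpose Y"
      for X Y :: "real ^ 'd ^ 'd" by (simp_all add: transpose_def vec_eq_iff)
    have "A = transpose A" by (simp only: A(1))
    also have "\<dots> = N ** transpose N + (transpose N - N)"
      by (simp only: N tr matrix_transpose_mul transpose_transpose)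
    finally have "N - transpose N = transpose N - N" unfolding N by (simp only: add_left_cancel)
    then have "2 *\<^sub>R (N - transpose N) = 0" by (simp only: scaleR_2) (metis add.right_inverse minus_diff_eq)
    then have "N - transpose N = 0" by (simp only: scaleR_eq_0_iff) simp
    then have "A = N ** transpose N" by (simp only: N add_0_right)
    then show ?thesis by (rule exI)
  qed
  then show ?thesis using that r(1) by blast
qed

text \<open>
  By Cramer's rule, the determinants on the right are \<open>det A\<close> times the coordinates of the vector \<open>x\<close>
  with \<open>N\<^sup>T x = v\<close>. The identity says that \<open>u \<bullet> v\<close> is determined by the products of \<open>u\<close> and \<open>v\<close>
  with a basis, in a form that is polynomial in these products.
\<close>

lemma gram_schur_complement:
  fixes N :: "real ^ 'd ^ 'd"
  assumes A: "A = N ** transpose N" "det A \<noteq> 0"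
  shows "det A * (u \<bullet> v) = (\<Sum>a\<in>UNIV. (N *v u) $ a * det (\<chi> i j. if j = a then (N *v v) $ i else A $ i $ j))"
proof -
  have "det (transpose N) \<noteq> 0" using A by (auto simp: det_mul)
  then obtain x where x: "transpose N *v x = v"
    using invertible_det_nz[of "transpose N"] by (metis invertible_def matrix_vector_mul_assoc matrix_vector_mul_lid)
  have Ax: "A *v x = N *v v" by (simp only: A(1) matrix_vector_mul_assoc[symmetric] x)
  have "det (\<chi> i j. if j = a then (N *v v) $ i else A $ i $ j) = x $ a * det A" for a
    by (rule cramer_lemma[of a A x, unfolded Ax])
  then have "(\<Sum>a\<in>UNIV. (N *v u) $ a * det (\<chi> i j. if j = a then (N *v v) $ i else A $ i $ j))
      = det A * ((N *v u) \<bullet> x)"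
    by (simp add: inner_vec_def sum_distrib_left mult_ac)
  also have "(N *v u) \<bullet> x = u \<bullet> (transpose N *v x)"
    using dot_lmul_matrix[of x N u] by (simp add: inner_commute)
  finally show ?thesis unfolding x by (rule sym)
qed

section \<open>The target configuration\<close>

definition coord_index :: "'d::finite \<Rightarrow> nat" where
  "coord_index = (SOME f. bij_betw f UNIV {0..<CARD('d)})"

lemma bij_coord_index: "bij_betw (coord_index :: 'd::finite \<Rightarrow> nat) UNIV {0..<CARD('d)}"
  unfolding coord_index_def
  by (rule someI_ex[OF ex_bij_betw_finite_nat[OF finite]])

definition basis_vertex :: "nat \<Rightarrow> 'd::finite \<Rightarrow> nat" where
  "basis_vertex m a = m + 1 + coord_index a"

lemma basis_vertex_gt: "m < basis_vertex m a"
  by (simp add: basis_vertex_def)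

lemma coord_index_eq_iff [simp]: "coord_index a = coord_index b \<longleftrightarrow> (a :: 'd::finite) = b"
  using bij_coord_index[where 'd = 'd] by (auto simp: bij_betw_def inj_eq)

lemma basis_vertex_eq_iff [simp]: "basis_vertex m a = basis_vertex m b \<longleftrightarrow> a = b"
  by (simp add: basis_vertex_def)

lemma basis_vertex_range:
  "basis_vertex m ` (UNIV :: 'd::finite set) = {m+1..m + CARD('d)}"
proof -
  have "basis_vertex m ` (UNIV :: 'd set) = (\<lambda>k. m + 1 + k) ` (coord_index ` (UNIV :: 'd set))"
    by (simp add: basis_vertex_def image_image)
  also have "\<dots> = (\<lambda>k. m + 1 + k) ` {0..<CARD('d)}"
    using bij_coord_index[where 'd = 'd] by (simp only: bij_betw_def)
  also have "\<dots> = {m+1..m + CARD('d)}"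
    using image_add_atLeastLessThan[of "m + 1" 0 "CARD('d)"] by auto
  finally show ?thesis .
qed

lemma basis_vertex_mem: "basis_vertex m (a :: 'd::finite) \<in> {1..m + CARD('d)}"
  using rangeI[of "basis_vertex m" a] unfolding basis_vertex_range by simp

lemma vertex_cases:
  assumes "i \<in> {1..m + CARD('d)}"
  obtains "i \<in> {1..m}" | a :: "'d::finite" where "i = basis_vertex m a"
proof (cases "i \<le> m")
  case False
  then have "i \<in> basis_vertex m ` (UNIV :: 'd set)" using assms by (simp add: basis_vertex_range)
  then show ?thesis using that(2) by blast
qed (use assms that(1) in simp)

definition target :: "nat \<Rightarrow> 'd::finite config" where
  "target m = (\<lambda>i\<in>{1..m + CARD('d)}. \<chi> a. if i = basis_vertex m a then 1 else 0)"

lemma target_zero: "i \<in> {1..m} \<Longrightarrow> (target m i :: real ^ 'd::finite) = 0"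
  by (auto simp: target_def vec_eq_iff basis_vertex_def)

lemma target_basis: "target m (basis_vertex m a) = axis (a :: 'd::finite) 1"
  using basis_vertex_mem[of m a] by (auto simp: target_def vec_eq_iff axis_def)

lemma target_configs: "target m \<in> (configs (m + CARD('d)) :: 'd::finite config set)"
  by (simp add: target_def configs_def)

section \<open>Regularity of the target configuration\<close>

text \<open>
  Squared lengths are stored for \<open>i < j\<close> only; this is the symmetric access to them.
\<close>

definition edge_value :: "(nat \<times> nat \<Rightarrow> real) \<Rightarrow> nat \<Rightarrow> nat \<Rightarrow> real" where
  "edge_value y i j = (if i < j then y (i, j) else if j < i then y (j, i) else 0)"

text \<open>
  The law of cosines: for the squared lengths of \<open>p\<close> this is the inner product of \<open>p i - p 1\<close> and
  \<open>p j - p 1\<close>.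
\<close>

definition gram :: "(nat \<times> nat \<Rightarrow> real) \<Rightarrow> nat \<Rightarrow> nat \<Rightarrow> real" where
  "gram y i j = (edge_value y 1 i + edge_value y 1 j - edge_value y i j) / 2"

lemma edge_value_commute: "edge_value y i j = edge_value y j i"
  by (simp add: edge_value_def)

lemma gram_commute: "gram y i j = gram y j i"
  by (simp add: gram_def edge_value_commute[of y i j])

lemma edge_value_self [simp]: "edge_value y i i = 0"
  by (simp add: edge_value_def)

lemma edge_value_gram: "edge_value y i j = gram y i i + gram y j j - 2 * gram y i j"
  by (simp add: gram_def field_simps)

lemma edge_value_distance_map:
  "i \<in> {1..n} \<Longrightarrow> j \<in> {1..n} \<Longrightarrow> edge_value (distance_map (complete_edges n) p) i j = (norm (p i - p j))\<^sup>2"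
  by (auto simp: edge_value_def distance_map_def complete_edges_def norm_minus_commute)

lemma inner_eq_norms: "(x - o1) \<bullet> (y - o1) = ((norm (o1 - x))\<^sup>2 + (norm (o1 - y))\<^sup>2 - (norm (x - y))\<^sup>2) / 2"
  for x y o1 :: "'a::real_inner"
  by (simp add: power2_norm_eq_inner inner_diff_left inner_diff_right inner_commute)

lemma gram_distance_map:
  assumes "i \<in> {1..n}" "j \<in> {1..n}"
  shows "gram (distance_map (complete_edges n) p) i j = (p i - p 1) \<bullet> (p j - p 1)"
proof -
  have "1 \<in> {1..n}" using assms by auto
  with assms show ?thesis by (simp only: gram_def edge_value_distance_map inner_eq_norms)
qed

definition gram_matrix :: "nat \<Rightarrow> (nat \<times> nat \<Rightarrow> real) \<Rightarrow> real ^ 'd::finite ^ 'd" where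
  "gram_matrix m y = (\<chi> a b. gram y (basis_vertex m a) (basis_vertex m b))"

definition gram_row :: "nat \<Rightarrow> (nat \<times> nat \<Rightarrow> real) \<Rightarrow> nat \<Rightarrow> real ^ 'd::finite" where
  "gram_row m y i = (\<chi> a. gram y i (basis_vertex m a))"

definition replace_column :: "real ^ 'd ^ 'd \<Rightarrow> 'd \<Rightarrow> real ^ 'd \<Rightarrow> real ^ 'd ^ 'd" where
  "replace_column A a w = (\<chi> i j. if j = a then w $ i else A $ i $ j)"

text \<open>
  Up to sign the determinant of the Gram matrix bordered by the rows of \<open>i\<close> and \<open>j\<close>. If the
  Gram matrix is invertible, it vanishes if and only if the product of \<open>i\<close> and \<open>j\<close> is the one that
  their products with the basis vertices dictate.
\<close>

definition defect :: "'d::finite itself \<Rightarrow> nat \<Rightarrow> nat \<Rightarrow> nat \<Rightarrow> (nat \<times> nat \<Rightarrow> real) \<Rightarrow> real" where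
  "defect T m i j y = det (gram_matrix m y :: real ^ 'd ^ 'd) * gram y i j -
     (\<Sum>a\<in>UNIV. gram_row m y i $ a * det (replace_column (gram_matrix m y) a (gram_row m y j :: real ^ 'd)))"

text \<open>
  The constraints are the defects of all pairs \<open>i \<le> j\<close> from \<open>{2..m}\<close>. Indexing them by the edges
  within \<open>{1..m}\<close>, where \<open>(1, j)\<close> stands for the pair \<open>(j, j)\<close>, makes their Jacobian triangular.
\<close>

definition first_end :: "nat \<times> nat \<Rightarrow> nat" where
  "first_end e = (if fst e = 1 then snd e else fst e)"

abbreviation constraint :: "'d::finite itself \<Rightarrow> nat \<Rightarrow> nat \<times> nat \<Rightarrow> (nat \<times> nat \<Rightarrow> real) \<Rightarrow> real" where
  "constraint T m e \<equiv> defect T m (first_end e) (snd e)"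

lemma poly_fun_edge_value:
  "i \<in> {1..n} \<Longrightarrow> j \<in> {1..n} \<Longrightarrow> poly_fun (complete_edges n) (\<lambda>y. edge_value y i j)"
  by (cases i j rule: linorder_cases)
    (auto simp: edge_value_def complete_edges_def intro!: poly_fun.const poly_fun.coord)

lemma poly_fun_gram:
  assumes "i \<in> {1..n}" "j \<in> {1..n}"
  shows "poly_fun (complete_edges n) (\<lambda>y. gram y i j)"
proof -
  have "1 \<in> {1..n}" using assms by auto
  then have "poly_fun (complete_edges n) (\<lambda>y. (1/2) * (edge_value y 1 i + edge_value y 1 j - edge_value y i j))"
    by (intro poly_fun.mult poly_fun.const poly_fun_diff poly_fun.add poly_fun_edge_value assms)
  then show ?thesis by (simp add: gram_def)
qed

lemma poly_fun_gram_matrix: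
  "poly_fun (complete_edges (m + CARD('d))) (\<lambda>y. gram_matrix m y $ a $ (b :: 'd::finite))"
  unfolding gram_matrix_def vec_lambda_beta by (rule poly_fun_gram[OF basis_vertex_mem basis_vertex_mem])

lemma poly_fun_gram_row:
  "i \<in> {1..m} \<Longrightarrow> poly_fun (complete_edges (m + CARD('d))) (\<lambda>y. gram_row m y i $ (a :: 'd::finite))"
  unfolding gram_row_def vec_lambda_beta by (rule poly_fun_gram[OF _ basis_vertex_mem]) simp

lemma poly_fun_replace_column:
  assumes "i \<in> {1..m}"
  shows "poly_fun (complete_edges (m + CARD('d)))
    (\<lambda>y. det (replace_column (gram_matrix m y) a (gram_row m y i :: real ^ 'd::finite)))"
proof (rule poly_fun_det)
  fix b c
  show "poly_fun (complete_edges (m + CARD('d)))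
    (\<lambda>y. replace_column (gram_matrix m y) a (gram_row m y i :: real ^ 'd) $ b $ c)"
    unfolding replace_column_def vec_lambda_beta
    using poly_fun_gram_row[OF assms, of b] poly_fun_gram_matrix[of m b c] by (cases "c = a") simp_all
qed

lemma poly_fun_defect:
  assumes "i \<in> {1..m}" "j \<in> {1..m}"
  shows "poly_fun (complete_edges (m + CARD('d))) (defect TYPE('d::finite) m i j)"
  unfolding defect_def[abs_def]
  by (intro poly_fun_diff poly_fun.mult poly_fun_sum poly_fun_det poly_fun_gram_matrix
      poly_fun_gram poly_fun_gram_row poly_fun_replace_column assms)
    (use assms in auto)

lemma partial_gram_other:
  assumes "e \<noteq> (1, i)" "e \<noteq> (1, j)" "e \<noteq> (i, j)" "e \<noteq> (j, i)" "1 \<le> i" "1 \<le> j"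
  shows "gram (y(e := t)) i j = gram y i j"
  using assms by (auto simp: gram_def edge_value_def)

text \<open>
  The constraint of \<open>e'\<close> sees no other edge within \<open>{1..m}\<close> than \<open>e'\<close> itself and, if \<open>e'\<close> avoids the
  base vertex 1, the two edges that join its ends to 1.
\<close>

lemma partial_constraint_other:
  assumes e: "e \<in> complete_edges m" "e' \<in> complete_edges m" "e \<noteq> e'" and "fst e \<noteq> 1 \<or> fst e' = 1"
  shows "partial e (constraint TYPE('d::finite) m e') y = 0"
proof (rule partial_eq_0)
  fix t
  obtain i j i' j' where ij: "e = (i, j)" "e' = (i', j')" by (cases e, cases e') blast
  have rng: "1 \<le> i" "i < j" "j \<le> m" "1 \<le> i'" "i' < j'" "j' \<le> m"
    using e by (auto simp: complete_edges_def ij)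
  have upd: "gram (y(e := t)) k (basis_vertex m a) = gram y k (basis_vertex m (a :: 'd))"
    if "k \<in> range (basis_vertex m :: 'd \<Rightarrow> nat) \<or> k = first_end e' \<or> k = j'" for k a
  proof (rule partial_gram_other)
    have "m < k \<or> k = first_end e' \<or> k = j'" using that basis_vertex_gt[of m] by auto
    then show "e \<noteq> (1, k)" "1 \<le> k"
      using rng assms(3,4) by (auto simp: ij first_end_def split: if_splits)
  qed (use rng basis_vertex_gt[of m a] in \<open>auto simp: ij\<close>)
  have M: "(gram_matrix m (y(e := t)) :: real ^ 'd ^ 'd) = gram_matrix m y"
    "(gram_row m (y(e := t)) (first_end e') :: real ^ 'd) = gram_row m y (first_end e')"
    "(gram_row m (y(e := t)) j' :: real ^ 'd) = gram_row m y j'"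
    by (simp_all add: gram_matrix_def gram_row_def vec_eq_iff upd)
  have G: "gram (y(e := t)) (first_end e') j' = gram y (first_end e') j'"
  proof (cases "i' = 1")
    case True
    then have "first_end e' = j'" by (simp add: ij first_end_def)
    then show ?thesis using True rng assms(3) by (intro partial_gram_other) (auto simp: ij)
  next
    case False
    then have "first_end e' = i'" by (simp add: ij first_end_def)
    then show ?thesis using False rng assms(3,4) by (intro partial_gram_other) (auto simp: ij)
  qed
  have "snd e' = j'" by (simp add: ij)
  then show "constraint TYPE('d) m e' (y(e := t)) = constraint TYPE('d) m e' y"
    by (simp only: defect_def M G)
qed

lemma partial_constraint_self:
  assumes ij: "2 \<le> i" "i < j" "j \<le> m"
  shows "partial (i, j) (constraint TYPE('d::finite) m (i, j)) y
    = - det (gram_matrix m y :: real ^ 'd ^ 'd) / 2"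
proof -
  have upd: "gram (y((i, j) := t)) k (basis_vertex m a) = gram y k (basis_vertex m (a :: 'd))"
    if "k \<in> range (basis_vertex m :: 'd \<Rightarrow> nat) \<or> k = i \<or> k = j" for k t a
  proof (rule partial_gram_other)
    have k: "m < k \<or> k = i \<or> k = j" using that basis_vertex_gt[of m] by auto
    then show "1 \<le> k" using ij by auto
    show "(i, j) \<noteq> (k, basis_vertex m a)" "(i, j) \<noteq> (basis_vertex m a, k)"
      using ij basis_vertex_gt[of m a] by auto
  qed (use ij basis_vertex_gt[of m a] in auto)
  have A: "(gram_matrix m (y((i, j) := t)) :: real ^ 'd ^ 'd) = gram_matrix m y"
    and w: "(gram_row m (y((i, j) := t)) i :: real ^ 'd) = gram_row m y i"
    "(gram_row m (y((i, j) := t)) j :: real ^ 'd) = gram_row m y j" for t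
    by (simp_all add: gram_matrix_def gram_row_def vec_eq_iff upd)
  have g: "gram (y((i, j) := t)) i j = (edge_value y 1 i + edge_value y 1 j - t) / 2" for t
    using ij by (simp add: gram_def edge_value_def)
  have fe: "first_end (i, j) = i" using ij by (simp add: first_end_def)
  have "constraint TYPE('d) m (i, j) (y((i, j) := t)) =
      det (gram_matrix m y :: real ^ 'd ^ 'd) * ((edge_value y 1 i + edge_value y 1 j - t) / 2) -
        (\<Sum>a\<in>UNIV. gram_row m y i $ a * det (replace_column (gram_matrix m y) a (gram_row m y j :: real ^ 'd)))" for t
    unfolding defect_def fe snd_conv A w g ..
  moreover have "((\<lambda>t. d * ((s - t) / 2) - K) has_real_derivative - d / 2) (at x)" for d s K x :: real
    by (auto intro!: derivative_eq_intros)
  ultimately show ?thesis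
    unfolding partial_def by (simp only: DERIV_imp_deriv)
qed

lemma gram_target:
  assumes "i \<in> {1..m + CARD('d)}" "j \<in> {1..m + CARD('d)}" "1 \<le> m"
  shows "gram (distance_map (complete_edges (m + CARD('d))) (target m :: 'd::finite config)) i j
    = (target m i :: real ^ 'd) \<bullet> target m j"
  using assms by (simp add: gram_distance_map target_zero)

lemma gram_matrix_target:
  assumes "1 \<le> m"
  shows "gram_matrix m (distance_map (complete_edges (m + CARD('d))) (target m :: 'd::finite config))
    = (mat 1 :: real ^ 'd ^ 'd)"
  by (simp add: gram_matrix_def vec_eq_iff gram_target[OF basis_vertex_mem basis_vertex_mem assms]
      target_basis inner_axis_axis mat_def)

lemma gram_row_target:
  assumes "i \<in> {1..m}"
  shows "gram_row m (distance_map (complete_edges (m + CARD('d))) (target m :: 'd::finite config)) i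
    = (0 :: real ^ 'd)"
proof -
  have i: "i \<in> {1..m + CARD('d)}" "1 \<le> m" using assms by auto
  have "gram (distance_map (complete_edges (m + CARD('d))) (target m :: 'd config)) i (basis_vertex m a) = 0" for a :: 'd
    unfolding gram_target[OF i(1) basis_vertex_mem i(2)] target_zero[OF assms] by simp
  then show ?thesis by (simp add: gram_row_def vec_eq_iff)
qed

text \<open>
  At the target the Gram matrix is the identity and the rows of the coincident vertices vanish, so
  only the linear part of a constraint contributes to its differential.
\<close>

lemma partial_constraint_target:
  fixes e and m :: nat
  defines "y \<equiv> distance_map (complete_edges (m + CARD('d))) (target m :: 'd::finite config)"
  assumes ij: "i \<in> {1..m}" "j \<in> {1..m}"
  shows "partial e (defect TYPE('d) m i j) y = partial e (\<lambda>y. gram y i j) y"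
proof -
  let ?I = "complete_edges (m + CARD('d))"
  let ?A = "gram_matrix m :: _ \<Rightarrow> real ^ 'd ^ 'd" and ?w = "gram_row m :: _ \<Rightarrow> _ \<Rightarrow> real ^ 'd"
  have m: "1 \<le> m" using ij by simp
  have ij': "i \<in> {1..m + CARD('d)}" "j \<in> {1..m + CARD('d)}" using ij by auto
  have A: "?A y = mat 1" unfolding y_def by (rule gram_matrix_target[OF m])
  have w: "?w y i = 0" "?w y j = 0" 
    unfolding y_def by (rule gram_row_target[OF ij(1)], rule gram_row_target[OF ij(2)])
  have g: "gram y i j = 0" unfolding y_def gram_target[OF ij' m] target_zero[OF ij(1)] by simp
  have D: "det (replace_column (?A y) a 0) = 0" for a
    by (rule det_zero_column(1)[of a]) (simp add: column_def replace_column_def vec_eq_iff)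
  note P = poly_fun_gram_matrix[of m, where 'd = 'd] poly_fun_gram[OF ij'] poly_fun_gram_row[OF ij(1), where 'd = 'd]
    poly_fun_replace_column[OF ij(2), where 'd = 'd]
  define f where "f a y = ?w y i $ a * det (replace_column (?A y) a (?w y j))" for a y
  have pf: "poly_fun ?I (f a)" for a unfolding f_def[abs_def] by (intro poly_fun.mult P)
  have f0: "partial e (f a) y = 0" for a
    unfolding f_def[abs_def] partial_mult[OF P(3) P(4)] D w by simp
  have pA: "poly_fun ?I (\<lambda>y. det (?A y))" by (rule poly_fun_det) (rule P)
  have "defect TYPE('d) m i j = (\<lambda>y. det (?A y) * gram y i j - (\<Sum>a\<in>UNIV. f a y))"
    by (simp add: defect_def[abs_def] f_def)
  then have "partial e (defect TYPE('d) m i j) y =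
      partial e (\<lambda>y. det (?A y) * gram y i j) y - (\<Sum>a\<in>UNIV. partial e (f a) y)"
    using partial_diff[OF poly_fun.mult[OF pA P(2)] poly_fun_sum[of UNIV ?I f, OF pf]]
      partial_sum[of UNIV ?I f, OF pf] by simp
  also have "\<dots> = partial e (\<lambda>y. gram y i j) y"
    by (simp add: partial_mult[OF pA P(2)] f0 g A det_I)
  finally show ?thesis .
qed

lemma constraint_distance_map:
  fixes p :: "'d::finite config" and m :: nat
  defines "y \<equiv> distance_map (complete_edges (m + CARD('d))) p"
  assumes det: "det (gram_matrix m y :: real ^ 'd ^ 'd) \<noteq> 0" and ij: "i \<in> {1..m}" "j \<in> {1..m}"
  shows "defect TYPE('d) m i j y = 0"
proof -
  define N :: "real ^ 'd ^ 'd" where "N = (\<chi> a. p (basis_vertex m a) - p 1)"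
  have gram: "gram y i j = (p i - p 1) \<bullet> (p j - p 1)"
    if "i \<in> {1..m + CARD('d)}" "j \<in> {1..m + CARD('d)}" for i j
    unfolding y_def by (rule gram_distance_map[OF that])
  have A: "gram_matrix m y = N ** transpose N"
    by (simp add: gram_matrix_def gram[OF basis_vertex_mem basis_vertex_mem] N_def vec_eq_iff
        matrix_matrix_mult_def transpose_def inner_vec_def)
  have w: "gram_row m y k = N *v (p k - p 1)" if "k \<in> {1..m}" for k
    using that by (simp add: gram_row_def gram[OF _ basis_vertex_mem] N_def vec_eq_iff
        matrix_vector_mult_def inner_vec_def mult.commute)
  have "gram y i j = (p i - p 1) \<bullet> (p j - p 1)" using ij by (intro gram) auto
  then show ?thesis
    unfolding defect_def w[OF ij(1)] w[OF ij(2)] replace_column_def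
    using gram_schur_complement[OF A det, of "p i - p 1" "p j - p 1"] by (simp only: diff_self)
qed

text \<open>
  Near the target the Gram matrix factors as \<open>N N\<^sup>T\<close>; the rows of \<open>N\<close> are the positions of the
  basis vertices, and a linear system with matrix \<open>N\<close> gives those of the others. The constraints
  say that the remaining products, and therefore all lengths, come out right.
\<close>

lemma realize_near_target:
  obtains r where "r > 0"
    "\<And>y. y \<in> complete_edges (m + CARD('d::finite)) \<rightarrow>\<^sub>E UNIV \<Longrightarrow> 1 \<le> m \<Longrightarrow>
       dist (gram_matrix m y :: real ^ 'd ^ 'd) (mat 1) < r \<Longrightarrow> det (gram_matrix m y :: real ^ 'd ^ 'd) \<noteq> 0 \<Longrightarrow>
       (\<And>e. e \<in> complete_edges m \<Longrightarrow> constraint TYPE('d) m e y = 0) \<Longrightarrow>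
       y \<in> distance_map (complete_edges (m + CARD('d))) ` (configs (m + CARD('d)) :: 'd config set)"
proof -
  obtain r where r: "r > 0"
    "\<And>A :: real ^ 'd ^ 'd. transpose A = A \<Longrightarrow> dist A (mat 1) < r \<Longrightarrow> \<exists>N :: real ^ 'd ^ 'd. A = N ** transpose N"
    using symmetric_near_identity_factor by blast
  show ?thesis
  proof (rule that[OF r(1)])
    fix y
    let ?n = "m + CARD('d)" and ?A = "gram_matrix m y :: real ^ 'd ^ 'd"
    assume y: "y \<in> complete_edges ?n \<rightarrow>\<^sub>E UNIV" and m: "1 \<le> m" and near: "dist ?A (mat 1) < r"
      and det: "det ?A \<noteq> 0" and con: "\<And>e. e \<in> complete_edges m \<Longrightarrow> constraint TYPE('d) m e y = 0"
    have "transpose ?A = ?A"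
      by (simp add: gram_matrix_def transpose_def vec_eq_iff gram_commute)
    then obtain N :: "real ^ 'd ^ 'd" where N: "?A = N ** transpose N" using r(2) near by blast
    then have "det N \<noteq> 0" using det by (auto simp: det_mul)
    then have "\<exists>u. N *v u = w" for w
      using invertible_det_nz[of N] by (metis invertible_def matrix_vector_mul_assoc matrix_vector_mul_lid)
    then obtain sol where sol: "\<And>w. N *v sol w = w" by metis
    define u where "u i = (if i = 1 then 0 else if i \<le> m then sol (gram_row m y i) else
        N $ (inv (basis_vertex m) i))" for i
    have u1: "u 1 = 0" by (simp add: u_def)
    have ub: "u (basis_vertex m a) = N $ a" for a
    proof -
      have "inv (basis_vertex m) (basis_vertex m a) = a" by (rule inv_f_f) (simp add: inj_def)
      then show ?thesis using m basis_vertex_gt[of m a] by (simp add: u_def)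
    qed
    have gram1: "gram y 1 k = 0" for k by (simp add: gram_def)
    have uz: "N *v u i = gram_row m y i" if "i \<in> {1..m}" for i
      using that gram1 by (cases "i = 1") (simp_all add: u_def sol gram_row_def vec_eq_iff)
    have bb: "gram y (basis_vertex m a) (basis_vertex m b) = N $ a \<bullet> N $ b" for a b :: 'd
    proof -
      have "gram y (basis_vertex m a) (basis_vertex m b) = ?A $ a $ b" by (simp add: gram_matrix_def)
      then show ?thesis by (simp add: N matrix_matrix_mult_def transpose_def inner_vec_def)
    qed
    have zb: "gram y i (basis_vertex m a) = u i \<bullet> N $ a" if "i \<in> {1..m}" for i and a :: 'd
    proof -
      have "gram y i (basis_vertex m a) = (N *v u i) $ a" by (simp add: uz[OF that] gram_row_def)
      then show ?thesis by (simp add: matrix_vector_mult_def inner_vec_def mult.commute)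
    qed
    have zz: "gram y i j = u i \<bullet> u j" if "i \<in> {1..m}" "j \<in> {1..m}" "i \<le> j" for i j
    proof (cases "i = 1")
      case False
      define e where "e = (if i = j then (1, j) else (i, j))"
      have e: "e \<in> complete_edges m" "first_end e = i" "snd e = j"
        using that False by (auto simp: e_def complete_edges_def first_end_def)
      have "det ?A * gram y i j = det ?A * (u i \<bullet> u j)"
        using con[OF e(1)] gram_schur_complement[OF N det, of "u i" "u j"]
        unfolding defect_def replace_column_def e uz[OF that(1)] uz[OF that(2)] by linarith
      then show ?thesis using det by simp
    next
      case True
      then show ?thesis by (simp only: gram1 u1 inner_zero_left)
    qed
    have gram: "gram y i j = u i \<bullet> u j" if ij: "i \<in> {1..?n}" "j \<in> {1..?n}" for i j
    proof (rule vertex_cases[OF ij(1)])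
      assume i: "i \<in> {1..m}"
      show ?thesis
      proof (rule vertex_cases[OF ij(2)])
        assume "j \<in> {1..m}"
        then show ?thesis using zz[of i j] zz[of j i] i
          by (cases "i \<le> j") (simp_all add: gram_commute[of y i j] inner_commute)
      qed (simp add: zb[OF i] ub)
    next
      fix a :: 'd assume i: "i = basis_vertex m a"
      show ?thesis
      proof (rule vertex_cases[OF ij(2)])
        assume "j \<in> {1..m}"
        then show ?thesis using zb[of j a] by (simp add: i ub gram_commute[of y _ j] inner_commute)
      qed (simp add: i ub bb)
    qed
    define p where "p = restrict u {1..?n}"
    have "distance_map (complete_edges ?n) p = y"
    proof
      fix e
      show "distance_map (complete_edges ?n) p e = y e"
      proof (cases "e \<in> complete_edges ?n")
        case True
        then obtain i j where e: "e = (i, j)" "i \<in> {1..?n}" "j \<in> {1..?n}" "i < j"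
          by (auto simp: complete_edges_def)
        have "distance_map (complete_edges ?n) p e = (norm (u j - u i))\<^sup>2"
          using True e by (simp add: distance_map_def p_def)
        also have "\<dots> = gram y i i + gram y j j - 2 * gram y i j"
          unfolding gram[OF e(2) e(2)] gram[OF e(3) e(3)] gram[OF e(2) e(3)] power2_norm_eq_inner
          by (simp add: inner_diff_left inner_diff_right inner_commute)
        also have "\<dots> = edge_value y i j" by (simp add: edge_value_gram)
        finally show ?thesis using e by (simp add: edge_value_def)
      next
        case False
        then show ?thesis using PiE_arb[OF y] by (simp add: distance_map_def)
      qed
    qed
    moreover have "p \<in> configs ?n" by (simp add: p_def configs_def)
    ultimately show "y \<in> distance_map (complete_edges ?n) ` (configs ?n :: 'd config set)" by blast
  qed
qed

lemma sum_partial_edge_value: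
  assumes "i \<in> {1..n}" "j \<in> {1..n}"
  shows "(\<Sum>e\<in>complete_edges n. partial e (\<lambda>y. edge_value y i j) x * v e) = edge_value v i j"
proof -
  have coord: "(\<Sum>e\<in>complete_edges n. partial e (\<lambda>y. y e') x * v e) = v e'" if "e' \<in> complete_edges n" for e'
    using that by (simp add: partial_coord if_distrib[of "\<lambda>c. c * _"] sum.delta cong: if_cong)
  show ?thesis
  proof (cases i j rule: linorder_cases)
    case less
    then show ?thesis using coord[of "(i, j)"] assms by (simp add: edge_value_def complete_edges_def)
  next
    case equal
    then show ?thesis by (simp add: edge_value_def partial_eq_0)
  next
    case greater
    then show ?thesis using coord[of "(j, i)"] assms by (simp add: edge_value_def complete_edges_def)
  qed
qed

lemma partial_gram:
  assumes "i \<in> {1..n}" "j \<in> {1..n}"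
  shows "partial e (\<lambda>y. gram y i j) x = (partial e (\<lambda>y. edge_value y 1 i) x +
    partial e (\<lambda>y. edge_value y 1 j) x - partial e (\<lambda>y. edge_value y i j) x) / 2"
proof -
  have one: "1 \<in> {1..n}" using assms by auto
  note D = poly_fun_partial(2)[OF poly_fun_edge_value, of _ n]
  have "partial e (\<lambda>y. gram y i j) x = deriv (\<lambda>t. gram (x(e := t)) i j) (x e)"
    by (simp only: partial_def)
  then show ?thesis
    unfolding gram_def
    by (elim trans) (intro DERIV_imp_deriv DERIV_cdivide DERIV_diff DERIV_add D assms one)
qed

lemma sum_partial_gram:
  assumes "i \<in> {1..n}" "j \<in> {1..n}"
  shows "(\<Sum>e\<in>complete_edges n. partial e (\<lambda>y. gram y i j) x * v e) = gram v i j"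
proof -
  have one: "1 \<in> {1..n}" using assms by auto
  have "(\<Sum>e\<in>complete_edges n. partial e (\<lambda>y. gram y i j) x * v e) =
      ((\<Sum>e\<in>complete_edges n. partial e (\<lambda>y. edge_value y 1 i) x * v e) +
       (\<Sum>e\<in>complete_edges n. partial e (\<lambda>y. edge_value y 1 j) x * v e) -
       (\<Sum>e\<in>complete_edges n. partial e (\<lambda>y. edge_value y i j) x * v e)) / 2"
    unfolding partial_gram[OF assms] sum.distrib[symmetric] sum_subtractf[symmetric] sum_divide_distrib
    by (intro sum.cong refl) (simp add: field_simps)
  then show ?thesis by (simp only: sum_partial_edge_value[OF one assms(1)] sum_partial_edge_value[OF one assms(2)]
        sum_partial_edge_value[OF assms] gram_def)
qed

lemma partial_constraint_target_nonzero:
  assumes e: "e \<in> complete_edges m"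
  shows "partial e (constraint TYPE('d::finite) m e)
     (distance_map (complete_edges (m + CARD('d))) (target m :: 'd config)) \<noteq> 0" (is "partial e ?c ?y \<noteq> 0")
proof -
  obtain i j where ij: "e = (i, j)" "1 \<le> i" "i < j" "j \<le> m" using e by (auto simp: complete_edges_def)
  show ?thesis
  proof (cases "i = 1")
    case True
    then have c: "?c = defect TYPE('d) m j j" by (simp add: ij first_end_def)
    have j: "j \<in> {1..m}" using ij by simp
    have "partial e ?c ?y = partial e (\<lambda>y. gram y j j) ?y"
      unfolding c by (rule partial_constraint_target[OF j j])
    also have "(\<lambda>y. gram y j j) = (\<lambda>y. y e)"
      using ij True by (simp add: gram_def edge_value_def fun_eq_iff)
    finally show ?thesis by (simp add: partial_coord)
  next
    case False
    then have "partial e ?c ?y = - det (gram_matrix m ?y :: real ^ 'd ^ 'd) / 2"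
      unfolding ij(1) using ij by (intro partial_constraint_self) auto
    then show ?thesis using ij by (simp add: gram_matrix_target det_I)
  qed
qed

lemma gram_zero_iff:
  "(\<forall>e\<in>complete_edges m. gram v (first_end e) (snd e) = 0) \<longleftrightarrow> (\<forall>e\<in>complete_edges m. v e = 0)"
proof
  assume v: "\<forall>e\<in>complete_edges m. v e = 0"
  then have ev: "edge_value v i j = 0" if "i \<in> {1..m}" "j \<in> {1..m}" for i j
    using that by (auto simp: edge_value_def complete_edges_def)
  show "\<forall>e\<in>complete_edges m. gram v (first_end e) (snd e) = 0"
  proof
    fix e assume e: "e \<in> complete_edges m"
    then have "first_end e \<in> {1..m}" "snd e \<in> {1..m}" "1 \<in> {1..m}"
      by (auto simp: complete_edges_def first_end_def)
    then show "gram v (first_end e) (snd e) = 0" by (simp add: gram_def ev)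
  qed
next
  assume g: "\<forall>e\<in>complete_edges m. gram v (first_end e) (snd e) = 0"
  have ev1: "edge_value v 1 j = 0" if "j \<in> {1..m}" for j
  proof (cases "j = 1")
    case False
    then have "(1, j) \<in> complete_edges m" using that by (auto simp: complete_edges_def)
    then have "gram v j j = 0" using g by (auto simp: first_end_def)
    then show ?thesis by (simp add: gram_def)
  qed simp
  show "\<forall>e\<in>complete_edges m. v e = 0"
  proof
    fix e assume e: "e \<in> complete_edges m"
    then obtain i j where ij: "e = (i, j)" "i \<in> {1..m}" "j \<in> {1..m}" "i < j"
      by (auto simp: complete_edges_def)
    show "v e = 0"
    proof (cases "i = 1")
      case True
      then show ?thesis using ev1[of j] ij by (simp add: edge_value_def)
    next
      case False
      then have "gram v i j = 0" using g e ij by (auto simp: first_end_def)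
      then have "edge_value v i j = 0" unfolding gram_def ev1[OF ij(2)] ev1[OF ij(3)] by simp
      then show ?thesis using ij by (simp add: edge_value_def)
    qed
  qed
qed

text \<open>
  Coincident vertices have no influence on the first order change of their distance. Any other
  prescribed change of the squared lengths is realized by prescribing the components of the
  velocities in the orthonormal frame \<open>b\<close> of the given configuration.
\<close>

lemma distance_map_deriv_image:
  fixes p :: "'d::finite config" and m :: nat
  defines "n \<equiv> m + CARD('d)"
  assumes m: "1 \<le> m" and cong: "congruent n (target m) p"
  shows "distance_map_deriv n (complete_edges n) p ` configs n =
    {v \<in> complete_edges n \<rightarrow>\<^sub>E UNIV. \<forall>e\<in>complete_edges m. v e = 0}"
proof (intro equalityI subsetI)
  let ?E = "complete_edges n"
  have deriv: "distance_map_deriv n ?E p u (i, j) = 2 * ((p i - p j) \<bullet> (u i - u j))"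
    if "(i, j) \<in> ?E" for i j u
    using that by (simp add: distance_map_deriv_def rigidity_apply_edge[OF simple_complete that])
  obtain T :: "real ^ 'd \<Rightarrow> real ^ 'd" where T: "\<And>x y. dist (T x) (T y) = dist x y" "\<And>i. i \<in> {1..n} \<Longrightarrow> p i = T (target m i)"
    using cong unfolding congruent_def by blast
  have pz: "p i = p 1" if "i \<in> {1..m}" for i
  proof -
    have "p i = T (target m i)" "p 1 = T (target m 1)" using T(2) that m by (auto simp: n_def)
    then show ?thesis using that m by (simp add: target_zero)
  qed
  define b where "b a = p (basis_vertex m a) - p 1" for a :: 'd
  have b: "b a \<bullet> b c = (if a = c then 1 else 0)" for a c :: 'd
  proof -
    have one: "1 \<in> {1..n}" using m by (simp add: n_def)
    have bn: "basis_vertex m a \<in> {1..n}" for a :: 'd unfolding n_def by (rule basis_vertex_mem)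
    have "b a \<bullet> b c = gram (distance_map ?E p) (basis_vertex m a) (basis_vertex m c)"
      unfolding b_def by (rule gram_distance_map[OF bn bn, symmetric])
    also have "distance_map ?E p = distance_map ?E (target m :: 'd config)"
      using cong by (simp add: distance_map_eq_iff_congruent)
    also have "gram \<dots> (basis_vertex m a) (basis_vertex m c) = (axis a 1 :: real ^ 'd) \<bullet> axis c 1"
      unfolding n_def by (simp add: gram_target[OF basis_vertex_mem basis_vertex_mem m] target_basis)
    finally show ?thesis by (simp add: inner_axis_axis)
  qed
  {
    fix v assume "v \<in> distance_map_deriv n ?E p ` configs n"
    then obtain u where v: "v = distance_map_deriv n ?E p u" by blast
    have "v e = 0" if "e \<in> complete_edges m" for e
    proof -
      obtain i j where e: "e = (i, j)" by (cases e)
      moreover have "i \<in> {1..m}" "j \<in> {1..m}" "(i, j) \<in> ?E"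
        using that by (auto simp: e complete_edges_def n_def)
      ultimately show ?thesis using pz[of i] pz[of j] by (simp add: v deriv)
    qed
    moreover have "v \<in> ?E \<rightarrow>\<^sub>E UNIV" by (simp add: v distance_map_deriv_def)
    ultimately show "v \<in> {v \<in> ?E \<rightarrow>\<^sub>E UNIV. \<forall>e\<in>complete_edges m. v e = 0}" by simp
  next
    fix v :: "nat \<times> nat \<Rightarrow> real" assume "v \<in> {v \<in> ?E \<rightarrow>\<^sub>E UNIV. \<forall>e\<in>complete_edges m. v e = 0}"
    then have v: "v \<in> ?E \<rightarrow>\<^sub>E UNIV" "\<And>e. e \<in> complete_edges m \<Longrightarrow> v e = 0" by auto
    define s where "s i a = (if i \<le> m then (edge_value v 1 (basis_vertex m a) - edge_value v i (basis_vertex m a)) / 2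
      else gram v i (basis_vertex m a) / 2)" for i and a :: 'd
    define u where "u = (\<lambda>i\<in>{1..n}. \<Sum>a\<in>UNIV. s i a *\<^sub>R b a)"
    have bu: "b a \<bullet> u i = s i a" if "i \<in> {1..n}" for a i
      using that by (simp add: u_def inner_sum_right b if_distrib[of "\<lambda>c. _ * c"] cong: if_cong)
    have dz: "2 * ((p i - p (basis_vertex m a)) \<bullet> (u i - u (basis_vertex m a))) = edge_value v i (basis_vertex m a)"
      if i: "i \<in> {1..m}" for i and a :: 'd
    proof -
      have n: "i \<in> {1..n}" "basis_vertex m a \<in> {1..n}" using i basis_vertex_mem[of m a] by (auto simp: n_def)
      have "2 * ((p i - p (basis_vertex m a)) \<bullet> (u i - u (basis_vertex m a))) =
          2 * (b a \<bullet> u (basis_vertex m a) - b a \<bullet> u i)"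
        by (simp add: pz[OF i] b_def inner_diff_left inner_diff_right)
      also have "\<dots> = edge_value v i (basis_vertex m a)"
        unfolding bu[OF n(1)] bu[OF n(2)] s_def using i basis_vertex_gt[of m a] by (simp add: gram_def field_simps)
      finally show ?thesis .
    qed
    have db: "2 * ((p (basis_vertex m c) - p (basis_vertex m a)) \<bullet> (u (basis_vertex m c) - u (basis_vertex m a)))
        = edge_value v (basis_vertex m c) (basis_vertex m a)" for a c :: 'd
    proof -
      have n: "basis_vertex m a \<in> {1..n}" "basis_vertex m c \<in> {1..n}"
        using basis_vertex_mem[of m] by (auto simp: n_def)
      have "2 * ((p (basis_vertex m c) - p (basis_vertex m a)) \<bullet> (u (basis_vertex m c) - u (basis_vertex m a))) =
          2 * (b c \<bullet> u (basis_vertex m c) - b c \<bullet> u (basis_vertex m a)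
             - b a \<bullet> u (basis_vertex m c) + b a \<bullet> u (basis_vertex m a))"
        by (simp add: b_def inner_diff_left inner_diff_right)
      also have "\<dots> = gram v (basis_vertex m c) (basis_vertex m c) - gram v (basis_vertex m a) (basis_vertex m c)
          - gram v (basis_vertex m c) (basis_vertex m a) + gram v (basis_vertex m a) (basis_vertex m a)"
        unfolding bu[OF n(1)] bu[OF n(2)] s_def using basis_vertex_gt[of m a] basis_vertex_gt[of m c] by simp
      also have "\<dots> = edge_value v (basis_vertex m c) (basis_vertex m a)"
        by (simp add: edge_value_gram gram_commute[of v "basis_vertex m a" "basis_vertex m c"])
      finally show ?thesis .
    qed
    have "distance_map_deriv n ?E p u = v"
    proof
      fix e
      show "distance_map_deriv n ?E p u e = v e"
      proof (cases "e \<in> ?E")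
        case True
        then obtain i j where e: "e = (i, j)" "i \<in> {1..n}" "j \<in> {1..n}" "i < j" "(i, j) \<in> ?E"
          by (auto simp: complete_edges_def)
        have ev: "v e = edge_value v i j" using e by (simp add: edge_value_def)
        show ?thesis
        proof (rule vertex_cases[OF e(2)[unfolded n_def]])
          assume i: "i \<in> {1..m}"
          show ?thesis
          proof (rule vertex_cases[OF e(3)[unfolded n_def]])
            assume j: "j \<in> {1..m}"
            then have "v e = 0" using e i by (intro v(2)) (simp add: complete_edges_def)
            then show ?thesis using pz[OF i] pz[OF j] by (simp add: e(1) deriv[OF e(5)])
          next
            fix a :: 'd assume "j = basis_vertex m a"
            then show ?thesis using dz[OF i, of a] ev e(5) by (simp add: e(1) deriv)
          qed
        next
          fix c :: 'd assume i: "i = basis_vertex m c"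
          show ?thesis
          proof (rule vertex_cases[OF e(3)[unfolded n_def]])
            assume "j \<in> {1..m}"
            then show ?thesis using e(4) basis_vertex_gt[of m c] by (simp add: i)
          next
            fix a :: 'd assume "j = basis_vertex m a"
            then show ?thesis using db[of c a] ev e(5) by (simp add: e(1) i deriv)
          qed
        qed
      next
        case False
        then show ?thesis using PiE_arb[OF v(1)] by (simp add: distance_map_deriv_def)
      qed
    qed
    moreover have "u \<in> configs n" by (simp add: u_def configs_def)
    ultimately show "v \<in> distance_map_deriv n ?E p ` configs n" by blast
  }
qed

lemma first_end_mem: "e \<in> complete_edges m \<Longrightarrow> first_end e \<in> {1..m}" "e \<in> complete_edges m \<Longrightarrow> snd e \<in> {1..m}"
  by (auto simp: complete_edges_def first_end_def)

text \<open>
  The neighbourhood \<open>W\<close> ensures that the Gram matrix is invertible and factors, and that the diagonal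
  of the triangular Jacobian has no zero. At the target the constraints have the linear parts
  \<open>gram v (first_end e) (snd e)\<close>, so the tangent space consists of the changes of length that vanish
  between coincident vertices, and this is the image of the derivative.
\<close>

lemma target_regular:
  assumes m: "1 \<le> m"
  shows "target m \<in> (regular_configs (m + CARD('d)) (complete_edges (m + CARD('d))) :: 'd::finite config set)"
proof -
  let ?n = "m + CARD('d)"
  let ?E = "complete_edges ?n" and ?A = "gram_matrix m :: _ \<Rightarrow> real ^ 'd ^ 'd"
  let ?M = "distance_map ?E ` (configs ?n :: 'd config set)"
  let ?c = "constraint TYPE('d) m"
  define y0 where "y0 = distance_map ?E (target m :: 'd config)"
  obtain r where r: "r > 0" "\<And>y. y \<in> ?E \<rightarrow>\<^sub>E UNIV \<Longrightarrow> 1 \<le> m \<Longrightarrow> dist (?A y) (mat 1) < r \<Longrightarrow>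
      det (?A y) \<noteq> 0 \<Longrightarrow> (\<And>e. e \<in> complete_edges m \<Longrightarrow> ?c e y = 0) \<Longrightarrow> y \<in> ?M"
    by (rule realize_near_target[of m, where 'd = 'd]) blast
  define c where "c = card (complete_edges m)"
  obtain enum where "bij_betw enum {0..<c} (complete_edges m)"
    unfolding c_def using ex_bij_betw_nat_finite[OF finite_complete_edges] by blast
  then have enum: "inj_on enum {0..<c}" "enum ` {0..<c} = complete_edges m" by (auto simp: bij_betw_def)
  then have enum_mem: "enum k \<in> complete_edges m" if "k < c" for k using that by auto
  define g where "g k = ?c (enum k)" for k
  have pc: "poly_fun ?E (?c e)" if "e \<in> complete_edges m" for e
    by (rule poly_fun_defect) (rule first_end_mem[OF that])+
  define W where "W = {y \<in> ?E \<rightarrow>\<^sub>E UNIV. dist (?A y) (mat 1) < r \<and> det (?A y) \<noteq> 0 \<and>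
      (\<forall>e\<in>complete_edges m. partial e (?c e) y \<noteq> 0)}"
  have all_iff: "(\<forall>k<c. P (enum k)) \<longleftrightarrow> (\<forall>e\<in>complete_edges m. P e)" for P
    unfolding enum(2)[symmetric] by auto
  have A0: "?A y0 = mat 1" unfolding y0_def by (rule gram_matrix_target[OF m])
  have y0: "y0 \<in> ?M \<inter> W"
  proof -
    have "y0 \<in> ?M" unfolding y0_def using target_configs by blast
    moreover have "y0 \<in> ?E \<rightarrow>\<^sub>E UNIV" by (simp add: y0_def distance_map_def)
    moreover have "\<forall>e\<in>complete_edges m. partial e (?c e) y0 \<noteq> 0"
      unfolding y0_def by (intro ballI partial_constraint_target_nonzero)
    ultimately show ?thesis using r(1) by (simp add: W_def A0 det_I)
  qed
  have openW: "openin (top_of_set (?E \<rightarrow>\<^sub>E UNIV)) W"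
  proof -
    have contA: "continuous_on UNIV ?A"
      unfolding gram_matrix_def[abs_def]
      
      by (intro continuous_on_vec_lambda poly_fun_continuous[OF poly_fun_gram[OF basis_vertex_mem[of m] basis_vertex_mem[of m]]])
    have "open {y. dist (?A y) (mat 1) < r}"
      by (intro open_Collect_less continuous_on_dist contA continuous_on_const)
    moreover have "open {y. det (?A y) \<noteq> 0}"
      by (intro open_Collect_neq continuous_on_const poly_fun_continuous[OF poly_fun_det[OF poly_fun_gram_matrix]])
    moreover have "open (\<Inter>e\<in>complete_edges m. {y. partial e (?c e) y \<noteq> 0})"
      by (intro open_INT finite_complete_edges ballI open_Collect_neq continuous_on_const
          poly_fun_continuous[OF poly_fun_partial(1)[OF pc]])
    ultimately have "open ({y. dist (?A y) (mat 1) < r} \<inter> {y. det (?A y) \<noteq> 0} \<inter>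
        (\<Inter>e\<in>complete_edges m. {y. partial e (?c e) y \<noteq> 0}))"
      by (intro open_Int)
    moreover have "W = (?E \<rightarrow>\<^sub>E UNIV) \<inter> ({y. dist (?A y) (mat 1) < r} \<inter> {y. det (?A y) \<noteq> 0} \<inter>
        (\<Inter>e\<in>complete_edges m. {y. partial e (?c e) y \<noteq> 0}))"
      unfolding W_def by blast
    ultimately show ?thesis unfolding openin_open by blast
  qed
  have zero_set: "?M \<inter> W = {y \<in> W. \<forall>k<c. g k y = 0}"
  proof -
    have iff: "y \<in> ?M \<longleftrightarrow> (\<forall>e\<in>complete_edges m. ?c e y = 0)" if y: "y \<in> W" for y
    proof
      assume "y \<in> ?M"
      then obtain p :: "'d config" where p: "y = distance_map ?E p" by blast
      have "det (?A y) \<noteq> 0" using y by (simp add: W_def)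
      then have "?c e y = 0" if "e \<in> complete_edges m" for e
        unfolding p by (rule constraint_distance_map) (rule first_end_mem[OF that])+
      then show "\<forall>e\<in>complete_edges m. ?c e y = 0" by (rule ballI)
    next
      assume "\<forall>e\<in>complete_edges m. ?c e y = 0"
      then show "y \<in> ?M" using y m by (intro r(2)) (simp_all add: W_def)
    qed
    show ?thesis
    proof (rule set_eqI)
      fix y
      show "y \<in> ?M \<inter> W \<longleftrightarrow> y \<in> {y \<in> W. \<forall>k<c. g k y = 0}"
        unfolding Int_iff mem_Collect_eq g_def all_iff[of "\<lambda>e. ?c e y = 0"]
        by (cases "y \<in> W") (simp_all only: iff simp_thms)
    qed
  qed
  have indep: "a k = 0"
    if y: "y \<in> W" and a: "\<forall>e\<in>?E. (\<Sum>k<c. a k * partial e (g k) y) = 0" and k: "k < c" for y a k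
  proof -
    have sub: "complete_edges m \<subseteq> ?E" by (auto simp: complete_edges_def)
    have single: "a k = 0" if k: "k < c" and other: "\<And>l. l < c \<Longrightarrow> l \<noteq> k \<Longrightarrow> a l * partial (enum k) (g l) y = 0" for k
    proof -
      have "(\<Sum>l<c. a l * partial (enum k) (g l) y) = (\<Sum>l\<in>{k}. a l * partial (enum k) (g l) y)"
        by (rule sum.mono_neutral_right) (use k other in auto)
      moreover have "(\<Sum>l<c. a l * partial (enum k) (g l) y) = 0"
        using a sub enum_mem[OF k] by blast
      moreover have "partial (enum k) (g k) y \<noteq> 0"
        using y enum_mem[OF k] by (simp add: W_def g_def)
      ultimately show ?thesis by simp
    qed
    have ne: "enum k \<noteq> enum l" if "k < c" "l < c" "l \<noteq> k" for k l
      using that enum(1) by (auto simp: inj_on_def)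
    have far: "a k = 0" if "k < c" "fst (enum k) \<noteq> 1" for k
    proof (rule single[OF that(1)])
      fix l assume l: "l < c" "l \<noteq> k"
      have "partial (enum k) (g l) y = 0"
        unfolding g_def using that l ne[of k l]
        by (intro partial_constraint_other enum_mem disjI1) simp_all
      then show "a l * partial (enum k) (g l) y = 0" by simp
    qed
    show ?thesis
    proof (rule single[OF k])
      fix l assume l: "l < c" "l \<noteq> k"
      show "a l * partial (enum k) (g l) y = 0"
      proof (cases "fst (enum l) = 1")
        case True
        have "partial (enum k) (g l) y = 0"
          unfolding g_def using True k l ne[of k l]
          by (intro partial_constraint_other enum_mem disjI2) simp_all
        then show ?thesis by simp
      next
        case False
        then show ?thesis using far[OF l(1)] by simp
      qed
    qed
  qed
  have "submanifold_near ?E ?M y0 W c g"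
    unfolding submanifold_near_def
  proof (intro conjI openW y0 zero_set)
    show "\<forall>j<c. smooth_fun_on ?E W (g j)"
      unfolding smooth_fun_on_def g_def by (intro allI impI poly_fun_C_k_on pc enum_mem)
    show "\<forall>y\<in>?M \<inter> W. \<forall>a. (\<forall>i\<in>?E. (\<Sum>j<c. a j * partial i (g j) y) = 0) \<longrightarrow> (\<forall>j<c. a j = 0)"
    proof (intro ballI allI impI)
      fix y a k
      assume "y \<in> ?M \<inter> W" "\<forall>i\<in>?E. (\<Sum>j<c. a j * partial i (g j) y) = 0" "k < c"
      then show "a k = 0" using indep[of y a k] by simp
    qed
  qed
  moreover have "distance_map_deriv ?n ?E p ` configs ?n = tangent_space ?E c g y0"
    if p: "distance_map ?E p = y0" for p :: "'d config"
  proof -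
    have "(\<Sum>i\<in>?E. partial i (?c e) y0 * v i) = gram v (first_end e) (snd e)" if e: "e \<in> complete_edges m" for e v
    proof -
      have "first_end e \<in> {1..?n}" "snd e \<in> {1..?n}" using first_end_mem[OF e] by auto
      then show ?thesis unfolding y0_def partial_constraint_target[OF first_end_mem[OF e]]
        by (rule sum_partial_gram)
    qed
    then have "(\<forall>k<c. (\<Sum>i\<in>?E. partial i (g k) y0 * v i) = 0) \<longleftrightarrow>
        (\<forall>e\<in>complete_edges m. gram v (first_end e) (snd e) = 0)" for v
      unfolding g_def all_iff[of "\<lambda>e. (\<Sum>i\<in>?E. partial i (?c e) y0 * v i) = 0"]
      by (intro ball_cong refl) simp
    then have "tangent_space ?E c g y0 = {v \<in> ?E \<rightarrow>\<^sub>E UNIV. \<forall>e\<in>complete_edges m. gram v (first_end e) (snd e) = 0}"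
      by (simp only: tangent_space_def)
    moreover have "congruent ?n (target m) p"
      using p unfolding y0_def by (simp add: distance_map_eq_iff_congruent)
    ultimately show ?thesis by (simp only: gram_zero_iff distance_map_deriv_image[OF m])
  qed
  ultimately have "regular_value TYPE('d) ?n ?E y0"
    unfolding regular_value_def by (intro exI[of _ W] exI[of _ c] exI[of _ g] conjI ballI impI)
  then show ?thesis unfolding regular_configs_def y0_def by (simp add: target_configs)
qed

section \<open>Existence of solutions\<close>

text \<open>
  The integral equation is a contraction for the unknown \<open>z t = exp (- \<kappa> t) (x t - x0)\<close> on the whole
  half-line if the weight \<open>\<kappa>\<close> exceeds the Lipschitz constant. Boundedness of \<open>f\<close> keeps the weighted
  functions bounded.
\<close>

lemma lipschitz_ode_global:
  fixes f :: "'a::banach \<Rightarrow> 'a"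
  assumes L: "0 \<le> L" "\<And>x y. norm (f x - f y) \<le> L * norm (x - y)" and M: "\<And>x. norm (f x) \<le> M"
  shows "\<exists>x. x 0 = x0 \<and> (\<forall>t\<ge>0. (x has_vector_derivative f (x t)) (at t within {0..}))"
proof -
  define \<kappa> where "\<kappa> = L + 1"
  have \<kappa>: "\<kappa> \<ge> 1" "\<kappa> > 0" using L by (auto simp: \<kappa>_def)
  define F where "F z s = f (x0 + exp (\<kappa> * s) *\<^sub>R apply_bcontfun z s)" for z s
  define I where "I z t = integral {0..t} (F z)" for z t
  have contf: "continuous_on UNIV f"
    by (rule lipschitz_on_continuous_on[of L]) (auto intro!: lipschitz_onI L simp: dist_norm)
  have contF: "continuous_on A (F z)" for A z
    unfolding F_def by (rule continuous_on_compose2[OF contf]) (auto intro!: continuous_intros)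
  \<comment> \<open>The fundamental theorem of calculus, including the one-sided derivative at 0.\<close>
  have dI: "(I z has_vector_derivative F z t) (at t within {0..})" if "t \<ge> 0" for z t
  proof -
    have "at t within {0..t+1} = at t within {0..}"
      by (rule at_within_nhd[of _ "{..<t+1}"]) auto
    then show ?thesis
      using integral_has_vector_derivative[OF contF[of "{0..t+1}" z], of t] that unfolding I_def by simp
  qed
  have contI: "continuous_on {0..} (I z)" for z
    using dI by (auto simp: continuous_on_eq_continuous_within intro: has_vector_derivative_continuous)
  have I0: "I z 0 = 0" for z by (simp add: I_def)
  define \<Phi> where "\<Phi> z t = exp (- \<kappa> * max 0 t) *\<^sub>R I z (max 0 t)" for z t
  have bnd: "norm (\<Phi> z t) \<le> M" for z t
  proof (cases "0 < t")
    case True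
    have "norm (I z t - I z 0) \<le> M * t - M * 0"
    proof (rule differentiable_bound_general[OF True])
      show "continuous_on {0..t} (I z)" by (rule continuous_on_subset[OF contI]) auto
      show "(I z has_vector_derivative F z s) (at s)" if "0 < s" for s
        using dI[of s z] that at_within_atLeast[of s] by simp
      show "norm (F z s) \<le> M" for s by (simp add: F_def M)
      show "((\<lambda>s. M * s) has_vector_derivative M) (at s)" for s
        by (auto intro!: derivative_eq_intros simp flip: has_real_derivative_iff_has_vector_derivative)
    qed (auto intro!: continuous_intros)
    then have "norm (\<Phi> z t) \<le> exp (- \<kappa> * t) * (M * t)"
      using True by (simp add: \<Phi>_def I0)
    also have "\<dots> \<le> exp (- \<kappa> * t) * (M * exp (\<kappa> * t))"
    proof (intro mult_left_mono)
      have "t \<le> \<kappa> * t" using \<kappa> True by simp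
      then show "t \<le> exp (\<kappa> * t)" using exp_ge_add_one_self[of "\<kappa> * t"] by linarith
      show "0 \<le> M" using norm_ge_zero[of "f 0"] M[of 0] by linarith
    qed auto
    also have "\<dots> = M" by (simp add: exp_minus)
    finally show ?thesis .
  qed (use norm_ge_zero[of "f 0"] M[of 0] in \<open>simp add: \<Phi>_def I0 max_def, linarith\<close>)
  have bc: "\<Phi> z \<in> bcontfun" for z
  proof (rule bcontfun_normI[OF _ bnd])
    have "continuous_on UNIV (\<lambda>t. I z (max 0 t))"
      by (rule continuous_on_compose2[OF contI]) (auto intro!: continuous_intros)
    then show "continuous_on UNIV (\<Phi> z)" unfolding \<Phi>_def by (intro continuous_intros)
  qed
  have "\<exists>!z. Bcontfun (\<Phi> z) = z"
  proof (rule banach_fix_type)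
    show "0 \<le> L / \<kappa>" "L / \<kappa> < 1" using L by (auto simp: \<kappa>_def)
    show "\<forall>y z. dist (Bcontfun (\<Phi> y)) (Bcontfun (\<Phi> z)) \<le> L / \<kappa> * dist y z"
    proof (intro allI dist_bound)
      fix y z t
      show "dist (apply_bcontfun (Bcontfun (\<Phi> y)) t) (apply_bcontfun (Bcontfun (\<Phi> z)) t) \<le> L / \<kappa> * dist y z"
      proof (cases "0 < t")
        case True
        have "norm ((I y t - I z t) - (I y 0 - I z 0))
            \<le> (L / \<kappa> * dist y z) * exp (\<kappa> * t) - (L / \<kappa> * dist y z) * exp (\<kappa> * 0)"
        proof (rule differentiable_bound_general[OF True])
          show "continuous_on {0..t} (\<lambda>t. I y t - I z t)"
            by (intro continuous_intros continuous_on_subset[OF contI]) auto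
          fix s :: real assume s: "0 < s" "s < t"
          show "((\<lambda>t. I y t - I z t) has_vector_derivative F y s - F z s) (at s)"
            using has_vector_derivative_diff[OF dI[of s y] dI[of s z]] s at_within_atLeast[of s] by simp
          show "((\<lambda>t. (L / \<kappa> * dist y z) * exp (\<kappa> * t)) has_vector_derivative
              L * dist y z * exp (\<kappa> * s)) (at s)"
            using \<kappa> by (auto intro!: derivative_eq_intros simp flip: has_real_derivative_iff_has_vector_derivative)
          have "norm (F y s - F z s)
              \<le> L * norm ((x0 + exp (\<kappa> * s) *\<^sub>R apply_bcontfun y s) - (x0 + exp (\<kappa> * s) *\<^sub>R apply_bcontfun z s))"
            unfolding F_def by (rule L)
          also have "\<dots> = L * (exp (\<kappa> * s) * dist (apply_bcontfun y s) (apply_bcontfun z s))"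
            by (simp add: dist_norm flip: scaleR_diff_right)
          also have "\<dots> \<le> L * (exp (\<kappa> * s) * dist y z)"
            by (intro mult_left_mono dist_bounded L) auto
          finally show "norm (F y s - F z s) \<le> L * dist y z * exp (\<kappa> * s)" by (simp add: mult_ac)
        qed (use \<kappa> in \<open>auto intro!: continuous_intros\<close>)
        also have "\<dots> \<le> (L / \<kappa> * dist y z) * exp (\<kappa> * t)" using L \<kappa> by simp
        finally have "exp (- \<kappa> * t) * norm (I y t - I z t)
            \<le> exp (- \<kappa> * t) * ((L / \<kappa> * dist y z) * exp (\<kappa> * t))"
          by (intro mult_left_mono) (auto simp: I0)
        also have "\<dots> = L / \<kappa> * dist y z" by (simp add: exp_minus field_simps)
        finally show ?thesis using True
          by (simp add: Bcontfun_inverse[OF bc] \<Phi>_def dist_norm flip: scaleR_diff_right)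
      qed (use L \<kappa> in \<open>simp add: Bcontfun_inverse[OF bc] \<Phi>_def I0 max_def\<close>)
    qed
  qed
  then obtain z where "Bcontfun (\<Phi> z) = z" by blast
  then have z: "apply_bcontfun z t = \<Phi> z t" for t using Bcontfun_inverse[OF bc, of z] by simp
  have fix_eq: "F z t = f (x0 + I z t)" if "t \<ge> 0" for t
    using that unfolding F_def z by (simp add: \<Phi>_def max_def flip: exp_add)
  show ?thesis
  proof (intro exI[of _ "\<lambda>t. x0 + I z t"] conjI allI impI)
    show "((\<lambda>t. x0 + I z t) has_vector_derivative f (x0 + I z t)) (at t within {0..})" if "t \<ge> 0" for t
      using dI[OF that, of z] fix_eq[OF that] by (auto intro!: derivative_eq_intros)
  qed (simp add: I0)
qed

lemma norm_vec_le_sum: "norm (x :: 'a::real_normed_vector ^ 'v::finite) \<le> (\<Sum>v\<in>UNIV. norm (x $ v))"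
  unfolding norm_vec_def by (rule L2_set_le_sum) simp

text \<open>
  The labelling identifies configurations with vectors indexed by a finite type, which form a
  Banach space.
\<close>

lemma bounded_interaction_solution:
  fixes h :: "nat \<Rightarrow> nat \<Rightarrow> real ^ 'd::finite \<Rightarrow> real ^ 'd" and label :: "'v::finite \<Rightarrow> nat"
  assumes label: "bij_betw label UNIV {1..n}"
    and L: "0 \<le> L" "\<And>k j x y. k \<in> {1..n} \<Longrightarrow> j \<in> {1..n} \<Longrightarrow> norm (h k j x - h k j y) \<le> L * norm (x - y)"
    and M: "\<And>k j x. k \<in> {1..n} \<Longrightarrow> j \<in> {1..n} \<Longrightarrow> norm (h k j x) \<le> M"
    and S: "\<And>k. k \<in> {1..n} \<Longrightarrow> S k \<subseteq> {1..n}" and p0: "p0 \<in> configs n"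
  obtains p where "p 0 = p0" "\<And>t. p t \<in> configs n"
    "\<And>t k. 0 \<le> t \<Longrightarrow> k \<in> {1..n} \<Longrightarrow>
      ((\<lambda>s. p s k) has_vector_derivative - (\<Sum>j\<in>S k. h k j (p t k - p t j))) (at t within {0..})"
proof -
  define ix where "ix = inv_into UNIV label"
  have ix: "label (ix k) = k" if "k \<in> {1..n}" for k
    using label that unfolding ix_def by (simp add: bij_betw_def f_inv_into_f)
  have ix': "ix (label v) = v" for v
    using label unfolding ix_def by (simp add: bij_betw_def)
  have lab: "label v \<in> {1..n}" for v using label by (auto simp: bij_betw_def)
  define f :: "(real ^ 'd) ^ 'v \<Rightarrow> (real ^ 'd) ^ 'v" where
    "f X = (\<chi> v. - (\<Sum>j\<in>S (label v). h (label v) j (X $ v - X $ ix j)))" for X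
  have cardS: "real (card (S (label v))) \<le> real n" for v
    using card_mono[OF _ S[OF lab]] by simp
  have bnd: "norm (f X) \<le> real CARD('v) * (real n * \<bar>M\<bar>)" for X
  proof -
    have "norm (f X $ v) \<le> real n * \<bar>M\<bar>" for v
    proof -
      have "norm (\<Sum>j\<in>S (label v). h (label v) j (X $ v - X $ ix j)) \<le> of_nat (card (S (label v))) * \<bar>M\<bar>"
        by (rule sum_norm_bound, rule order_trans[OF M[OF lab]]) (use subsetD[OF S[OF lab[of v]]] in auto)
      also have "\<dots> \<le> real n * \<bar>M\<bar>" using cardS by (intro mult_right_mono) auto
      finally show ?thesis by (simp add: f_def)
    qed
    then have "(\<Sum>v\<in>UNIV. norm (f X $ v)) \<le> (\<Sum>v\<in>(UNIV :: 'v set). real n * \<bar>M\<bar>)"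
      by (intro sum_mono)
    then show ?thesis using norm_vec_le_sum[of "f X"] by simp
  qed
  have lip: "norm (f X - f Y) \<le> (real CARD('v) * (real n * (L * 2))) * norm (X - Y)" for X Y
  proof -
    have "norm ((f X - f Y) $ v) \<le> real n * (L * 2 * norm (X - Y))" for v
    proof -
      have "norm (h (label v) j (X $ v - X $ ix j) - h (label v) j (Y $ v - Y $ ix j)) \<le> L * 2 * norm (X - Y)"
        if "j \<in> S (label v)" for j
      proof -
        have "norm (h (label v) j (X $ v - X $ ix j) - h (label v) j (Y $ v - Y $ ix j))
            \<le> L * norm ((X $ v - X $ ix j) - (Y $ v - Y $ ix j))"
          using subsetD[OF S[OF lab[of v]] that] by (intro L lab)
        also have "(X $ v - X $ ix j) - (Y $ v - Y $ ix j) = (X - Y) $ v - (X - Y) $ ix j" by simp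
        also have "norm \<dots> \<le> norm (X - Y) + norm (X - Y)"
          by (rule order_trans[OF norm_triangle_ineq4]) (intro add_mono Finite_Cartesian_Product.norm_nth_le)
        finally show ?thesis using L(1) by (simp add: mult_left_mono)
      qed
      then have "norm (\<Sum>j\<in>S (label v). h (label v) j (X $ v - X $ ix j) - h (label v) j (Y $ v - Y $ ix j))
          \<le> of_nat (card (S (label v))) * (L * 2 * norm (X - Y))"
        by (rule sum_norm_bound)
      also have "\<dots> \<le> real n * (L * 2 * norm (X - Y))"
        using cardS L(1) by (intro mult_right_mono) auto
      finally show ?thesis by (simp add: f_def sum_subtractf norm_minus_commute)
    qed
    then have "(\<Sum>v\<in>UNIV. norm ((f X - f Y) $ v)) \<le> (\<Sum>v\<in>(UNIV :: 'v set). real n * (L * 2 * norm (X - Y)))"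
      by (intro sum_mono)
    then show ?thesis using norm_vec_le_sum[of "f X - f Y"] by (simp add: mult.assoc)
  qed
  have "0 \<le> real CARD('v) * (real n * (L * 2))" using L(1) by simp
  from lipschitz_ode_global[OF this lip bnd, of "\<chi> v. p0 (label v)"]
  obtain x where x: "x 0 = (\<chi> v. p0 (label v))"
      "\<And>t. 0 \<le> t \<Longrightarrow> (x has_vector_derivative f (x t)) (at t within {0..})"
    by blast
  define p where "p t = (\<lambda>k\<in>{1..n}. x t $ ix k)" for t
  show ?thesis
  proof (rule that)
    show "p 0 = p0"
    proof
      fix k
      show "p 0 k = p0 k"
      proof (cases "k \<in> {1..n}")
        case True
        show ?thesis unfolding p_def x(1) restrict_apply'[OF True] vec_lambda_beta ix[OF True] by (rule refl)
      next
        case False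
        show ?thesis
          unfolding p_def restrict_def if_not_P[OF False] PiE_arb[OF p0[unfolded configs_def] False] by (rule refl)
      qed
    qed
    show "p t \<in> configs n" for t by (simp add: p_def configs_def)
    show "((\<lambda>s. p s k) has_vector_derivative - (\<Sum>j\<in>S k. h k j (p t k - p t j))) (at t within {0..})"
      if t: "0 \<le> t" and k: "k \<in> {1..n}" for t k
    proof -
      have "((\<lambda>s. x s $ ix k) has_vector_derivative f (x t) $ ix k) (at t within {0..})"
        by (rule bounded_linear.has_vector_derivative[OF bounded_linear_vec_nth x(2)[OF t]])
      also have "f (x t) $ ix k = - (\<Sum>j\<in>S k. h k j (x t $ ix k - x t $ ix j))"
        by (simp add: f_def ix[OF k])
      also have "\<dots> = - (\<Sum>j\<in>S k. h k j (p t k - p t j))"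
        using subsetD[OF S[OF k]] k by (intro arg_cong[where f = uminus] sum.cong refl) (simp add: p_def)
      finally show ?thesis by (simp only: p_def restrict_apply'[OF k])
    qed
  qed
qed

text \<open>
  Clipping the argument to a ball turns the cubic interaction of the controller into a bounded
  Lipschitz function without changing it near the target.
\<close>

lemma clipped_cubic:
  fixes R c :: real
  assumes "0 \<le> R" "\<bar>c\<bar> \<le> R\<^sup>2"
  defines "cl \<equiv> closest_point (cball (0 :: 'a::euclidean_space) R)"
  shows "norm (((norm (cl x))\<^sup>2 - c) *\<^sub>R cl x - ((norm (cl y))\<^sup>2 - c) *\<^sub>R cl y) \<le> 4 * R\<^sup>2 * norm (x - y)"
    and "norm (((norm (cl x))\<^sup>2 - c) *\<^sub>R cl x) \<le> 2 * R\<^sup>2 * R"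
proof -
  have ball: "cball (0::'a) R \<noteq> {}" using assms(1) by simp
  have le: "norm (cl x) \<le> R" for x
    using closest_point_in_set[OF closed_cball ball, of x] by (simp add: cl_def)
  have sq: "(norm (cl x))\<^sup>2 \<le> R\<^sup>2" for x by (rule power_mono[OF le]) simp
  have "norm (cl x - cl y) \<le> norm (x - y)"
    using closest_point_lipschitz[OF convex_cball closed_cball ball, of x y] by (simp add: cl_def dist_norm)
  define a b where "a = cl x" and "b = cl y"
  have ab: "norm a \<le> R" "norm b \<le> R" "(norm a)\<^sup>2 \<le> R\<^sup>2" by (simp_all add: a_def b_def le sq)
  have "((norm a)\<^sup>2 - c) *\<^sub>R a - ((norm b)\<^sup>2 - c) *\<^sub>R b
      = ((norm a)\<^sup>2 - c) *\<^sub>R (a - b) + ((norm a)\<^sup>2 - (norm b)\<^sup>2) *\<^sub>R b"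
    by (simp add: algebra_simps)
  also have "norm \<dots> \<le> 2 * R\<^sup>2 * norm (a - b) + 2 * R * norm (a - b) * R"
  proof (rule norm_triangle_le, rule add_mono)
    have "\<bar>(norm a)\<^sup>2 - c\<bar> \<le> 2 * R\<^sup>2" using ab(3) assms(2) zero_le_power2[of "norm a"] by linarith
    then show "norm (((norm a)\<^sup>2 - c) *\<^sub>R (a - b)) \<le> 2 * R\<^sup>2 * norm (a - b)"
      by (simp add: mult_right_mono)
    have "\<bar>(norm a)\<^sup>2 - (norm b)\<^sup>2\<bar> = (norm a + norm b) * \<bar>norm a - norm b\<bar>"
      by (simp add: power2_eq_square square_diff_square_factored abs_mult)
    also have "\<dots> \<le> (2 * R) * norm (a - b)"
      using ab assms(1) by (intro mult_mono norm_triangle_ineq3) auto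
    finally show "norm (((norm a)\<^sup>2 - (norm b)\<^sup>2) *\<^sub>R b) \<le> 2 * R * norm (a - b) * R"
      using ab assms(1) by (simp add: mult_mono)
  qed
  also have "\<dots> = 4 * R\<^sup>2 * norm (a - b)" by (simp add: power2_eq_square)
  also have "\<dots> \<le> 4 * R\<^sup>2 * norm (x - y)"
    using \<open>norm (cl x - cl y) \<le> norm (x - y)\<close> by (intro mult_left_mono) (auto simp: a_def b_def)
  finally show "norm (((norm (cl x))\<^sup>2 - c) *\<^sub>R cl x - ((norm (cl y))\<^sup>2 - c) *\<^sub>R cl y) \<le> 4 * R\<^sup>2 * norm (x - y)"
    by (simp only: a_def b_def)
  have "\<bar>(norm (cl x))\<^sup>2 - c\<bar> \<le> 2 * R\<^sup>2"
    using sq[of x] assms(2) zero_le_power2[of "norm (cl x)"] by linarith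
  then show "norm (((norm (cl x))\<^sup>2 - c) *\<^sub>R cl x) \<le> 2 * R\<^sup>2 * R"
    using le[of x] by (simp add: mult_mono)
qed

text \<open>
  The hypothesis is what a bound \<open>A c exp (- c t)\<close> on the speed gives after integration.
\<close>

lemma exponential_limit:
  fixes x :: "real \<Rightarrow> 'a::banach"
  assumes c: "0 < c" and A: "0 \<le> A"
    and x: "\<And>s t. 0 \<le> s \<Longrightarrow> s \<le> t \<Longrightarrow> norm (x t - x s) \<le> A * (exp (- c * s) - exp (- c * t))"
  obtains q where "\<And>t. 0 \<le> t \<Longrightarrow> norm (x t - q) \<le> A * exp (- c * t)"
proof -
  have le: "norm (x t - x s) \<le> A * exp (- c * s)" if "0 \<le> s" "s \<le> t" for s t
  proof -
    have "A * (exp (- c * s) - exp (- c * t)) \<le> A * exp (- c * s)" using A by (intro mult_left_mono) auto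
    then show ?thesis using x[OF that] by linarith
  qed
  have lim: "(\<lambda>k. A * exp (- c * real k)) \<longlonglongrightarrow> 0"
    using c by real_asymp
  have "Cauchy (\<lambda>k. x (real k))"
  proof (rule CauchyI')
    fix e :: real assume "0 < e"
    then obtain M where M: "A * exp (- c * real k) < e" if "k \<ge> M" for k
      using order_tendstoD(2)[OF lim \<open>0 < e\<close>] by (auto simp: eventually_sequentially)
    have "dist (x (real k)) (x (real l)) < e" if "M \<le> k" "k < l" for k l
      using le[of "real k" "real l"] M[OF that(1)] that by (simp add: dist_norm norm_minus_commute)
    then show "\<exists>M. \<forall>m\<ge>M. \<forall>n>m. dist (x (real m)) (x (real n)) < e" by blast
  qed
  then obtain q where q: "(\<lambda>k. x (real k)) \<longlonglongrightarrow> q" using Cauchy_convergent convergent_def by blast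
  have "norm (x t - q) \<le> A * exp (- c * t)" if t: "0 \<le> t" for t
  proof -
    have "eventually (\<lambda>k. t \<le> real k) sequentially"
      by (rule eventually_sequentiallyI[of "nat \<lceil>t\<rceil>"]) linarith
    then have "eventually (\<lambda>k. norm (x (real k) - x t) \<le> A * exp (- c * t)) sequentially"
      by eventually_elim (rule le[OF t])
    moreover have "(\<lambda>k. norm (x (real k) - x t)) \<longlonglongrightarrow> norm (q - x t)" by (intro tendsto_intros q)
    ultimately have "norm (q - x t) \<le> A * exp (- c * t)" by (intro tendsto_upperbound) auto
    then show ?thesis by (simp add: norm_minus_commute)
  qed
  then show ?thesis by (rule that)
qed

section \<open>Convergence from a Lyapunov function\<close>

definition length_error :: "'d::finite config \<Rightarrow> 'd config \<Rightarrow> nat \<Rightarrow> nat \<Rightarrow> real" where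
  "length_error ps p i j = (norm (p i - p j))\<^sup>2 - (norm (ps i - ps j))\<^sup>2"

definition out_field :: "(nat \<Rightarrow> nat set) \<Rightarrow> 'd::finite config \<Rightarrow> 'd config \<Rightarrow> 'd config" where
  "out_field S ps p k = - (\<Sum>j\<in>S k. length_error ps p k j *\<^sub>R (p k - p j))"

definition exponentially_attracting :: "nat \<Rightarrow> (nat \<Rightarrow> nat set) \<Rightarrow> 'd::finite config \<Rightarrow> real \<Rightarrow> bool" where
  "exponentially_attracting n S ps c \<longleftrightarrow> (\<exists>\<delta>>0. \<exists>K>0. \<forall>p0\<in>configs n. (\<forall>k\<in>{1..n}. norm (p0 k - ps k) < \<delta>) \<longrightarrow>
    (\<exists>p. p 0 = p0 \<and> (\<forall>t\<ge>0. p t \<in> configs n \<and>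
        (\<forall>k\<in>{1..n}. ((\<lambda>s. p s k) has_vector_derivative out_field S ps (p t) k) (at t within {0..}))) \<and>
      (\<exists>q\<in>configs n. congruent n ps q \<and> (\<forall>t\<ge>0. config_dist n (p t) q \<le> K * exp (- c * t)))))"

text \<open>
  As long as the solution of the clipped system is near \<open>ps\<close>, the function \<open>V\<close> decays exponentially,
  and so does the speed, which is at most a multiple of \<open>sqrt V\<close> because the length errors are. The
  length of the path is then at most a multiple of \<open>sqrt (V p0)\<close>, so that the solution cannot reach the
  boundary of the neighbourhood and clipping never becomes active. In the limit all length errors vanish.
\<close>

lemma lyapunov_convergence:
  fixes ps :: "'d::finite config" and V V' :: "'d config \<Rightarrow> real" and label :: "'v::finite \<Rightarrow> nat"
  assumes label: "bij_betw label UNIV {1..n}" and S: "\<And>k. k \<in> {1..n} \<Longrightarrow> S k \<subseteq> {1..n}"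
    and pos: "0 < \<rho>" "0 < c" "0 \<le> C"
    and deriv: "\<And>x t T. (\<And>k. k \<in> {1..n} \<Longrightarrow> ((\<lambda>s. x s k) has_vector_derivative out_field S ps (x t) k) (at t within T)) \<Longrightarrow>
      ((\<lambda>s. V (x s)) has_real_derivative V' (x t)) (at t within T)"
    and nonneg: "\<And>p. 0 \<le> V p"
    and decay: "\<And>p. (\<And>k. k \<in> {1..n} \<Longrightarrow> norm (p k - ps k) \<le> \<rho>) \<Longrightarrow> V' p \<le> - (2 * c) * V p"
    and err: "\<And>p i j. (\<And>k. k \<in> {1..n} \<Longrightarrow> norm (p k - ps k) \<le> \<rho>) \<Longrightarrow> i \<in> {1..n} \<Longrightarrow> j \<in> {1..n} \<Longrightarrow>
      \<bar>length_error ps p i j\<bar> \<le> C * sqrt (V p)"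
    and small: "\<And>\<epsilon>. 0 < \<epsilon> \<Longrightarrow> \<exists>\<delta>>0. \<forall>p. (\<forall>k\<in>{1..n}. norm (p k - ps k) < \<delta>) \<longrightarrow> V p < \<epsilon>"
  shows "exponentially_attracting n S ps c"
proof -
  define R where "R = (\<Sum>i\<in>{1..n}. norm (ps i)) * 2 + 2 * \<rho>"
  have psR: "norm (ps i - ps j) \<le> R - 2 * \<rho>" if "i \<in> {1..n}" "j \<in> {1..n}" for i j
  proof -
    have "norm (ps k) \<le> (\<Sum>i\<in>{1..n}. norm (ps i))" if "k \<in> {1..n}" for k
      using that by (intro member_le_sum) auto
    from this[OF that(1)] this[OF that(2)] show ?thesis
      unfolding R_def using norm_triangle_ineq4[of "ps i" "ps j"] by linarith
  qed
  have R0: "0 \<le> R" using pos by (simp add: R_def sum_nonneg)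
  define near where "near p \<longleftrightarrow> (\<forall>k\<in>{1..n}. norm (p k - ps k) \<le> \<rho>)" for p :: "'d config"
  have nearR: "norm (p i - p j) \<le> R" if "near p" "i \<in> {1..n}" "j \<in> {1..n}" for p i j
  proof -
    have "p i - p j = (p i - ps i) - (p j - ps j) + (ps i - ps j)" by simp
    then have "norm (p i - p j) \<le> norm (p i - ps i) + norm (p j - ps j) + norm (ps i - ps j)"
      by (metis norm_triangle_le norm_triangle_ineq4 add_right_mono)
    moreover have "norm (p i - ps i) \<le> \<rho>" "norm (p j - ps j) \<le> \<rho>" using that by (auto simp: near_def)
    ultimately show ?thesis using psR[OF that(2,3)] by linarith
  qed
  define cl where "cl = closest_point (cball (0 :: real ^ 'd) R)"
  define h where "h k j a = ((norm (cl a))\<^sup>2 - (norm (ps k - ps j))\<^sup>2) *\<^sub>R cl a" for k j a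
  have sq: "\<bar>(norm (ps k - ps j))\<^sup>2\<bar> \<le> R\<^sup>2" if "k \<in> {1..n}" "j \<in> {1..n}" for k j
    using power_mono[of "norm (ps k - ps j)" R 2] psR[OF that] pos by simp
  have unclipped: "- (\<Sum>j\<in>S k. h k j (p k - p j)) = out_field S ps p k" if "near p" "k \<in> {1..n}" for p k
  proof -
    have "h k j (p k - p j) = length_error ps p k j *\<^sub>R (p k - p j)" if "j \<in> S k" for j
    proof -
      have "cl (p k - p j) = p k - p j"
        unfolding cl_def using nearR[of p k j] that \<open>near p\<close> \<open>k \<in> {1..n}\<close> S[of k]
        by (intro closest_point_self) auto
      then show ?thesis by (simp add: h_def length_error_def)
    qed
    then show ?thesis by (simp add: out_field_def)
  qed
  define C' where "C' = real n * (C * R)"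
  have C'0: "0 \<le> C'" using pos R0 by (simp add: C'_def)
  have speed: "norm (out_field S ps p k) \<le> C' * sqrt (V p)" if p: "near p" and k: "k \<in> {1..n}" for p k
  proof -
    have "norm (length_error ps p k j *\<^sub>R (p k - p j)) \<le> (C * sqrt (V p)) * R" if "j \<in> S k" for j
    proof -
      have j: "j \<in> {1..n}" using S[OF k] that by blast
      have "\<bar>length_error ps p k j\<bar> \<le> C * sqrt (V p)" using p by (intro err k j) (simp add: near_def)
      then show ?thesis using nearR[OF p k j] pos nonneg[of p] by (simp add: mult_mono)
    qed
    then have "norm (\<Sum>j\<in>S k. length_error ps p k j *\<^sub>R (p k - p j)) \<le> of_nat (card (S k)) * ((C * sqrt (V p)) * R)"
      by (rule sum_norm_bound)
    also have "\<dots> \<le> real n * ((C * sqrt (V p)) * R)"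
      using card_mono[OF _ S[OF k]] pos R0 nonneg[of p] by (intro mult_right_mono) auto
    finally show ?thesis by (simp add: out_field_def C'_def mult_ac)
  qed
  \<comment> \<open>For such initial values the length of the path is at most a quarter of the radius.\<close>
  define \<epsilon> where "\<epsilon> = min 1 ((\<rho> * c / (4 * (C' + 1)))\<^sup>2)"
  have \<epsilon>: "0 < \<epsilon>" using pos C'0 by (simp add: \<epsilon>_def)
  obtain \<delta>' where \<delta>': "0 < \<delta>'" "\<And>p. (\<forall>k\<in>{1..n}. norm (p k - ps k) < \<delta>') \<Longrightarrow> V p < \<epsilon>"
    using small[OF \<epsilon>] by blast
  define \<delta> where "\<delta> = min \<delta>' (\<rho> / 2)"
  define A where "A = C' / c"
  have A0: "0 \<le> A" using C'0 pos by (simp add: A_def)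
  define K where "K = real n * A + 1"
  have "\<exists>p. p 0 = p0 \<and> (\<forall>t\<ge>0. p t \<in> configs n \<and>
        (\<forall>k\<in>{1..n}. ((\<lambda>s. p s k) has_vector_derivative out_field S ps (p t) k) (at t within {0..}))) \<and>
      (\<exists>q\<in>configs n. congruent n ps q \<and> (\<forall>t\<ge>0. config_dist n (p t) q \<le> K * exp (- c * t)))"
    if p0: "p0 \<in> configs n" and p0\<delta>: "\<forall>k\<in>{1..n}. norm (p0 k - ps k) < \<delta>" for p0
  proof -
    obtain x where x: "x 0 = p0" "\<And>t. x t \<in> configs n"
      and dx: "\<And>t k. 0 \<le> t \<Longrightarrow> k \<in> {1..n} \<Longrightarrow>
        ((\<lambda>s. x s k) has_vector_derivative - (\<Sum>j\<in>S k. h k j (x t k - x t j))) (at t within {0..})"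
    proof (rule bounded_interaction_solution[OF label, of "4 * R\<^sup>2" h "2 * R\<^sup>2 * R" S p0])
      show "norm (h k j a - h k j b) \<le> 4 * R\<^sup>2 * norm (a - b)" if "k \<in> {1..n}" "j \<in> {1..n}" for k j a b
        unfolding h_def cl_def by (rule clipped_cubic(1)[OF R0 sq[OF that]])
      show "norm (h k j a) \<le> 2 * R\<^sup>2 * R" if "k \<in> {1..n}" "j \<in> {1..n}" for k j a
        unfolding h_def cl_def by (rule clipped_cubic(2)[OF R0 sq[OF that]])
    qed (use S p0 in auto)
    have contx: "continuous_on {0..} (\<lambda>s. x s k)" if "k \<in> {1..n}" for k
      using dx[OF _ that] by (auto simp: continuous_on_eq_continuous_within intro: has_vector_derivative_continuous)
    have V0: "0 \<le> V p0" "V p0 < \<epsilon>" "V p0 \<le> 1"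
    proof -
      show "0 \<le> V p0" by (rule nonneg)
      show "V p0 < \<epsilon>" using p0\<delta> by (intro \<delta>'(2)) (auto simp: \<delta>_def)
      then show "V p0 \<le> 1" by (simp add: \<epsilon>_def)
    qed
    have est: "sqrt (V (x t)) \<le> exp (- c * t)" (is ?decay)
        "norm (x t k - x s k) \<le> A * sqrt (V p0) * (exp (- c * s) - exp (- c * t))" (is ?path)
      if T: "\<And>t. 0 \<le> t \<Longrightarrow> t \<le> T \<Longrightarrow> near (x t)" and st: "0 \<le> s" "s \<le> t" "t \<le> T" and k: "k \<in> {1..n}" for T s t k
    proof -
      have dxf: "((\<lambda>s. x s k) has_vector_derivative out_field S ps (x t) k) (at t within {0..})"
        if "0 \<le> t" "t \<le> T" "k \<in> {1..n}" for t k
        using dx[OF that(1,3)] unclipped[OF T[OF that(1,2)] that(3)] by simp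
      have V: "V (x t) \<le> V p0 * exp (- (2 * c) * t)" if t: "0 \<le> t" "t \<le> T" for t
      proof -
        have "V (x t) * exp (2 * c * t) \<le> V (x 0) * exp (2 * c * 0)"
        proof (rule decreasing_of_deriv_nonpos[OF _ t(1)])
          fix s assume s: "0 \<le> s" "s \<le> t"
          have "((\<lambda>s. V (x s)) has_real_derivative V' (x s)) (at s within {0..})"
            by (rule deriv) (use dxf s t in auto)
          then show "((\<lambda>s. V (x s) * exp (2 * c * s)) has_real_derivative
              exp (2 * c * s) * (V' (x s) + (2 * c) * V (x s))) (at s within {0..})"
            by (auto intro!: derivative_eq_intros simp: algebra_simps)
        next
          fix s assume s: "0 < s" "s < t"
          have "V' (x s) \<le> - (2 * c) * V (x s)" using T[of s] s t by (intro decay) (simp add: near_def)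
          then show "exp (2 * c * s) * (V' (x s) + (2 * c) * V (x s)) \<le> 0"
            by (simp add: mult_le_0_iff)
        qed simp
        then have "V (x t) * exp (2 * c * t) * exp (- (2 * c * t)) \<le> V p0 * exp (- (2 * c * t))"
          by (intro mult_right_mono) (simp_all add: x(1))
        then show ?thesis by (simp add: mult.assoc flip: exp_add)
      qed
      have sqrtV: "sqrt (V (x t)) \<le> sqrt (V p0) * exp (- c * t)" if t: "0 \<le> t" "t \<le> T" for t
      proof -
        have "V p0 * exp (- (2 * c) * t) = (sqrt (V p0) * exp (- c * t))\<^sup>2"
          using exp_double[of "- c * t"] V0(1) by (simp add: power_mult_distrib mult.assoc)
        then show ?thesis using V[OF t] V0(1) by (intro real_le_lsqrt) simp_all
      qed
      have "sqrt (V p0) \<le> 1" using V0 by simp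
      then have "sqrt (V p0) * exp (- c * t) \<le> 1 * exp (- c * t)" by (rule mult_right_mono) simp
      then show ?decay using sqrtV[of t] st by linarith
      show ?path
      proof (cases "s = t")
        case False
        have "norm (x t k - x s k) \<le> - (A * sqrt (V p0)) * exp (- c * t) - (- (A * sqrt (V p0)) * exp (- c * s))"
        proof (rule differentiable_bound_general)
          show "s < t" using False st by simp
          show "continuous_on {s..t} (\<lambda>s. x s k)"
            by (rule continuous_on_subset[OF contx[OF k]]) (use st in auto)
          show "continuous_on {s..t} (\<lambda>t. - (A * sqrt (V p0)) * exp (- c * t))" by (intro continuous_intros)
          fix u assume u: "s < u" "u < t"
          show "((\<lambda>s. x s k) has_vector_derivative out_field S ps (x u) k) (at u)"
            using dxf[of u k] u st k at_within_atLeast[of u] by simp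
          show "((\<lambda>t. - (A * sqrt (V p0)) * exp (- c * t)) has_vector_derivative
              C' * (sqrt (V p0) * exp (- c * u))) (at u)"
            using pos by (auto intro!: derivative_eq_intros simp: A_def simp flip: has_real_derivative_iff_has_vector_derivative)
          have "norm (out_field S ps (x u) k) \<le> C' * sqrt (V (x u))" using u st by (intro speed T k) auto
          also have "\<dots> \<le> C' * (sqrt (V p0) * exp (- c * u))"
            using u st C'0 by (intro mult_left_mono sqrtV) auto
          finally show "norm (out_field S ps (x u) k) \<le> C' * (sqrt (V p0) * exp (- c * u))" .
        qed
        then show ?thesis by (simp add: algebra_simps)
      qed simp
    qed
    have Asmall: "A * sqrt (V p0) \<le> \<rho> / 4"
    proof -
      have "sqrt (V p0) \<le> \<rho> * c / (4 * (C' + 1))"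
        using V0 pos C'0 by (intro real_le_lsqrt) (auto simp: \<epsilon>_def)
      then have "C' * sqrt (V p0) \<le> (C' + 1) * (\<rho> * c / (4 * (C' + 1)))"
        using C'0 V0(1) by (intro mult_mono) auto
      also have "\<dots> = \<rho> / 4 * c" using C'0 by (simp add: field_simps)
      finally show ?thesis using pos by (simp add: A_def field_simps)
    qed
    have close: "norm (x t k - ps k) \<le> 3 / 4 * \<rho>" if "\<And>t. 0 \<le> t \<Longrightarrow> t \<le> T \<Longrightarrow> near (x t)" "0 \<le> t" "t \<le> T" "k \<in> {1..n}" for T t k
    proof -
      have "norm (x t k - x 0 k) \<le> A * sqrt (V p0) * (exp (- c * 0) - exp (- c * t))"
        using that by (intro est(2)) auto
      also have "\<dots> \<le> A * sqrt (V p0) * 1" using A0 V0(1) by (intro mult_left_mono) auto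
      finally have "norm (x t k - p0 k) \<le> \<rho> / 4" using Asmall x(1) by simp
      moreover have "norm (p0 k - ps k) \<le> \<rho> / 2" using p0\<delta> that(4) by (force simp: \<delta>_def)
      ultimately show ?thesis using norm_triangle_ineq[of "x t k - p0 k" "p0 k - ps k"] by simp
    qed
    have near: "near (x t)" if t: "0 \<le> t" for t
    proof (rule ccontr)
      assume "\<not> near (x t)"
      define B where "B = {s \<in> {0..}. \<exists>k\<in>{1..n}. \<rho> \<le> norm (x s k - ps k)}"
      have "B = (\<Union>k\<in>{1..n}. {s \<in> {0..}. \<rho> \<le> norm (x s k - ps k)})" by (auto simp: B_def)
      moreover have "closed {s \<in> {0..}. \<rho> \<le> norm (x s k - ps k)}" if "k \<in> {1..n}" for k
        by (intro continuous_on_closed_Collect_le continuous_intros contx that closed_atLeast)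
      ultimately have "closed B" by auto
      have "t \<in> B" using \<open>\<not> near (x t)\<close> t by (force simp: B_def near_def)
      \<comment> \<open>The first time at which the boundary of the neighbourhood is reached.\<close>
      define T where "T = Inf B"
      have bdd: "bdd_below B" by (rule bdd_belowI[of _ 0]) (auto simp: B_def)
      have "T \<in> B" unfolding T_def using \<open>t \<in> B\<close> bdd \<open>closed B\<close> by (intro closed_contains_Inf) auto
      then have T0: "0 \<le> T" by (simp add: B_def)
      have below: "norm (x s k - ps k) < \<rho>" if "0 \<le> s" "s < T" "k \<in> {1..n}" for s k
      proof (rule ccontr)
        assume "\<not> ?thesis"
        then have "s \<in> B" using that by (force simp: B_def)
        then show False using cInf_lower[OF _ bdd, of s] that by (simp add: T_def)
      qed
      obtain k where k: "k \<in> {1..n}" "\<rho> \<le> norm (x T k - ps k)" using \<open>T \<in> B\<close> by (auto simp: B_def)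
      have "T \<noteq> 0"
      proof
        assume "T = 0"
        then show False using k p0\<delta> pos by (force simp: x(1) \<delta>_def)
      qed
      then have Tpos: "0 < T" using T0 by simp
      have "norm (x s k - ps k) \<le> \<rho>" if s: "0 \<le> s" "s \<le> T" and k: "k \<in> {1..n}" for s k
      proof (rule continuous_on_closure_norm_le[where f = "\<lambda>s. x s k - ps k" and s = "{0..<T}"])
        show "continuous_on (closure {0..<T}) (\<lambda>s. x s k - ps k)"
          using Tpos by (intro continuous_intros continuous_on_subset[OF contx[OF k]]) auto
        show "\<forall>y\<in>{0..<T}. norm (x y k - ps k) \<le> \<rho>" using below k by (auto intro: less_imp_le)
        show "s \<in> closure {0..<T}" using s Tpos by simp
      qed
      then have "near (x s)" if "0 \<le> s" "s \<le> T" for s using that by (simp add: near_def)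
      then have "norm (x T k - ps k) \<le> 3 / 4 * \<rho>" using T0 k(1) by (intro close[of T]) auto
      then show False using k(2) pos by simp
    qed
    have path: "norm (x t k - x s k) \<le> A * (exp (- c * s) - exp (- c * t))"
      if "0 \<le> s" "s \<le> t" "k \<in> {1..n}" for s t k
    proof -
      have "norm (x t k - x s k) \<le> A * sqrt (V p0) * (exp (- c * s) - exp (- c * t))"
        by (rule est(2)[of t]) (use near that in auto)
      also have "\<dots> \<le> A * 1 * (exp (- c * s) - exp (- c * t))"
        using A0 V0 pos that by (intro mult_right_mono mult_left_mono) auto
      finally show ?thesis by simp
    qed
    have "\<exists>q. \<forall>t\<ge>0. norm (x t k - q) \<le> A * exp (- c * t)" if "k \<in> {1..n}" for k
      using exponential_limit[OF pos(2) A0 path[OF _ _ that]] by blast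
    then obtain q0 where q0: "\<And>k t. k \<in> {1..n} \<Longrightarrow> 0 \<le> t \<Longrightarrow> norm (x t k - q0 k) \<le> A * exp (- c * t)"
      by metis
    define q where "q = restrict q0 {1..n}"
    have q: "norm (x t k - q k) \<le> A * exp (- c * t)" if "k \<in> {1..n}" "0 \<le> t" for k t
      using q0[OF that] that(1) by (simp add: q_def)
    have lim0: "(\<lambda>l. B * exp (- c * real l)) \<longlonglongrightarrow> 0" for B
      using pos by real_asymp
    have limx: "(\<lambda>l. x (real l) k) \<longlonglongrightarrow> q k" if "k \<in> {1..n}" for k
    proof -
      have "(\<lambda>l. x (real l) k - q k) \<longlonglongrightarrow> 0"
        by (rule Lim_null_comparison[OF _ lim0[of A]]) (use q[OF that] in auto)
      then show ?thesis by (simp add: LIM_zero_iff)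
    qed
    have "dist (q i) (q j) = dist (ps i) (ps j)" if "i \<in> {1..n}" "j \<in> {1..n}" for i j
    proof -
      have "(\<lambda>l. length_error ps (x (real l)) i j) \<longlonglongrightarrow> 0"
      proof (rule Lim_null_comparison[OF _ lim0[of C]], rule always_eventually, rule allI)
        fix l :: nat
        have "\<bar>length_error ps (x (real l)) i j\<bar> \<le> C * sqrt (V (x (real l)))"
          using near[of "real l"] by (intro err that) (simp add: near_def)
        also have "\<dots> \<le> C * exp (- c * real l)"
          using pos that(1) near by (intro mult_left_mono est(1)[of "real l" "real l" "real l" i]) auto
        finally show "norm (length_error ps (x (real l)) i j) \<le> C * exp (- c * real l)" by simp
      qed
      moreover have "(\<lambda>l. length_error ps (x (real l)) i j) \<longlonglongrightarrow> length_error ps q i j"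
        unfolding length_error_def by (intro tendsto_intros limx that)
      ultimately have "length_error ps q i j = 0" by (rule LIMSEQ_unique[rotated])
      then show ?thesis by (simp add: length_error_def dist_norm)
    qed
    then have "congruent n ps q" by (simp add: congruent_iff_dist)
    moreover have "q \<in> configs n" by (simp add: q_def configs_def)
    moreover have "config_dist n (x t) q \<le> K * exp (- c * t)" if t: "0 \<le> t" for t
    proof -
      have "config_dist n (x t) q \<le> (\<Sum>k\<in>{1..n}. dist (x t k) (q k))"
        unfolding config_dist_def by (rule L2_set_le_sum) simp
      also have "\<dots> \<le> (\<Sum>k\<in>{1..n}. A * exp (- c * t))"
        by (rule sum_mono) (simp only: dist_norm q[OF _ t])
      also have "\<dots> \<le> K * exp (- c * t)" by (simp add: K_def algebra_simps)
      finally show ?thesis .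
    qed
    moreover have "((\<lambda>s. x s k) has_vector_derivative out_field S ps (x t) k) (at t within {0..})"
      if "0 \<le> t" "k \<in> {1..n}" for t k
      using dx[OF that] unclipped[OF near[OF that(1)] that(2)] by simp
    ultimately show ?thesis using x by blast
  qed
  moreover have "0 < \<delta>" "0 < K" using \<delta>'(1) pos A0 by (auto simp: \<delta>_def K_def add_nonneg_pos)
  ultimately show ?thesis unfolding exponentially_attracting_def by blast
qed

section \<open>The cyclic orientation\<close>

definition leader :: "nat \<Rightarrow> nat \<Rightarrow> bool" where
  "leader m i \<longleftrightarrow> i = 1 \<or> m < i"

text \<open>
  The leaders are 1 and the basis vertices beyond \<open>m\<close>. The classes of followers are the residue
  classes modulo 3, and within a class the arcs point to the smaller vertex.
\<close>

definition cyclic_arcs :: "nat \<Rightarrow> nat \<Rightarrow> (nat \<times> nat) set" where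
  "cyclic_arcs m n = {(i, j). i \<in> {1..n} \<and> j \<in> {1..n} \<and>
     (if leader m i then leader m j \<and> j < i
      else leader m j \<or> j mod 3 = Suc i mod 3 \<or> j mod 3 = i mod 3 \<and> j < i)}"

lemma orientation_cyclic: "orientation (complete_edges n) (cyclic_arcs m n)"
proof -
  have tri: "(j mod 3 = Suc i mod 3 \<or> j mod 3 = i mod 3 \<and> j < i) \<noteq>
      (i mod 3 = Suc j mod 3 \<or> i mod 3 = j mod 3 \<and> i < j)" if "i \<noteq> j" for i j :: nat
  proof -
    have "i mod 3 < 3" "j mod 3 < 3" by simp_all
    then have "i mod 3 = 0 \<or> i mod 3 = 1 \<or> i mod 3 = 2" "j mod 3 = 0 \<or> j mod 3 = 1 \<or> j mod 3 = 2"
      by linarith+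
    moreover have "j < i \<longleftrightarrow> \<not> i < j" using that by linarith
    ultimately show ?thesis by (elim disjE) (simp_all add: mod_Suc)
  qed
  have irrefl: "(i, i) \<notin> cyclic_arcs m n" for i
  proof -
    have "i mod 3 \<noteq> Suc i mod 3" by (simp add: mod_Suc)
    then show ?thesis by (simp add: cyclic_arcs_def)
  qed
  have "cyclic_arcs m n \<subseteq> complete_edges n \<union> (complete_edges n)\<inverse>"
  proof
    fix e assume e: "e \<in> cyclic_arcs m n"
    obtain i j where ij: "e = (i, j)" by (cases e)
    have "i \<noteq> j" using e irrefl ij by auto
    moreover have "i \<in> {1..n}" "j \<in> {1..n}" using e by (simp_all add: ij cyclic_arcs_def)
    ultimately show "e \<in> complete_edges n \<union> (complete_edges n)\<inverse>"
      by (cases "i < j") (simp_all add: ij complete_edges_def)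
  qed
  moreover have "((i, j) \<in> cyclic_arcs m n) \<noteq> ((j, i) \<in> cyclic_arcs m n)"
    if "(i, j) \<in> complete_edges n" for i j
  proof -
    have ij: "i \<in> {1..n}" "j \<in> {1..n}" "i < j" using that by (simp_all add: complete_edges_def)
    then show ?thesis using tri[of i j] by (cases "leader m i"; cases "leader m j") (simp_all add: cyclic_arcs_def)
  qed
  ultimately show ?thesis unfolding orientation_def by blast
qed

definition out_set :: "nat \<Rightarrow> nat \<Rightarrow> nat \<Rightarrow> nat set" where
  "out_set m n k = {j. (k, j) \<in> cyclic_arcs m n}"

definition follower_set :: "nat \<Rightarrow> nat \<Rightarrow> nat set" where
  "follower_set m k = {j \<in> {2..m}. j mod 3 = Suc k mod 3 \<or> j mod 3 = k mod 3 \<and> j < k}"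

lemma out_set_subset: "out_set m n k \<subseteq> {1..n}"
  by (auto simp: out_set_def cyclic_arcs_def)

lemma out_set_root: "out_set m n 1 = {}"
  by (auto simp: out_set_def cyclic_arcs_def leader_def)

lemma out_set_leader:
  assumes "1 \<le> m" "k \<in> {m+1..n}"
  shows "out_set m n k = insert 1 {m+1..<k}"
  using assms by (auto simp: out_set_def cyclic_arcs_def leader_def)

lemma out_set_follower:
  assumes "m \<le> n" "k \<in> {2..m}"
  shows "out_set m n k = insert 1 ({m+1..n} \<union> follower_set m k)"
  using assms by (auto simp: out_set_def cyclic_arcs_def leader_def follower_set_def)

lemma target_inner:
  assumes "i \<in> {m+1..m + CARD('d)}" "j \<in> {m+1..m + CARD('d)}"
  shows "(target m i :: real ^ 'd::finite) \<bullet> target m j = (if i = j then 1 else 0)"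
proof -
  obtain a b :: 'd where "i = basis_vertex m a" "j = basis_vertex m b"
    using assms unfolding basis_vertex_range[of m, where 'd = 'd, symmetric] by blast
  then show ?thesis by (simp add: target_basis inner_axis_axis)
qed

lemma target_parseval:
  "(\<Sum>k\<in>{m+1..m + CARD('d)}. (w \<bullet> target m k)\<^sup>2) = (norm (w :: real ^ 'd::finite))\<^sup>2"
proof -
  have "inj (basis_vertex m :: 'd \<Rightarrow> nat)" by (simp add: inj_def)
  then have "(\<Sum>k\<in>{m+1..m + CARD('d)}. (w \<bullet> target m k)\<^sup>2) = (\<Sum>a\<in>UNIV. (w \<bullet> target m (basis_vertex m (a :: 'd)))\<^sup>2)"
    unfolding basis_vertex_range[of m, where 'd = 'd, symmetric] by (simp add: sum.reindex)
  also have "\<dots> = (\<Sum>a\<in>UNIV. w $ a * w $ a)" by (simp add: target_basis inner_axis power2_eq_square)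
  also have "\<dots> = w \<bullet> w" by (simp add: inner_vec_def)
  finally show ?thesis by (simp add: power2_norm_eq_inner)
qed

lemma norm_target_le: "i \<in> {1..m + CARD('d)} \<Longrightarrow> norm (target m i :: real ^ 'd::finite) \<le> 1"
  by (erule vertex_cases) (simp_all add: target_zero target_basis)

section \<open>Elementary estimates\<close>

lemma sum_square_le_card:
  fixes f :: "'i \<Rightarrow> real"
  assumes "finite A" "card A \<le> N"
  shows "(\<Sum>i\<in>A. f i)\<^sup>2 \<le> real N * (\<Sum>i\<in>A. (f i)\<^sup>2)"
proof -
  have "(\<Sum>i\<in>A. f i)\<^sup>2 \<le> real (card A) * (\<Sum>i\<in>A. (f i)\<^sup>2)"
    using Cauchy_Schwarz_ineq_sum[of "\<lambda>i. 1" f A] by simp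
  also have "\<dots> \<le> real N * (\<Sum>i\<in>A. (f i)\<^sup>2)"
    using assms by (intro mult_right_mono sum_nonneg) auto
  finally show ?thesis .
qed

lemma norm_sum_scaleR_square_le:
  assumes "finite A" "card A \<le> N" "\<And>i. i \<in> A \<Longrightarrow> norm (r i) \<le> b" "0 \<le> b"
  shows "(norm (\<Sum>i\<in>A. e i *\<^sub>R r i))\<^sup>2 \<le> b\<^sup>2 * (real N * (\<Sum>i\<in>A. (e i)\<^sup>2))"
proof -
  have "norm (\<Sum>i\<in>A. e i *\<^sub>R r i) \<le> (\<Sum>i\<in>A. b * \<bar>e i\<bar>)"
  proof (rule sum_norm_le)
    show "norm (e i *\<^sub>R r i) \<le> b * \<bar>e i\<bar>" if "i \<in> A" for i
      using mult_left_mono[OF assms(3)[OF that] abs_ge_zero[of "e i"]] by (simp add: mult.commute)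
  qed
  then have "(norm (\<Sum>i\<in>A. e i *\<^sub>R r i))\<^sup>2 \<le> (b * (\<Sum>i\<in>A. \<bar>e i\<bar>))\<^sup>2"
    by (intro power_mono) (simp_all add: sum_distrib_left)
  also have "\<dots> \<le> b\<^sup>2 * (real N * (\<Sum>i\<in>A. (e i)\<^sup>2))"
    using sum_square_le_card[OF assms(1,2), of "\<lambda>i. \<bar>e i\<bar>"] by (simp add: power_mult_distrib mult_left_mono)
  finally show ?thesis .
qed

text \<open>
  Quantitative linear independence of the vectors \<open>r'\<close> survives a small perturbation.
\<close>

lemma perturbed_lower_bound:
  fixes r r' :: "'i \<Rightarrow> 'a::real_inner"
  assumes A: "finite A" "card A \<le> N"
    and near: "\<And>i. i \<in> A \<Longrightarrow> norm (r i - r' i) \<le> b" "0 \<le> b" "4 * b\<^sup>2 * (real N * (real N + 1)) \<le> 1"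
    and low: "(\<Sum>i\<in>A. (e i)\<^sup>2) \<le> (real N + 1) * (norm (\<Sum>i\<in>A. e i *\<^sub>R r' i))\<^sup>2"
  shows "(\<Sum>i\<in>A. (e i)\<^sup>2) \<le> 4 * (real N + 1) * (norm (\<Sum>i\<in>A. e i *\<^sub>R r i))\<^sup>2"
proof -
  define E where "E = (\<Sum>i\<in>A. (e i)\<^sup>2)"
  define x d where "x = (\<Sum>i\<in>A. e i *\<^sub>R r i)" and "d = (\<Sum>i\<in>A. e i *\<^sub>R (r i - r' i))"
  have E0: "0 \<le> E" by (simp add: E_def sum_nonneg)
  have "(\<Sum>i\<in>A. e i *\<^sub>R r' i) = x - d" by (simp add: x_def d_def scaleR_diff_right sum_subtractf)
  moreover have "(norm (x - d))\<^sup>2 \<le> 2 * (norm x)\<^sup>2 + 2 * (norm d)\<^sup>2"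
    using zero_le_power2[of "norm (x + d)"]
    by (simp add: power2_norm_eq_inner inner_add_left inner_add_right inner_diff_left inner_diff_right inner_commute)
  moreover have "(norm d)\<^sup>2 \<le> b\<^sup>2 * (real N * E)"
    unfolding d_def E_def by (rule norm_sum_scaleR_square_le[OF A near(1,2)])
  ultimately have "E \<le> (real N + 1) * (norm (x - d))\<^sup>2"
    and le: "(norm (x - d))\<^sup>2 \<le> 2 * (norm x)\<^sup>2 + 2 * (b\<^sup>2 * (real N * E))"
    using low unfolding E_def by (simp, linarith)
  note this(1)
  also have "(real N + 1) * (norm (x - d))\<^sup>2 \<le> (real N + 1) * (2 * (norm x)\<^sup>2 + 2 * (b\<^sup>2 * (real N * E)))"
    by (rule mult_left_mono[OF le]) simp
  also have "\<dots> = 2 * ((real N + 1) * (norm x)\<^sup>2) + (4 * b\<^sup>2 * (real N * (real N + 1))) * (E / 2)"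
    by (simp add: algebra_simps)
  also have "\<dots> \<le> 2 * ((real N + 1) * (norm x)\<^sup>2) + 1 * (E / 2)"
    using near(3) E0 by (intro add_left_mono mult_right_mono) auto
  finally have "E \<le> 4 * ((real N + 1) * (norm x)\<^sup>2)" by linarith
  then show ?thesis unfolding E_def x_def by (simp only: mult.assoc)
qed

text \<open>
  With weights \<open>\<epsilon> ^ i\<close> the influence of \<open>U j\<close> on a later \<open>U i\<close> costs at least one factor \<open>\<epsilon>\<close>, which
  is chosen to absorb the coupling constant \<open>B\<close>.
\<close>

lemma cascade_decay:
  fixes U U' :: "nat \<Rightarrow> real"
  assumes pos: "0 < \<alpha>" "0 \<le> B" and U: "\<And>i. i \<le> N \<Longrightarrow> 0 \<le> U i"
    and U': "\<And>i. i \<le> N \<Longrightarrow> U' i \<le> - \<alpha> * U i + B * (\<Sum>j<i. U j)"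
    and \<epsilon>: "\<epsilon> = \<alpha> / (2 * (B + \<alpha>) * (real N + 1))"
  shows "(\<Sum>i\<le>N. \<epsilon> ^ i * U' i) \<le> - (\<alpha> / 2) * (\<Sum>i\<le>N. \<epsilon> ^ i * U i)"
proof -
  define W where "W = (\<Sum>i\<le>N. \<epsilon> ^ i * U i)"
  have \<epsilon>0: "0 < \<epsilon>" using pos unfolding \<epsilon> by (intro divide_pos_pos mult_pos_pos) auto
  have "\<alpha> \<le> 2 * (B + \<alpha>) * (real N + 1)"
  proof -
    have "\<alpha> * 1 \<le> (2 * (B + \<alpha>)) * (real N + 1)" using pos by (intro mult_mono) auto
    then show ?thesis by simp
  qed
  then have \<epsilon>1: "\<epsilon> \<le> 1" using pos by (simp add: \<epsilon>)
  have "B * (\<alpha> / (2 * D * M) * M) = \<alpha> * (B / (2 * D))" if "D \<noteq> 0" "M \<noteq> 0" for D M :: real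
    using that by (simp add: field_simps)
  from this[of "B + \<alpha>" "real N + 1"]
  have "B * (\<epsilon> * (real N + 1)) = \<alpha> * (B / (2 * (B + \<alpha>)))"
    using pos unfolding \<epsilon> by simp
  also have "\<dots> \<le> \<alpha> * (1 / 2)" using pos by (intro mult_left_mono) (simp_all add: field_simps)
  finally have B\<epsilon>: "B * (\<epsilon> * (real N + 1)) \<le> \<alpha> / 2" by simp
  have W0: "0 \<le> W" unfolding W_def using U \<epsilon>0 by (intro sum_nonneg) auto
  have step: "\<epsilon> ^ i * U' i \<le> - \<alpha> * (\<epsilon> ^ i * U i) + B * (\<epsilon> * W)" if i: "i \<le> N" for i
  proof -
    have "\<epsilon> ^ i * (\<Sum>j<i. U j) \<le> (\<Sum>j<i. \<epsilon> * (\<epsilon> ^ j * U j))"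
      unfolding sum_distrib_left
    proof (rule sum_mono)
      fix j assume "j \<in> {..<i}"
      then have "\<epsilon> ^ i \<le> \<epsilon> ^ Suc j" "0 \<le> U j"
        using power_decreasing[of "Suc j" i \<epsilon>] \<epsilon>0 \<epsilon>1 U[of j] i by simp_all
      from mult_right_mono[OF this] show "\<epsilon> ^ i * U j \<le> \<epsilon> * (\<epsilon> ^ j * U j)" by (simp add: mult.assoc)
    qed
    also have "\<dots> = \<epsilon> * (\<Sum>j<i. \<epsilon> ^ j * U j)" by (simp add: sum_distrib_left)
    also have "\<dots> \<le> \<epsilon> * W"
      unfolding W_def using i U \<epsilon>0 by (intro mult_left_mono sum_mono2) auto
    finally have le: "\<epsilon> ^ i * (\<Sum>j<i. U j) \<le> \<epsilon> * W" .
    have "\<epsilon> ^ i * U' i \<le> \<epsilon> ^ i * (- \<alpha> * U i + B * (\<Sum>j<i. U j))"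
      using U'[OF i] \<epsilon>0 by (intro mult_left_mono) auto
    also have "\<dots> = - \<alpha> * (\<epsilon> ^ i * U i) + B * (\<epsilon> ^ i * (\<Sum>j<i. U j))" by (simp add: algebra_simps)
    also have "\<dots> \<le> - \<alpha> * (\<epsilon> ^ i * U i) + B * (\<epsilon> * W)"
      using le pos by (intro add_left_mono mult_left_mono) auto
    finally show ?thesis .
  qed
  have "(\<Sum>i\<le>N. \<epsilon> ^ i * U' i) \<le> (\<Sum>i\<le>N. - \<alpha> * (\<epsilon> ^ i * U i) + B * (\<epsilon> * W))"
    by (intro sum_mono step) simp
  also have "\<dots> = - \<alpha> * W + (B * (\<epsilon> * (real N + 1))) * W"
  proof -
    have "(\<Sum>i\<le>N. - \<alpha> * (\<epsilon> ^ i * U i)) = - \<alpha> * W" by (simp only: W_def sum_distrib_left)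
    then show ?thesis unfolding sum.distrib by (simp add: algebra_simps)
  qed
  also have "\<dots> \<le> - \<alpha> * W + (\<alpha> / 2) * W"
    using B\<epsilon> W0 by (intro add_left_mono mult_right_mono) auto
  finally show ?thesis by (simp add: W_def)
qed

section \<open>Decay of the errors of the leaders\<close>

text \<open>
  The out-edges of a leader point from a basis vector to the origin and to other basis vectors and
  are linearly independent: the components of their combination along the basis vectors are the
  coefficients \<open>- e j\<close> and the sum of all coefficients.
\<close>

lemma leader_independence:
  fixes e :: "nat \<Rightarrow> real"
  assumes m: "1 \<le> m" and k: "k \<in> {m+1..m + CARD('d)}"
  shows "(\<Sum>j\<in>insert 1 {m+1..<k}. (e j)\<^sup>2) \<le> (real CARD('d) + 1) *
    (norm (\<Sum>j\<in>insert 1 {m+1..<k}. e j *\<^sub>R (target m k - target m j :: real ^ 'd::finite)))\<^sup>2"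
proof -
  define L where "L = {m+1..<k}"
  have L: "finite L" "1 \<notin> L" "card L + 1 \<le> CARD('d)" "\<And>j. j \<in> L \<Longrightarrow> j \<in> {m+1..m + CARD('d)} \<and> j \<noteq> k"
    using k m by (auto simp: L_def)
  define s where "s = e 1 + (\<Sum>j\<in>L. e j)"
  define g :: "real ^ 'd" where "g = s *\<^sub>R target m k - (\<Sum>j\<in>L. e j *\<^sub>R target m j)"
  have g: "(\<Sum>j\<in>insert 1 L. e j *\<^sub>R (target m k - target m j :: real ^ 'd)) = g"
    using L(1,2) m
    by (simp add: g_def s_def target_zero scaleR_diff_right sum_subtractf scaleR_add_left flip: scaleR_sum_left)
  have gk: "g \<bullet> target m k = s"
  proof -
    have "(\<Sum>j\<in>L. e j *\<^sub>R target m j) \<bullet> (target m k :: real ^ 'd) = 0"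
      unfolding inner_sum_left using L(4) k by (intro sum.neutral ballI) (simp add: target_inner)
    then show ?thesis using k by (simp add: g_def inner_diff_left target_inner)
  qed
  have gj: "g \<bullet> target m j = - e j" if j: "j \<in> L" for j
  proof -
    have "(\<Sum>i\<in>L. e i *\<^sub>R target m i) \<bullet> (target m j :: real ^ 'd) = (\<Sum>i\<in>L. if i = j then e i else 0)"
      unfolding inner_sum_left using L(4) j by (intro sum.cong refl) (simp add: target_inner)
    also have "\<dots> = e j" using L(1) j by simp
    finally show ?thesis using L(4)[OF j] k by (simp add: g_def inner_diff_left target_inner)
  qed
  have "g \<bullet> g = s * (g \<bullet> target m k) - (\<Sum>j\<in>L. e j * (g \<bullet> target m j))"
    by (subst (2) g_def) (simp add: inner_diff_right inner_sum_right)
  also have "\<dots> = s\<^sup>2 + (\<Sum>j\<in>L. (e j)\<^sup>2)"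
    using gj by (simp add: gk power2_eq_square sum_negf)
  finally have norm_g: "(norm g)\<^sup>2 = s\<^sup>2 + (\<Sum>j\<in>L. (e j)\<^sup>2)" by (simp add: power2_norm_eq_inner)
  have "(e 1)\<^sup>2 = (\<Sum>j\<in>insert 1 L. if j = 1 then s else - e j)\<^sup>2"
  proof -
    have "(\<Sum>j\<in>L. if j = 1 then s else - e j) = (\<Sum>j\<in>L. - e j)"
      using L(2) by (intro sum.cong refl) auto
    then show ?thesis using L(1,2) by (simp add: s_def sum_negf)
  qed
  also have "\<dots> \<le> real CARD('d) * (\<Sum>j\<in>insert 1 L. (if j = 1 then s else - e j)\<^sup>2)"
    using L(1-3) by (intro sum_square_le_card) auto
  also have "(\<Sum>j\<in>insert 1 L. (if j = 1 then s else - e j)\<^sup>2) = s\<^sup>2 + (\<Sum>j\<in>L. (e j)\<^sup>2)"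
  proof -
    have "(\<Sum>j\<in>L. (if j = 1 then s else - e j)\<^sup>2) = (\<Sum>j\<in>L. (e j)\<^sup>2)"
      using L(2) by (intro sum.cong refl) auto
    then show ?thesis using L(1,2) by simp
  qed
  finally have e1: "(e 1)\<^sup>2 \<le> real CARD('d) * (norm g)\<^sup>2" by (simp add: norm_g)
  have "(\<Sum>j\<in>insert 1 L. (e j)\<^sup>2) = (e 1)\<^sup>2 + (\<Sum>j\<in>L. (e j)\<^sup>2)" using L(1,2) by simp
  also have "\<dots> \<le> real CARD('d) * (norm g)\<^sup>2 + (norm g)\<^sup>2"
    using e1 unfolding norm_g using zero_le_power2[of s] by linarith
  finally show ?thesis using g by (simp add: L_def algebra_simps)
qed

abbreviation cyclic_field :: "nat \<Rightarrow> 'd::finite config \<Rightarrow> 'd config" where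
  "cyclic_field m \<equiv> out_field (out_set m (m + CARD('d))) (target m)"

definition leader_error :: "nat \<Rightarrow> 'd::finite config \<Rightarrow> nat \<Rightarrow> real" where
  "leader_error m p k = (\<Sum>j\<in>out_set m (m + CARD('d)) k. (length_error (target m) p k j)\<^sup>2)"

text \<open>
  Like \<open>spread_rate\<close> below, this is the derivative of the preceding error along the controller.
\<close>

definition leader_rate :: "nat \<Rightarrow> 'd::finite config \<Rightarrow> nat \<Rightarrow> real" where
  "leader_rate m p k = (\<Sum>j\<in>out_set m (m + CARD('d)) k. 4 * length_error (target m) p k j *
     ((p k - p j) \<bullet> (cyclic_field m p k -
        cyclic_field m p j)))"

definition spread :: "nat \<Rightarrow> 'd::finite config \<Rightarrow> real" where
  "spread m p = (\<Sum>h\<in>{2..m}. (norm (p h - p 1))\<^sup>2)"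

definition spread_rate :: "nat \<Rightarrow> 'd::finite config \<Rightarrow> real" where
  "spread_rate m p = (\<Sum>h\<in>{2..m}. 2 * ((p h - p 1) \<bullet>
     (cyclic_field m p h -
      cyclic_field m p 1)))"

definition near_target :: "nat \<Rightarrow> real \<Rightarrow> 'd::finite config \<Rightarrow> bool" where
  "near_target m \<rho> p \<longleftrightarrow> (\<forall>k\<in>{1..m + CARD('d)}. norm (p k - target m k) \<le> \<rho>)"

lemma near_target_diff:
  fixes p :: "'d::finite config"
  assumes "near_target m \<rho> p" "i \<in> {1..m + CARD('d)}" "j \<in> {1..m + CARD('d)}"
  shows "norm ((p i - p j) - (target m i - target m j)) \<le> 2 * \<rho>"
proof -
  have "(p i - p j) - (target m i - target m j) = (p i - target m i) - (p j - target m j)" by simp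
  then have "norm ((p i - p j) - (target m i - target m j)) \<le> norm (p i - target m i) + norm (p j - target m j)"
    by (simp only: norm_triangle_ineq4)
  moreover have "norm (p i - target m i) \<le> \<rho>" "norm (p j - target m j) \<le> \<rho>"
    using assms by (simp_all add: near_target_def)
  ultimately show ?thesis by linarith
qed

lemma near_target_norm_diff:
  fixes p :: "'d::finite config"
  assumes "near_target m \<rho> p" "\<rho> \<le> 1 / 64" "i \<in> {1..m + CARD('d)}" "j \<in> {1..m + CARD('d)}"
  shows "norm (p i - p j) \<le> 3"
proof -
  have "norm (p i - p j) \<le> norm ((p i - p j) - (target m i - target m j)) + norm (target m i - target m j :: real ^ 'd)"
    using norm_triangle_ineq[of "(p i - p j) - (target m i - target m j)" "target m i - target m j"] by simp
  moreover have "norm (target m i - target m j :: real ^ 'd) \<le> 1 + 1"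
    by (rule order_trans[OF norm_triangle_ineq4]) (intro add_mono norm_target_le assms)
  ultimately show ?thesis using near_target_diff[OF assms(1,3,4)] assms(2) by linarith
qed

lemma out_field_root: "out_field (out_set m n) ps p 1 = 0"
  by (simp only: out_field_def out_set_root sum.empty minus_zero)

lemma card_out_set_leader:
  assumes "1 \<le> m" "k \<in> {m+1..m + CARD('d::finite)}"
  shows "card (out_set m (m + CARD('d)) k) \<le> CARD('d)" "finite (out_set m (m + CARD('d)) k)"
  unfolding out_set_leader[OF assms] using assms by (auto simp: card_insert_if)

lemma out_field_leader_le:
  fixes p :: "'d::finite config"
  assumes m: "1 \<le> m" and near: "near_target m \<rho> p" "\<rho> \<le> 1 / 64" and k: "k \<in> {m+1..m + CARD('d)}"
  shows "(norm (cyclic_field m p k))\<^sup>2 \<le> 9 * (real CARD('d) * leader_error m p k)"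
proof -
  have "norm (p k - p j) \<le> 3" if "j \<in> out_set m (m + CARD('d)) k" for j
    using k subsetD[OF out_set_subset that] by (intro near_target_norm_diff[OF near]) auto
  from norm_sum_scaleR_square_le[OF card_out_set_leader(2,1)[OF m k] this, where e = "length_error (target m) p k"]
  show ?thesis by (simp add: out_field_def leader_error_def)
qed

lemma young_12: "12 * a * b \<le> a\<^sup>2 / (2 * M) + 72 * M * b\<^sup>2" if "0 < M" for a b M :: real
proof -
  have "0 \<le> (a - 12 * M * b)\<^sup>2 / (2 * M)" using that by simp
  also have "\<dots> = a\<^sup>2 / (2 * M) + 72 * M * b\<^sup>2 - 12 * a * b"
    using that by (simp add: power2_eq_square field_simps)
  finally show ?thesis by simp
qed

text \<open>
  With \<open>x\<close> the combination of the out-edges of \<open>k\<close> with their errors, the velocity of \<open>k\<close> is \<open>- x\<close>, and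
  its own contribution to the rate is \<open>- 4 |x|\<^sup>2\<close>, which dominates the error by independence of the
  out-edges. The velocities of the leaders that \<open>k\<close> follows are bounded by their errors; the mixed
  terms are split by \<open>young_12\<close>.
\<close>

lemma leader_rate_le:
  fixes p :: "'d::finite config"
  defines "N \<equiv> real CARD('d)"
  assumes m: "1 \<le> m" and near: "near_target m \<rho> p" "0 \<le> \<rho>" "\<rho> * (N + 1) \<le> 1 / 64" "\<rho> \<le> 1 / 64"
    and k: "k \<in> {m+1..m + CARD('d)}"
  shows "leader_rate m p k \<le> - (1 / (2 * (N + 1))) * leader_error m p k +
    648 * (N * (N + 1)) * (\<Sum>j\<in>{m+1..<k}. leader_error m p j)"
proof -
  let ?n = "m + CARD('d)"
  let ?S = "out_set m ?n k" and ?f = "out_field (out_set m ?n) (target m) p"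
  define e where "e j = length_error (target m) p k j" for j
  define r where "r j = p k - p j" for j
  define x where "x = (\<Sum>j\<in>?S. e j *\<^sub>R r j)"
  define E where "E = (\<Sum>j\<in>?S. (e j)\<^sup>2)"
  have E: "leader_error m p k = E" by (simp add: E_def e_def leader_error_def)
  have N0: "0 \<le> N" by (simp add: N_def)
  have fk: "?f k = - x" by (simp add: out_field_def x_def e_def r_def)
  have kn: "k \<in> {1..?n}" using k by auto
  have S: "finite ?S" "card ?S \<le> CARD('d)" using card_out_set_leader[OF m k] by auto
  have Sn: "j \<in> {1..?n}" if "j \<in> ?S" for j using subsetD[OF out_set_subset that] .
  have "E \<le> 4 * (real CARD('d) + 1) * (norm x)\<^sup>2"
    unfolding E_def x_def
  proof (rule perturbed_lower_bound[OF S, where r' = "\<lambda>j. target m k - target m j"])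
    show "norm (r j - (target m k - target m j)) \<le> 2 * \<rho>" if "j \<in> ?S" for j
      unfolding r_def by (rule near_target_diff[OF near(1) kn Sn[OF that]])
    show "0 \<le> 2 * \<rho>" using near(2) by simp
    have "(\<rho> * (N + 1))\<^sup>2 \<le> (1 / 64)\<^sup>2" using near N0 by (intro power_mono) auto
    moreover have "\<rho>\<^sup>2 * (N * (N + 1)) \<le> \<rho>\<^sup>2 * ((N + 1) * (N + 1))" using N0 by (intro mult_left_mono mult_right_mono) auto
    ultimately have "\<rho>\<^sup>2 * (N * (N + 1)) \<le> 1 / 4096" by (simp add: power2_eq_square algebra_simps)
    moreover have "4 * (2 * \<rho>)\<^sup>2 * (N * (N + 1)) = 16 * (\<rho>\<^sup>2 * (N * (N + 1)))" by (simp add: power2_eq_square)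
    ultimately show "4 * (2 * \<rho>)\<^sup>2 * (real CARD('d) * (real CARD('d) + 1)) \<le> 1" by (simp add: N_def)
    show "(\<Sum>j\<in>?S. (e j)\<^sup>2) \<le> (real CARD('d) + 1) * (norm (\<Sum>j\<in>?S. e j *\<^sub>R (target m k - target m j :: real ^ 'd)))\<^sup>2"
      unfolding out_set_leader[OF m k] by (rule leader_independence[OF m k])
  qed
  then have low: "E / (N + 1) \<le> 4 * (norm x)\<^sup>2" using N0 by (simp add: N_def field_simps)
  have young: "- (4 * e j * (r j \<bullet> ?f j)) \<le> (e j)\<^sup>2 / (2 * (N + 1)) + 72 * (N + 1) * (norm (?f j))\<^sup>2"
    if "j \<in> ?S" for j
  proof -
    have "\<bar>r j \<bullet> ?f j\<bar> \<le> norm (r j) * norm (?f j)" by (rule Cauchy_Schwarz_ineq2)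
    also have "\<dots> \<le> 3 * norm (?f j)"
      unfolding r_def by (intro mult_right_mono near_target_norm_diff[OF near(1,4) kn Sn[OF that]]) simp
    finally have "\<bar>e j\<bar> * \<bar>r j \<bullet> ?f j\<bar> \<le> \<bar>e j\<bar> * (3 * norm (?f j))" by (rule mult_left_mono) simp
    then have "\<bar>e j * (r j \<bullet> ?f j)\<bar> \<le> 3 * (\<bar>e j\<bar> * norm (?f j))" by (simp add: abs_mult)
    then have "- (4 * e j * (r j \<bullet> ?f j)) \<le> 12 * \<bar>e j\<bar> * norm (?f j)" by linarith
    also have "\<dots> \<le> \<bar>e j\<bar>\<^sup>2 / (2 * (N + 1)) + 72 * (N + 1) * (norm (?f j))\<^sup>2"
      using N0 by (intro young_12) simp
    finally show ?thesis by simp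
  qed
  have "leader_rate m p k = (\<Sum>j\<in>?S. 4 * ((e j *\<^sub>R r j) \<bullet> (- x)) + - (4 * e j * (r j \<bullet> ?f j)))"
    unfolding leader_rate_def fk
    by (intro sum.cong refl) (simp add: e_def r_def inner_diff_right algebra_simps)
  also have "\<dots> = - 4 * (norm x)\<^sup>2 + (\<Sum>j\<in>?S. - (4 * e j * (r j \<bullet> ?f j)))"
  proof -
    have "(\<Sum>j\<in>?S. 4 * ((e j *\<^sub>R r j) \<bullet> (- x))) = 4 * (x \<bullet> (- x))"
      unfolding sum_distrib_left[symmetric] inner_sum_left[symmetric] x_def[symmetric] ..
    then show ?thesis unfolding sum.distrib by (simp add: power2_norm_eq_inner)
  qed
  also have "\<dots> \<le> - 4 * (norm x)\<^sup>2 + (\<Sum>j\<in>?S. (e j)\<^sup>2 / (2 * (N + 1)) + 72 * (N + 1) * (norm (?f j))\<^sup>2)"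
    by (intro add_left_mono sum_mono young)
  also have "\<dots> = - 4 * (norm x)\<^sup>2 + (E / (2 * (N + 1)) + 72 * (N + 1) * (\<Sum>j\<in>?S. (norm (?f j))\<^sup>2))"
    by (simp add: sum.distrib E_def sum_divide_distrib sum_distrib_left)
  also have "\<dots> \<le> - (E / (N + 1)) + (E / (2 * (N + 1)) + 72 * (N + 1) * (9 * N * (\<Sum>j\<in>{m+1..<k}. leader_error m p j)))"
  proof (intro add_mono mult_left_mono)
    show "- 4 * (norm x)\<^sup>2 \<le> - (E / (N + 1))" using low by simp
    have "(\<Sum>j\<in>?S. (norm (?f j))\<^sup>2) = (\<Sum>j\<in>{m+1..<k}. (norm (?f j))\<^sup>2)"
    proof -
      have "1 \<notin> {m+1..<k}" using m by simp
      then have "(\<Sum>j\<in>?S. (norm (?f j))\<^sup>2) = (norm (?f 1))\<^sup>2 + (\<Sum>j\<in>{m+1..<k}. (norm (?f j))\<^sup>2)"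
        unfolding out_set_leader[OF m k] by (intro sum.insert) simp_all
      then show ?thesis unfolding out_field_root by simp
    qed
    also have "\<dots> \<le> (\<Sum>j\<in>{m+1..<k}. 9 * (N * leader_error m p j))"
      unfolding N_def using k by (intro sum_mono out_field_leader_le[OF m near(1,4)]) auto
    finally show "(\<Sum>j\<in>?S. (norm (?f j))\<^sup>2) \<le> 9 * N * (\<Sum>j\<in>{m+1..<k}. leader_error m p j)"
      by (simp add: sum_distrib_left mult.assoc)
  qed (use N0 in auto)
  also have "\<dots> = - (1 / (2 * (N + 1))) * E + 648 * (N * (N + 1)) * (\<Sum>j\<in>{m+1..<k}. leader_error m p j)"
  proof -
    have "- (E / M) + (E / (2 * M) + 72 * M * (9 * N * s)) = - (1 / (2 * M)) * E + 648 * (N * M) * s"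
      if "M \<noteq> 0" for M s
      using that by (simp add: field_simps)
    moreover have "N + 1 \<noteq> 0" using N0 by simp
    ultimately show ?thesis by blast
  qed
  finally show ?thesis by (simp only: E)
qed

section \<open>Decay of the spread of the followers\<close>

text \<open>
  The force of one basis vertex on a follower: \<open>w\<close> is the displacement of the follower, \<open>v\<close> the basis
  vertex and \<open>b\<close> its target. To leading order the force opposes \<open>w\<close> by twice the square of the
  projection of \<open>w\<close> onto \<open>b\<close>; over an orthonormal basis these squares add up to \<open>|w|\<^sup>2\<close>.
\<close>

lemma anchor_estimate:
  fixes w v b :: "'a::real_inner"
  assumes b: "norm b = 1" and v: "norm (v - b) \<le> 2 * \<rho>" and w: "norm w \<le> 2 * \<rho>"
    and \<rho>: "0 \<le> \<rho>" "\<rho> \<le> 1 / 64" and \<theta>: "0 < \<theta>"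
  shows "2 * (w \<bullet> b)\<^sup>2 - (16 * \<rho> + \<theta>) * (norm w)\<^sup>2 - ((norm v)\<^sup>2 - 1)\<^sup>2 / \<theta>
    \<le> ((norm (w - v))\<^sup>2 - 1) * ((w - v) \<bullet> w)"
proof -
  define y c a z E where "y = norm w" and "c = w \<bullet> v" and "a = w \<bullet> b" and "z = w \<bullet> (v - b)"
    and "E = (norm v)\<^sup>2 - 1"
  have y0: "0 \<le> y" "y \<le> 2 * \<rho>" using w by (auto simp: y_def)
  have y2: "w \<bullet> w = y\<^sup>2" by (simp add: y_def power2_norm_eq_inner)
  have "norm v \<le> norm (v - b) + norm b" using norm_triangle_ineq[of "v - b" b] by simp
  then have "norm v \<le> 5 / 4" using b v \<rho> by linarith
  then have c: "\<bar>c\<bar> \<le> 5 / 4 * y"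
    using Cauchy_Schwarz_ineq2[of w v] mult_left_mono[of "norm v" "5/4" y] y0 by (simp add: c_def y_def)
  have a: "\<bar>a\<bar> \<le> y" using Cauchy_Schwarz_ineq2[of w b] b by (simp add: a_def y_def)
  have z: "\<bar>z\<bar> \<le> 2 * \<rho> * y"
    using Cauchy_Schwarz_ineq2[of w "v - b"] mult_left_mono[OF v, of y] y0 by (simp add: z_def y_def mult.commute)
  have az: "\<bar>a * z\<bar> \<le> 2 * \<rho> * y\<^sup>2"
    using mult_mono[OF a z] y0 \<rho> by (simp add: abs_mult power2_eq_square mult_ac)
  have caz: "c = a + z" by (simp add: c_def a_def z_def inner_diff_right)
  have "c\<^sup>2 = a\<^sup>2 + 2 * (a * z) + z\<^sup>2" by (simp add: caz power2_eq_square algebra_simps)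
  then have c2: "2 * c\<^sup>2 \<ge> 2 * a\<^sup>2 - 8 * \<rho> * y\<^sup>2" using az zero_le_power2[of z] by linarith
  have "3 * c * y\<^sup>2 \<le> 8 * \<rho> * y\<^sup>2"
  proof (rule mult_right_mono)
    show "3 * c \<le> 8 * \<rho>" using c y0 \<rho> by linarith
  qed simp
  moreover have "- (\<theta> * y\<^sup>2 + E\<^sup>2 / \<theta>) \<le> E * (y\<^sup>2 - c)"
  proof -
    have "y\<^sup>2 \<le> 1 / 4 * y" unfolding power2_eq_square using y0 \<rho> by (intro mult_right_mono) linarith+
    then have "\<bar>y\<^sup>2 - c\<bar> \<le> 2 * y" using c zero_le_power2[of y] by linarith
    then have "\<bar>E\<bar> * \<bar>y\<^sup>2 - c\<bar> \<le> \<bar>E\<bar> * (2 * y)" by (rule mult_left_mono) simp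
    moreover have "2 * \<bar>E\<bar> * y \<le> \<theta> * y\<^sup>2 + E\<^sup>2 / \<theta>"
    proof -
      have "0 \<le> (\<theta> * y - \<bar>E\<bar>)\<^sup>2 / \<theta>" using \<theta> by simp
      also have "\<dots> = \<theta> * y\<^sup>2 + \<bar>E\<bar>\<^sup>2 / \<theta> - 2 * \<bar>E\<bar> * y"
        using \<theta> by (simp add: power2_diff power_mult_distrib field_simps) (simp add: power2_eq_square)
      finally show ?thesis by simp
    qed
    moreover have "\<bar>E * (y\<^sup>2 - c)\<bar> = \<bar>E\<bar> * \<bar>y\<^sup>2 - c\<bar>" by (rule abs_mult)
    ultimately show ?thesis by linarith
  qed
  moreover have "((norm (w - v))\<^sup>2 - 1) * ((w - v) \<bullet> w) = 2 * c\<^sup>2 - 3 * c * y\<^sup>2 + (y\<^sup>2)\<^sup>2 + E * (y\<^sup>2 - c)"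
  proof -
    have eqs: "(norm (w - v))\<^sup>2 - 1 = y\<^sup>2 - 2 * c + E"
      unfolding power2_norm_eq_inner E_def c_def y2[symmetric]
      by (simp add: inner_diff_left inner_diff_right inner_commute)
    have eqs': "(w - v) \<bullet> w = y\<^sup>2 - c" 
      unfolding inner_diff_left y2 c_def inner_commute[of v w] by (rule refl)
    show ?thesis unfolding eqs eqs' by (simp add: power2_eq_square algebra_simps)
  qed
  moreover have "0 \<le> (y\<^sup>2)\<^sup>2" by simp
  moreover have "(16 * \<rho> + \<theta>) * y\<^sup>2 = 8 * \<rho> * y\<^sup>2 + 8 * \<rho> * y\<^sup>2 + \<theta> * y\<^sup>2" by (simp add: algebra_simps)
  ultimately show ?thesis using c2 unfolding y_def a_def E_def by linarith
qed

text \<open>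
  The force between two followers is cubic in their displacements.
\<close>

lemma mutual_estimate:
  fixes w u :: "'a::real_inner"
  assumes "norm w \<le> 2 * \<rho>" "norm u \<le> 2 * \<rho>" "0 \<le> \<rho>"
  shows "- ((norm (w - u))\<^sup>2 * ((w - u) \<bullet> w)) \<le> 32 * \<rho>\<^sup>2 * ((norm w)\<^sup>2 + (norm u)\<^sup>2)"
proof -
  define x y where "x = norm w" and "y = norm u"
  have xy: "0 \<le> x" "0 \<le> y" by (simp_all add: x_def y_def)
  have wu: "norm (w - u) \<le> x + y" unfolding x_def y_def by (rule norm_triangle_ineq4)
  have "norm (w - u) \<le> 4 * \<rho>" using wu assms by (simp add: x_def y_def)
  then have sq: "(norm (w - u))\<^sup>2 \<le> 16 * \<rho>\<^sup>2"
    using power_mono[of "norm (w - u)" "4 * \<rho>" 2] by (simp add: power_mult_distrib)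
  have "\<bar>(w - u) \<bullet> w\<bar> \<le> norm (w - u) * norm w" by (rule Cauchy_Schwarz_ineq2)
  also have "\<dots> \<le> (x + y) * x" using wu by (simp add: x_def mult_right_mono)
  also have "(x + y) * x \<le> 2 * (x\<^sup>2 + y\<^sup>2)"
  proof -
    have "x\<^sup>2 + x * y \<le> 2 * (x\<^sup>2 + y\<^sup>2)"
    proof -
      have "2 * (x * y) \<le> x\<^sup>2 + y\<^sup>2" using sum_squares_bound[of x y] by (simp only: mult.assoc)
      moreover have "X + P \<le> 2 * (X + Y)" if "2 * P \<le> X + Y" "0 \<le> X" "0 \<le> Y" for X Y P :: real
        using that by simp
      ultimately show ?thesis by (simp only: zero_le_power2)
    qed
    then show ?thesis by (simp add: power2_eq_square algebra_simps)
  qed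
  finally have "\<bar>(w - u) \<bullet> w\<bar> \<le> 2 * (x\<^sup>2 + y\<^sup>2)" .
  then have "(norm (w - u))\<^sup>2 * \<bar>(w - u) \<bullet> w\<bar> \<le> 16 * \<rho>\<^sup>2 * (2 * (x\<^sup>2 + y\<^sup>2))"
    using sq by (intro mult_mono) auto
  moreover have "\<bar>(norm (w - u))\<^sup>2 * ((w - u) \<bullet> w)\<bar> = (norm (w - u))\<^sup>2 * \<bar>(w - u) \<bullet> w\<bar>" by (simp add: abs_mult)
  ultimately show ?thesis unfolding x_def y_def by (simp, linarith)
qed

lemma out_field_follower:
  fixes p :: "'d::finite config"
  assumes m: "1 \<le> m" and h: "h \<in> {2..m}"
  shows "cyclic_field m p h =
    - ((norm (p h - p 1))\<^sup>2 *\<^sub>R (p h - p 1) +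
       (\<Sum>k\<in>{m+1..m + CARD('d)}. ((norm (p h - p k))\<^sup>2 - 1) *\<^sub>R (p h - p k)) +
       (\<Sum>j\<in>follower_set m h. (norm (p h - p j))\<^sup>2 *\<^sub>R (p h - p j)))"
proof -
  let ?B = "{m+1..m + CARD('d)}"
  define g where "g j = length_error (target m) p h j *\<^sub>R (p h - p j)" for j
  have th: "target m h = (0 :: real ^ 'd)" "target m 1 = (0 :: real ^ 'd)" using h m by (auto intro: target_zero)
  have tB: "norm (target m k :: real ^ 'd) = 1" if "k \<in> ?B" for k
    using target_inner[OF that that] by (simp add: norm_eq_sqrt_inner)
  have tT: "target m j = (0 :: real ^ 'd)" if "j \<in> follower_set m h" for j
    using that by (intro target_zero) (auto simp: follower_set_def)
  have fin: "finite (follower_set m h)" by (simp add: follower_set_def)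
  have disj: "1 \<notin> ?B \<union> follower_set m h" "?B \<inter> follower_set m h = {}"
    using m by (auto simp: follower_set_def)
  have "(\<Sum>j\<in>out_set m (m + CARD('d)) h. g j) = g 1 + ((\<Sum>k\<in>?B. g k) + (\<Sum>j\<in>follower_set m h. g j))"
  proof -
    have "(\<Sum>j\<in>insert 1 (?B \<union> follower_set m h). g j) = g 1 + (\<Sum>j\<in>?B \<union> follower_set m h. g j)"
      using fin disj(1) by (intro sum.insert) simp_all
    also have "(\<Sum>j\<in>?B \<union> follower_set m h. g j) = (\<Sum>k\<in>?B. g k) + (\<Sum>j\<in>follower_set m h. g j)"
      using fin disj(2) by (intro sum.union_disjoint) simp_all
    finally show ?thesis unfolding out_set_follower[OF le_add1 h] .
  qed
  moreover have "g 1 = (norm (p h - p 1))\<^sup>2 *\<^sub>R (p h - p 1)"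
    unfolding g_def length_error_def th by simp
  moreover have "(\<Sum>k\<in>?B. g k) = (\<Sum>k\<in>?B. ((norm (p h - p k))\<^sup>2 - 1) *\<^sub>R (p h - p k))"
    by (intro sum.cong refl) (simp add: g_def length_error_def th tB)
  moreover have "(\<Sum>j\<in>follower_set m h. g j) = (\<Sum>j\<in>follower_set m h. (norm (p h - p j))\<^sup>2 *\<^sub>R (p h - p j))"
    by (intro sum.cong refl) (simp add: g_def length_error_def th tT)
  ultimately show ?thesis unfolding out_field_def g_def[symmetric] by (simp only: add.assoc)
qed

lemma square_root_error_le:
  fixes p :: "'d::finite config"
  assumes m: "1 \<le> m" and k: "k \<in> {m+1..m + CARD('d)}"
  shows "((norm (p k - p 1))\<^sup>2 - 1)\<^sup>2 \<le> leader_error m p k"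
proof -
  have "norm (target m k - target m 1 :: real ^ 'd) = 1"
    using target_inner[OF k k] m by (simp add: norm_eq_sqrt_inner target_zero)
  then have "((norm (p k - p 1))\<^sup>2 - 1)\<^sup>2 = (length_error (target m) p k 1)\<^sup>2"
    by (simp add: length_error_def)
  also have "\<dots> \<le> leader_error m p k"
    unfolding leader_error_def
    by (rule member_le_sum) (use card_out_set_leader[OF m k] in \<open>simp_all add: out_set_leader[OF m k]\<close>)
  finally show ?thesis .
qed

lemma follower_decay:
  fixes p :: "'d::finite config"
  defines "N \<equiv> real CARD('d)"
  assumes m: "1 \<le> m" and near: "near_target m \<rho> p" "0 \<le> \<rho>" "\<rho> * (N + 1) \<le> 1 / 64" "\<rho> \<le> 1 / 64"
    and h: "h \<in> {2..m}"
  shows "(p h - p 1) \<bullet> cyclic_field m p h \<le>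
    - (3 / 2) * (norm (p h - p 1))\<^sup>2 + 4 * N * (\<Sum>k\<in>{m+1..m + CARD('d)}. leader_error m p k) +
    32 * \<rho>\<^sup>2 * (real m * (norm (p h - p 1))\<^sup>2 + spread m p)"
proof -
  let ?B = "{m+1..m + CARD('d)}"
  define w where "w j = p j - p 1" for j
  have N1: "1 \<le> N" by (simp add: N_def Suc_leI)
  have n: "h \<in> {1..m + CARD('d)}" "1 \<in> {1..m + CARD('d)}" using h m by auto
  have wle: "norm (w j) \<le> 2 * \<rho>" if "j \<in> {2..m}" for j
  proof -
    have "target m j = (0 :: real ^ 'd)" "target m 1 = (0 :: real ^ 'd)" using that m by (auto intro: target_zero)
    then show ?thesis using near_target_diff[OF near(1), of j 1] that m by (simp add: w_def)
  qed
  have diff: "p h - p j = w h - w j" for j by (simp add: w_def)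
  have anchor: "2 * (w h \<bullet> target m k)\<^sup>2 - (16 * \<rho> + 1 / (4 * N)) * (norm (w h))\<^sup>2 - 4 * N * leader_error m p k
      \<le> ((norm (w h - w k))\<^sup>2 - 1) * ((w h - w k) \<bullet> w h)" if k: "k \<in> ?B" for k
  proof -
    have "norm (target m k :: real ^ 'd) = 1" using target_inner[OF k k] by (simp add: norm_eq_sqrt_inner)
    moreover have "norm (w k - target m k) \<le> 2 * \<rho>"
      using near_target_diff[OF near(1) _ n(2), of k] k m by (simp add: w_def target_zero)
    ultimately have "2 * (w h \<bullet> target m k)\<^sup>2 - (16 * \<rho> + 1 / (4 * N)) * (norm (w h))\<^sup>2 -
        ((norm (w k))\<^sup>2 - 1)\<^sup>2 / (1 / (4 * N)) \<le> ((norm (w h - w k))\<^sup>2 - 1) * ((w h - w k) \<bullet> w h)"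
      using N1 wle[OF h] near(2,4) by (intro anchor_estimate) simp_all
    moreover have "((norm (w k))\<^sup>2 - 1)\<^sup>2 / (1 / (4 * N)) \<le> 4 * N * leader_error m p k"
      using mult_left_mono[OF square_root_error_le[OF m k, of p], of "4 * N"] N1 by (simp add: w_def mult.commute)
    ultimately show ?thesis by linarith
  qed
  have sumB: "3 / 2 * (norm (w h))\<^sup>2 - 4 * N * (\<Sum>k\<in>?B. leader_error m p k)
      \<le> (\<Sum>k\<in>?B. ((norm (w h - w k))\<^sup>2 - 1) * ((w h - w k) \<bullet> w h))"
  proof -
    have "(\<Sum>k\<in>?B. 2 * (w h \<bullet> target m k)\<^sup>2 - (16 * \<rho> + 1 / (4 * N)) * (norm (w h))\<^sup>2 - 4 * N * leader_error m p k)
      = 2 * (norm (w h))\<^sup>2 - N * ((16 * \<rho> + 1 / (4 * N)) * (norm (w h))\<^sup>2) - 4 * N * (\<Sum>k\<in>?B. leader_error m p k)"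
      by (simp only: sum_subtractf sum_distrib_left[symmetric] target_parseval) (simp add: N_def)
    moreover have "N * ((16 * \<rho> + 1 / (4 * N)) * (norm (w h))\<^sup>2) \<le> 1 / 2 * (norm (w h))\<^sup>2"
    proof -
      have "N * (16 * \<rho> + 1 / (4 * N)) = 16 * (\<rho> * N) + 1 / 4" using N1 by (simp add: field_simps)
      also have "\<dots> \<le> 1 / 2" using near(2,3) by (simp add: algebra_simps)
      finally have "N * (16 * \<rho> + 1 / (4 * N)) \<le> 1 / 2" .
      from mult_right_mono[OF this zero_le_power2[of "norm (w h)"]] show ?thesis by (simp only: mult.assoc)
    qed
    moreover have "(\<Sum>k\<in>?B. 2 * (w h \<bullet> target m k)\<^sup>2 - (16 * \<rho> + 1 / (4 * N)) * (norm (w h))\<^sup>2 - 4 * N * leader_error m p k)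
        \<le> (\<Sum>k\<in>?B. ((norm (w h - w k))\<^sup>2 - 1) * ((w h - w k) \<bullet> w h))"
      by (rule sum_mono) (rule anchor)
    ultimately show ?thesis by linarith
  qed
  have sumT: "- (\<Sum>j\<in>follower_set m h. (norm (w h - w j))\<^sup>2 * ((w h - w j) \<bullet> w h))
      \<le> 32 * \<rho>\<^sup>2 * (real m * (norm (w h))\<^sup>2 + spread m p)"
  proof -
    have sub: "follower_set m h \<subseteq> {2..m}" by (auto simp: follower_set_def)
    have "- (\<Sum>j\<in>follower_set m h. (norm (w h - w j))\<^sup>2 * ((w h - w j) \<bullet> w h))
        \<le> (\<Sum>j\<in>follower_set m h. 32 * \<rho>\<^sup>2 * ((norm (w h))\<^sup>2 + (norm (w j))\<^sup>2))"
      unfolding sum_negf[symmetric]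
    proof (rule sum_mono)
      fix j assume "j \<in> follower_set m h"
      then have "j \<in> {2..m}" using sub by blast
      then show "- ((norm (w h - w j))\<^sup>2 * ((w h - w j) \<bullet> w h)) \<le> 32 * \<rho>\<^sup>2 * ((norm (w h))\<^sup>2 + (norm (w j))\<^sup>2)"
        by (intro mutual_estimate[OF wle[OF h] wle near(2)])
    qed
    also have "\<dots> \<le> (\<Sum>j\<in>{2..m}. 32 * \<rho>\<^sup>2 * ((norm (w h))\<^sup>2 + (norm (w j))\<^sup>2))"
      by (intro sum_mono2 sub) simp_all
    also have "\<dots> = 32 * \<rho>\<^sup>2 * (real (card {2..m}) * (norm (w h))\<^sup>2 + spread m p)"
      by (simp only: sum_distrib_left[symmetric] sum.distrib sum_constant spread_def w_def)
    also have "\<dots> \<le> 32 * \<rho>\<^sup>2 * (real m * (norm (w h))\<^sup>2 + spread m p)"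
      by (intro mult_left_mono add_right_mono mult_right_mono) simp_all
    finally show ?thesis .
  qed
  define F where "F = cyclic_field m p h"
  have F: "F = - ((norm (w h))\<^sup>2 *\<^sub>R w h + (\<Sum>k\<in>?B. ((norm (w h - w k))\<^sup>2 - 1) *\<^sub>R (w h - w k)) +
      (\<Sum>j\<in>follower_set m h. (norm (w h - w j))\<^sup>2 *\<^sub>R (w h - w j)))"
    unfolding F_def out_field_follower[OF m h] w_def[of h, symmetric] unfolding diff ..
  have "w h \<bullet> F = F \<bullet> w h" by (rule inner_commute)
  also have "\<dots> = - ((norm (w h))\<^sup>2 * (w h \<bullet> w h) + (\<Sum>k\<in>?B. ((norm (w h - w k))\<^sup>2 - 1) * ((w h - w k) \<bullet> w h)) +
      (\<Sum>j\<in>follower_set m h. (norm (w h - w j))\<^sup>2 * ((w h - w j) \<bullet> w h)))"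
    unfolding F inner_minus_left inner_add_left inner_sum_left inner_scaleR_left ..
  finally have "w h \<bullet> F = - ((norm (w h))\<^sup>2 * (w h \<bullet> w h) + (\<Sum>k\<in>?B. ((norm (w h - w k))\<^sup>2 - 1) * ((w h - w k) \<bullet> w h)) +
      (\<Sum>j\<in>follower_set m h. (norm (w h - w j))\<^sup>2 * ((w h - w j) \<bullet> w h)))" .
  moreover have "0 \<le> (norm (w h))\<^sup>2 * (w h \<bullet> w h)" by simp
  ultimately show ?thesis using sumB sumT unfolding w_def[of h, symmetric] F_def by linarith
qed

lemma spread_rate_le:
  fixes p :: "'d::finite config"
  defines "N \<equiv> real CARD('d)"
  assumes m: "1 \<le> m" and near: "near_target m \<rho> p" "0 \<le> \<rho>" "\<rho> * (N + 1) \<le> 1 / 64" "\<rho> \<le> 1 / 64"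
    and \<rho>m: "\<rho> * real m \<le> 1 / 64"
  shows "spread_rate m p \<le> - 2 * spread m p + 8 * (N * real m) * (\<Sum>k\<in>{m+1..m + CARD('d)}. leader_error m p k)"
proof -
  define Z where "Z = (\<Sum>k\<in>{m+1..m + CARD('d)}. leader_error m p k)"
  have Z0: "0 \<le> Z" unfolding Z_def leader_error_def by (intro sum_nonneg) simp
  have spread0: "0 \<le> spread m p" unfolding spread_def by (intro sum_nonneg) simp
  have N0: "0 \<le> N" by (simp add: N_def)
  have \<rho>2m: "\<rho>\<^sup>2 * real m \<le> 1 / 4096"
    using mult_mono[OF near(4) \<rho>m] near(2) by (simp add: power2_eq_square mult.assoc)
  have decay: "(p h - p 1) \<bullet> cyclic_field m p h \<le>
      - (3 / 2) * (norm (p h - p 1))\<^sup>2 + 4 * N * Z + 32 * \<rho>\<^sup>2 * (real m * (norm (p h - p 1))\<^sup>2 + spread m p)"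
    if "h \<in> {2..m}" for h
    unfolding N_def Z_def by (rule follower_decay[OF m near(1,2) near(3)[unfolded N_def] near(4) that])
  have "spread_rate m p = (\<Sum>h\<in>{2..m}. 2 * ((p h - p 1) \<bullet> cyclic_field m p h))"
    unfolding spread_rate_def out_field_root by simp
  also have "\<dots> \<le> (\<Sum>h\<in>{2..m}. 2 * (- (3 / 2) * (norm (p h - p 1))\<^sup>2 + 4 * N * Z +
      32 * \<rho>\<^sup>2 * (real m * (norm (p h - p 1))\<^sup>2 + spread m p)))"
    by (intro sum_mono mult_left_mono decay) simp_all
  also have "\<dots> = 2 * (- (3 / 2) * spread m p + 4 * N * (real (card {2..m}) * Z) +
      32 * \<rho>\<^sup>2 * (real m * spread m p + real (card {2..m}) * spread m p))"
    by (simp only: sum_distrib_left[symmetric] sum.distrib sum_constant spread_def[symmetric])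
  also have "\<dots> \<le> 2 * (- (3 / 2) * spread m p + 4 * N * (real m * Z) +
      32 * \<rho>\<^sup>2 * (real m * spread m p + real m * spread m p))"
    using Z0 N0 spread0
    by (intro mult_left_mono add_mono add_left_mono mult_right_mono) simp_all
  also have "\<dots> = - 3 * spread m p + 8 * (N * real m) * Z + 128 * (\<rho>\<^sup>2 * real m) * spread m p"
    by (simp add: algebra_simps)
  also have "\<dots> \<le> - 3 * spread m p + 8 * (N * real m) * Z + 1 * spread m p"
    using \<rho>2m spread0 by (intro add_left_mono mult_right_mono) auto
  finally show ?thesis by (simp add: Z_def)
qed

section \<open>The cyclic orientation is stable\<close>

lemma length_error_commute: "length_error ps p i j = length_error ps p j i"
  by (simp add: length_error_def norm_minus_commute)

lemma length_error_has_derivative: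
  fixes x :: "real \<Rightarrow> 'd::finite config"
  assumes "((\<lambda>s. x s i) has_vector_derivative u) (at t within T)"
    and "((\<lambda>s. x s j) has_vector_derivative v) (at t within T)"
  shows "((\<lambda>s. length_error ps (x s) i j) has_real_derivative 2 * ((x t i - x t j) \<bullet> (u - v))) (at t within T)"
proof -
  have d: "((\<lambda>s. x s i - x s j) has_vector_derivative u - v) (at t within T)"
    by (rule has_vector_derivative_diff[OF assms])
  have "((\<lambda>s. (x s i - x s j) \<bullet> (x s i - x s j)) has_real_derivative
      (x t i - x t j) \<bullet> (u - v) + (u - v) \<bullet> (x t i - x t j)) (at t within T)"
    unfolding has_real_derivative_iff_has_vector_derivative
    by (rule bounded_bilinear.has_vector_derivative[OF bounded_bilinear_inner d d])
  then have "((\<lambda>s. (x s i - x s j) \<bullet> (x s i - x s j)) has_real_derivative 2 * ((x t i - x t j) \<bullet> (u - v))) (at t within T)"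
    by (simp add: inner_commute)
  from DERIV_diff[OF this DERIV_const[of "(norm (ps i - ps j))\<^sup>2"]]
  show ?thesis by (simp add: length_error_def power2_norm_eq_inner)
qed

lemma leader_error_has_derivative:
  fixes x :: "real \<Rightarrow> 'd::finite config"
  assumes "\<And>k. k \<in> {1..m + CARD('d)} \<Longrightarrow>
      ((\<lambda>s. x s k) has_vector_derivative cyclic_field m (x t) k) (at t within T)"
    and k: "k \<in> {1..m + CARD('d)}"
  shows "((\<lambda>s. leader_error m (x s) k) has_real_derivative leader_rate m (x t) k) (at t within T)"
  unfolding leader_error_def leader_rate_def
proof (rule DERIV_sum)
  fix j assume "j \<in> out_set m (m + CARD('d)) k"
  then have j: "j \<in> {1..m + CARD('d)}" by (rule subsetD[OF out_set_subset])
  let ?f = "cyclic_field m (x t)"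
  have "((\<lambda>s. (length_error (target m) (x s) k j)\<^sup>2) has_real_derivative
      2 * (2 * ((x t k - x t j) \<bullet> (?f k - ?f j)) * length_error (target m) (x t) k j)) (at t within T)"
    using DERIV_power[OF length_error_has_derivative[OF assms(1)[OF k] assms(1)[OF j]], of "target m" 2] by simp
  then show "((\<lambda>s. (length_error (target m) (x s) k j)\<^sup>2) has_real_derivative
      4 * length_error (target m) (x t) k j * ((x t k - x t j) \<bullet> (?f k - ?f j))) (at t within T)"
    by (simp add: mult_ac)
qed

lemma spread_has_derivative:
  fixes x :: "real \<Rightarrow> 'd::finite config"
  assumes "\<And>k. k \<in> {1..m + CARD('d)} \<Longrightarrow>
      ((\<lambda>s. x s k) has_vector_derivative cyclic_field m (x t) k) (at t within T)"
    and m: "1 \<le> m"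
  shows "((\<lambda>s. spread m (x s)) has_real_derivative spread_rate m (x t)) (at t within T)"
  unfolding spread_def spread_rate_def
proof (rule DERIV_sum)
  fix h assume "h \<in> {2..m}"
  then have h: "h \<in> {1..m + CARD('d)}" "1 \<in> {1..m + CARD('d)}" by auto
  from length_error_has_derivative[OF assms(1)[OF h(1)] assms(1)[OF h(2)], of "\<lambda>_. 0"]
  show "((\<lambda>s. (norm (x s h - x s 1))\<^sup>2) has_real_derivative 2 * ((x t h - x t 1) \<bullet>
      (cyclic_field m (x t) h -
       cyclic_field m (x t) 1))) (at t within T)"
    by (simp add: length_error_def)
qed

text \<open>
  The error of a leader controls the lengths of its out-edges, and the spread controls the positions
  of the followers relative to vertex 1, hence all their lengths.
\<close>

lemma length_error_le:
  fixes p :: "'d::finite config"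
  assumes m: "1 \<le> m" and near: "near_target m \<rho> p" "\<rho> \<le> 1 / 64"
    and Y: "\<And>k. k \<in> {m+1..m + CARD('d)} \<Longrightarrow> leader_error m p k \<le> Y" "spread m p \<le> Y"
    and ij: "i \<in> {1..m + CARD('d)}" "j \<in> {1..m + CARD('d)}"
  shows "\<bar>length_error (target m) p i j\<bar> \<le> 8 * sqrt Y"
proof -
  let ?B = "{m+1..m + CARD('d)}"
  have one: "1 \<in> {1..m + CARD('d)}" "1 \<in> {1..m}" using m by auto
  have Y0: "0 \<le> Y"
    using Y(2) sum_nonneg[of "{2..m}" "\<lambda>h. (norm (p h - p 1))\<^sup>2"] unfolding spread_def by (meson order_trans zero_le_power2)
  have sY0: "0 \<le> sqrt Y" using Y0 by simp
  have w: "norm (p h - p 1) \<le> sqrt Y" "norm (p h - p 1) \<le> 1 / 32" if h: "h \<in> {1..m}" for h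
  proof -
    have "h \<in> {1..m + CARD('d)}" using h by simp
    from near_target_diff[OF near(1) this one(1)] show "norm (p h - p 1) \<le> 1 / 32"
      using near(2) unfolding target_zero[OF h] target_zero[OF one(2)] by simp
    show "norm (p h - p 1) \<le> sqrt Y"
    proof (cases "h = 1")
      case False
      then have "(norm (p h - p 1))\<^sup>2 \<le> spread m p"
        unfolding spread_def using h by (intro member_le_sum) auto
      then show ?thesis using Y(2) by (intro real_le_rsqrt) simp
    next
      case True
      then show ?thesis using sY0 by (simp only: diff_self norm_zero)
    qed
  qed
  have leaders: "\<bar>length_error (target m) p k l\<bar> \<le> sqrt Y"
    if "k \<in> ?B" "l = 1 \<or> l \<in> {m+1..<k}" for k l
  proof -
    have "(length_error (target m) p k l)\<^sup>2 \<le> leader_error m p k"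
      unfolding leader_error_def
      by (rule member_le_sum) (use card_out_set_leader[OF m that(1)] that in \<open>auto simp: out_set_leader[OF m that(1)]\<close>)
    then have "\<bar>length_error (target m) p k l\<bar>\<^sup>2 \<le> Y" using Y(1)[OF that(1)] by simp
    then show ?thesis by (rule real_le_rsqrt)
  qed
  have mixed: "\<bar>length_error (target m) p h k\<bar> \<le> 8 * sqrt Y" if h: "h \<in> {1..m}" and k: "k \<in> ?B" for h k
  proof -
    define u v where "u = p h - p 1" and "v = p k - p 1"
    have "norm (target m k - target m 1 :: real ^ 'd) = norm (target m h - target m k :: real ^ 'd)"
      unfolding target_zero[OF h] target_zero[OF one(2)] by simp
    moreover have "(norm (u - v))\<^sup>2 = (norm u)\<^sup>2 - 2 * (u \<bullet> v) + (norm v)\<^sup>2"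
      by (simp add: power2_norm_eq_inner inner_diff_left inner_diff_right inner_commute)
    moreover have "p h - p k = u - v" by (simp add: u_def v_def)
    ultimately have eq: "length_error (target m) p h k = (norm u)\<^sup>2 - 2 * (u \<bullet> v) + length_error (target m) p k 1"
      by (simp only: length_error_def v_def)
    have u: "norm u \<le> sqrt Y" "norm u \<le> 1 / 32" unfolding u_def by (rule w[OF h])+
    have "(norm u)\<^sup>2 \<le> norm u" unfolding power2_eq_square using u(2) by (intro mult_left_le_one_le) auto
    moreover have "\<bar>u \<bullet> v\<bar> \<le> norm u * 3"
    proof -
      have "k \<in> {1..m + CARD('d)}" using k by simp
      then have "norm v \<le> 3" unfolding v_def by (intro near_target_norm_diff[OF near _ one(1)])
      then show ?thesis using Cauchy_Schwarz_ineq2[of u v] mult_left_mono[of "norm v" 3 "norm u"] by simp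
    qed
    moreover have "\<bar>length_error (target m) p k 1\<bar> \<le> sqrt Y" using k by (intro leaders) auto
    ultimately show ?thesis using eq u(1) zero_le_power2[of "norm u"] by linarith
  qed
  have "i \<in> {1..m} \<or> i \<in> ?B" "j \<in> {1..m} \<or> j \<in> ?B" using ij by auto
  then consider "i \<in> {1..m}" "j \<in> {1..m}" | "i \<in> {1..m}" "j \<in> ?B" | "i \<in> ?B" "j \<in> {1..m}" | "i \<in> ?B" "j \<in> ?B"
    by blast
  then show ?thesis
  proof cases
    case 1
    have "norm (p i - p j) \<le> norm (p i - p 1) + norm (p j - p 1)"
      using norm_triangle_ineq4[of "p i - p 1" "p j - p 1"] by simp
    then have le: "norm (p i - p j) \<le> 2 * sqrt Y" "norm (p i - p j) \<le> 1"
      using w[OF 1(1)] w[OF 1(2)] by linarith+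
    have "\<bar>length_error (target m) p i j\<bar> = (norm (p i - p j))\<^sup>2"
      by (simp add: length_error_def target_zero[OF 1(1)] target_zero[OF 1(2)])
    also have "\<dots> \<le> norm (p i - p j)" unfolding power2_eq_square using le(2) by (intro mult_left_le_one_le) auto
    finally show ?thesis using le(1) sY0 by linarith
  next
    case 2
    then show ?thesis by (rule mixed)
  next
    case 3
    then show ?thesis using mixed[of j i] by (simp only: length_error_commute[of _ _ i j])
  next
    case 4
    show ?thesis
    proof (cases i j rule: linorder_cases)
      case less
      then have "\<bar>length_error (target m) p j i\<bar> \<le> sqrt Y" using 4 by (intro leaders) auto
      then show ?thesis using sY0 by (simp only: length_error_commute[of _ _ i j])
    next
      case equal
      then show ?thesis using sY0 by (simp add: length_error_def)
    next
      case greater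
      then have "\<bar>length_error (target m) p i j\<bar> \<le> sqrt Y" using 4 by (intro leaders) auto
      then show ?thesis using sY0 by linarith
    qed
  qed
qed

lemma length_error_small:
  fixes p :: "'d::finite config"
  assumes near: "near_target m \<delta> p" "\<delta> \<le> 1 / 64"
    and ij: "i \<in> {1..m + CARD('d)}" "j \<in> {1..m + CARD('d)}"
  shows "\<bar>length_error (target m) p i j\<bar> \<le> 10 * \<delta>"
proof -
  let ?r = "p i - p j" and ?r' = "target m i - target m j :: real ^ 'd"
  have "\<bar>length_error (target m) p i j\<bar> = (norm ?r + norm ?r') * \<bar>norm ?r - norm ?r'\<bar>"
    by (simp add: length_error_def power2_eq_square square_diff_square_factored abs_mult)
  also have "\<dots> \<le> 5 * (2 * \<delta>)"
  proof (intro mult_mono)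
    have "norm ?r' \<le> 1 + 1"
      by (rule order_trans[OF norm_triangle_ineq4]) (intro add_mono norm_target_le ij)
    then show "norm ?r + norm ?r' \<le> 5" using near_target_norm_diff[OF near ij] by linarith
    show "\<bar>norm ?r - norm ?r'\<bar> \<le> 2 * \<delta>"
      by (rule order_trans[OF norm_triangle_ineq3 near_target_diff[OF near(1) ij]])
  qed auto
  finally show ?thesis by simp
qed

lemma leader_error_small:
  fixes p :: "'d::finite config"
  assumes m: "1 \<le> m" and near: "near_target m \<delta> p" "\<delta> \<le> 1 / 64" and k: "k \<in> {m+1..m + CARD('d)}"
  shows "leader_error m p k \<le> 100 * (real CARD('d) + real m) * \<delta>\<^sup>2"
proof -
  have "leader_error m p k \<le> (\<Sum>j\<in>out_set m (m + CARD('d)) k. 100 * \<delta>\<^sup>2)"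
    unfolding leader_error_def
  proof (rule sum_mono)
    fix j assume "j \<in> out_set m (m + CARD('d)) k"
    then have "\<bar>length_error (target m) p k j\<bar> \<le> 10 * \<delta>"
      using k subsetD[OF out_set_subset] by (intro length_error_small[OF near]) auto
    then have "\<bar>length_error (target m) p k j\<bar>\<^sup>2 \<le> (10 * \<delta>)\<^sup>2" by (intro power_mono) auto
    then show "(length_error (target m) p k j)\<^sup>2 \<le> 100 * \<delta>\<^sup>2" by (simp add: power_mult_distrib)
  qed
  also have "\<dots> \<le> (real CARD('d) + real m) * (100 * \<delta>\<^sup>2)"
    using card_out_set_leader(1)[OF m k] unfolding sum_constant by (intro mult_right_mono) auto
  finally show ?thesis by (simp add: mult_ac)
qed

lemma spread_small:
  fixes p :: "'d::finite config"
  assumes m: "1 \<le> m" and near: "near_target m \<delta> p"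
  shows "spread m p \<le> 100 * (real CARD('d) + real m) * \<delta>\<^sup>2"
proof -
  have "spread m p \<le> (\<Sum>h\<in>{2..m}. 4 * \<delta>\<^sup>2)"
    unfolding spread_def
  proof (rule sum_mono)
    fix h assume h: "h \<in> {2..m}"
    then have "norm ((p h - p 1) - (target m h - target m 1)) \<le> 2 * \<delta>"
      using m by (intro near_target_diff[OF near]) auto
    moreover have "target m h = (0 :: real ^ 'd)" "target m 1 = (0 :: real ^ 'd)" using h by (auto intro: target_zero)
    ultimately have "(norm (p h - p 1))\<^sup>2 \<le> (2 * \<delta>)\<^sup>2" by (intro power_mono) simp_all
    then show "(norm (p h - p 1))\<^sup>2 \<le> 4 * \<delta>\<^sup>2" by (simp add: power_mult_distrib)
  qed
  also have "\<dots> = real (card {2..m}) * (4 * \<delta>\<^sup>2)" by (simp only: sum_constant)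
  also have "\<dots> \<le> (real CARD('d) + real m) * (100 * \<delta>\<^sup>2)" by (intro mult_mono) auto
  finally show ?thesis by (simp add: mult_ac)
qed

text \<open>
  The definition of stability asks for a limit inside the basin. Therefore all configurations congruent
  to the target, which are equilibria, are added to the neighbourhood \<open>W\<close> of the target.
\<close>

lemma stable_of_convergence:
  fixes ps :: "'d::finite config"
  assumes or: "orientation (complete_edges n) D" and c: "0 < c"
    and conv: "exponentially_attracting n (\<lambda>k. {j. (k, j) \<in> D}) ps c"
    and ps: "ps \<in> configs n"
  shows "locally_exponentially_stable n (complete_edges n) D ps"
proof -
  let ?E = "complete_edges n" and ?S = "\<lambda>k. {j. (k, j) \<in> D}"
  obtain \<delta> K where \<delta>: "0 < \<delta>" "0 < K" and conv: "\<forall>p0\<in>configs n. (\<forall>k\<in>{1..n}. norm (p0 k - ps k) < \<delta>) \<longrightarrow>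
    (\<exists>p. p 0 = p0 \<and> (\<forall>t\<ge>0. p t \<in> configs n \<and>
        (\<forall>k\<in>{1..n}. ((\<lambda>s. p s k) has_vector_derivative out_field ?S ps (p t) k) (at t within {0..}))) \<and>
      (\<exists>q\<in>configs n. congruent n ps q \<and> (\<forall>t\<ge>0. config_dist n (p t) q \<le> K * exp (- c * t))))"
    using conv unfolding exponentially_attracting_def by (elim exE conjE) (rule that)
  have field: "controller_field n ?E D (distance_map ?E ps) p k = out_field ?S ps p k" if "k \<in> {1..n}" for p k
    unfolding controller_field_out_edges[OF simple_complete or that] out_field_def length_error_def ..
  have solution: "controller_solution n ?E D (distance_map ?E ps) p \<longleftrightarrow> (\<forall>t\<ge>0. p t \<in> configs n \<and>
      (\<forall>k\<in>{1..n}. ((\<lambda>s. p s k) has_vector_derivative out_field ?S ps (p t) k) (at t within {0..})))" for p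
    unfolding controller_solution_def by (simp add: field)
  define W where "W = {p \<in> configs n. \<forall>k\<in>{1..n}. norm (p k - ps k) < \<delta>}"
  define Q where "Q = {q \<in> configs n. congruent n ps q}"
  have "openin (top_of_set (configs n)) W"
  proof -
    have "open (\<Inter>k\<in>{1..n}. {p :: 'd config. norm (p k - ps k) < \<delta>})"
      by (intro open_INT finite_atLeastAtMost ballI open_Collect_less continuous_intros
          continuous_on_product_coordinates)
    moreover have "W = configs n \<inter> (\<Inter>k\<in>{1..n}. {p. norm (p k - ps k) < \<delta>})" by (auto simp: W_def)
    ultimately show ?thesis unfolding openin_open by blast
  qed
  moreover have "ps \<in> W" using ps \<delta> by (simp add: W_def)
  moreover have "\<exists>p. controller_solution n ?E D (distance_map ?E ps) p \<and> p 0 = p0 \<and>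
      (\<exists>q\<in>W \<union> Q. congruent n ps q \<and> (\<forall>t\<ge>0. config_dist n (p t) q \<le> K * exp (- c * t)))" if "p0 \<in> W \<union> Q" for p0
  proof (cases "p0 \<in> W")
    case True
    then have "p0 \<in> configs n" "\<forall>k\<in>{1..n}. norm (p0 k - ps k) < \<delta>" by (simp_all add: W_def)
    from bspec[OF conv this(1), THEN mp, OF this(2)] obtain p q where "p 0 = p0" "\<forall>t\<ge>0. p t \<in> configs n \<and>
        (\<forall>k\<in>{1..n}. ((\<lambda>s. p s k) has_vector_derivative out_field ?S ps (p t) k) (at t within {0..}))"
      and "q \<in> configs n" "congruent n ps q" "\<forall>t\<ge>0. config_dist n (p t) q \<le> K * exp (- c * t)"
      by (elim exE conjE bexE) (rule that)
    then show ?thesis unfolding solution by (intro exI[of _ p] conjI bexI[of _ q]) (simp_all add: Q_def)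
  next
    case False
    then have q: "p0 \<in> configs n" "congruent n ps p0" "p0 \<in> Q" using that by (auto simp: Q_def)
    have "out_field ?S ps p0 k = 0" if k: "k \<in> {1..n}" for k
    proof -
      have "length_error ps p0 k j *\<^sub>R (p0 k - p0 j) = 0" if "j \<in> ?S k" for j
      proof -
        have "(k, j) \<in> complete_edges n \<union> (complete_edges n)\<inverse>" using that or unfolding orientation_def by auto
        then have "j \<in> {1..n}" by (auto simp: complete_edges_def)
        then have "dist (p0 k) (p0 j) = dist (ps k) (ps j)" using q(2) k by (simp only: congruent_iff_dist)
        then show ?thesis by (simp add: length_error_def dist_norm)
      qed
      then show ?thesis unfolding out_field_def by (simp add: sum.neutral)
    qed
    then have "controller_solution n ?E D (distance_map ?E ps) (\<lambda>t. p0)"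
      unfolding solution using q(1) by simp
    moreover have "config_dist n p0 p0 \<le> K * exp (- c * t)" for t
      using \<delta>(2) by (simp add: config_dist_def L2_set_def)
    ultimately show ?thesis using q(2,3) by (intro exI[of _ "\<lambda>t. p0"] conjI bexI[of _ p0]) simp_all
  qed
  moreover have "W \<union> Q \<subseteq> configs n" by (auto simp: W_def Q_def)
  ultimately show ?thesis
    unfolding locally_exponentially_stable_def using \<delta>(2) c
    by (intro exI[of _ "W \<union> Q"] conjI exI[of _ W] exI[of _ K] exI[of _ c] ballI Un_upper1)
qed

text \<open>
  The cascade consists of the \<open>d\<close> leaders beyond vertex 1 in their order, followed by the spread of
  all followers.
\<close>

lemma cyclic_stable:
  fixes label :: "'v::finite \<Rightarrow> nat" and m :: nat
  defines "n \<equiv> m + CARD('d::finite)"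
  assumes m: "1 \<le> m" and label: "bij_betw label UNIV {1..n}"
  shows "locally_exponentially_stable n (complete_edges n) (cyclic_arcs m n) (target m :: 'd config)"
proof -
  let ?N = "CARD('d)" and ?S = "out_set m n" and ?ps = "target m :: 'd config"
  \<comment> \<open>The decay rate, the coupling constant and the weight of the cascade, and the radius on which the estimates hold.\<close>
  define \<alpha> where "\<alpha> = 1 / (2 * (real ?N + 1))"
  define B where "B = 648 * (real ?N * (real ?N + 1)) + 8 * (real ?N * real m)"
  define \<epsilon> where "\<epsilon> = \<alpha> / (2 * (B + \<alpha>) * (real ?N + 1))"
  define \<rho> where "\<rho> = 1 / (64 * (real ?N + 1) * real m)"
  define U where "U p i = (if i < ?N then leader_error m p (m + 1 + i) else spread m p)" for p :: "'d config" and i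
  define U' where "U' p i = (if i < ?N then leader_rate m p (m + 1 + i) else spread_rate m p)" for p :: "'d config" and i
  define V where "V p = (\<Sum>i\<le>?N. \<epsilon> ^ i * U p i)" for p
  define V' where "V' p = (\<Sum>i\<le>?N. \<epsilon> ^ i * U' p i)" for p
  have \<alpha>0: "0 < \<alpha>" "\<alpha> \<le> 1" by (simp_all add: \<alpha>_def)
  have B0: "0 \<le> B" by (simp add: B_def)
  have \<epsilon>0: "0 < \<epsilon>" using \<alpha>0 B0 unfolding \<epsilon>_def by (intro divide_pos_pos mult_pos_pos) auto
  have \<epsilon>1: "\<epsilon> \<le> 1"
  proof -
    have "\<alpha> * 1 \<le> (2 * (B + \<alpha>)) * (real ?N + 1)" using \<alpha>0 B0 by (intro mult_mono) auto
    then show ?thesis using \<alpha>0 B0 by (simp add: \<epsilon>_def)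
  qed
  have m1: "1 \<le> real m" using m by simp
  have \<rho>: "0 < \<rho>" "\<rho> * (real ?N + 1) \<le> 1 / 64" "\<rho> \<le> 1 / 64" "\<rho> * real m \<le> 1 / 64"
  proof -
    have gen: "1 / (64 * x * y) * x \<le> 1 / 64" "1 / (64 * x * y) \<le> 1 / 64" "1 / (64 * x * y) * y \<le> 1 / 64"
      if "1 \<le> x" "1 \<le> y" for x y :: real
      using that mult_mono[of 1 x 1 y] by (simp_all add: field_simps)
    show "0 < \<rho>" using m1 by (simp add: \<rho>_def)
    show "\<rho> * (real ?N + 1) \<le> 1 / 64" "\<rho> \<le> 1 / 64" "\<rho> * real m \<le> 1 / 64"
      unfolding \<rho>_def by (rule gen; use m1 in simp)+
  qed
  have U0: "0 \<le> U p i" for p i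
    by (simp add: U_def leader_error_def spread_def sum_nonneg)
  have shift: "(\<Sum>k\<in>{m+1..<m+1+i}. leader_error m p k) = (\<Sum>j<i. U p j)" if "i \<le> ?N" for p :: "'d config" and i
  proof -
    have "(\<Sum>k\<in>{m+1..<m+1+i}. leader_error m p k) = (\<Sum>j\<in>{0..<i}. leader_error m p (j + (m + 1)))"
      using sum.shift_bounds_nat_ivl[of "leader_error m p" 0 "m + 1" i] by (simp add: add.commute)
    also have "\<dots> = (\<Sum>j<i. U p j)"
      unfolding atLeast0LessThan using that by (intro sum.cong refl) (simp add: U_def add.commute)
    finally show ?thesis .
  qed
  have cascade: "U' p i \<le> - \<alpha> * U p i + B * (\<Sum>j<i. U p j)" if near: "near_target m \<rho> p" and i: "i \<le> ?N" for p i
  proof (cases "i < ?N")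
    case True
    have k: "m + 1 + i \<in> {m+1..m + CARD('d)}" using True by simp
    have "leader_rate m p (m + 1 + i) \<le> - \<alpha> * leader_error m p (m + 1 + i) +
        648 * (real ?N * (real ?N + 1)) * (\<Sum>j<i. U p j)"
      using leader_rate_le[OF m near less_imp_le[OF \<rho>(1)] \<rho>(2,3) k] unfolding shift[OF i] \<alpha>_def .
    also have "\<dots> \<le> - \<alpha> * leader_error m p (m + 1 + i) + B * (\<Sum>j<i. U p j)"
      using U0 by (intro add_left_mono mult_right_mono sum_nonneg) (simp_all add: B_def)
    finally show ?thesis using True by (simp add: U_def U'_def)
  next
    case False
    then have i: "i = ?N" using i by simp
    have "{m+1..m + CARD('d)} = {m+1..<m+1+?N}" by auto
    then have "spread_rate m p \<le> - 2 * spread m p + 8 * (real ?N * real m) * (\<Sum>j<?N. U p j)"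
      using spread_rate_le[OF m near less_imp_le[OF \<rho>(1)] \<rho>(2,3,4)] shift[OF order_refl, of p] by simp
    also have "\<dots> \<le> - \<alpha> * spread m p + B * (\<Sum>j<?N. U p j)"
    proof (intro add_mono mult_right_mono)
      show "0 \<le> spread m p" by (simp add: spread_def sum_nonneg)
    qed (use \<alpha>0 U0 in \<open>auto simp: B_def intro: sum_nonneg\<close>)
    finally show ?thesis by (simp add: U_def U'_def i)
  qed
  have near_iff: "near_target m \<rho> p \<longleftrightarrow> (\<forall>k\<in>{1..n}. norm (p k - ?ps k) \<le> \<rho>)" for \<rho> p
    by (simp add: near_target_def n_def)
  have U_le: "U p i \<le> V p / \<epsilon> ^ ?N" if "i \<le> ?N" for p i
  proof -
    have "\<epsilon> ^ ?N * U p i \<le> \<epsilon> ^ i * U p i"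
      using \<epsilon>0 \<epsilon>1 that U0 by (intro mult_right_mono power_decreasing) auto
    also have "\<dots> \<le> V p" unfolding V_def using that \<epsilon>0 U0 by (intro member_le_sum) auto
    finally show ?thesis using \<epsilon>0 by (simp add: field_simps)
  qed
  have "exponentially_attracting n ?S ?ps (\<alpha> / 4)"
  proof (rule lyapunov_convergence[OF label, where V = V and V' = V' and \<rho> = \<rho> and C = "8 / sqrt (\<epsilon> ^ ?N)"])
    show "?S k \<subseteq> {1..n}" for k by (rule out_set_subset)
    show "0 < \<rho>" by (rule \<rho>)
    show "0 < \<alpha> / 4" using \<alpha>0 by simp
    show "0 \<le> 8 / sqrt (\<epsilon> ^ ?N)" using \<epsilon>0 by simp
    show "0 \<le> V p" for p unfolding V_def using \<epsilon>0 U0 by (intro sum_nonneg) auto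
    show "((\<lambda>s. V (x s)) has_real_derivative V' (x t)) (at t within T)"
      if "\<And>k. k \<in> {1..n} \<Longrightarrow> ((\<lambda>s. x s k) has_vector_derivative out_field ?S ?ps (x t) k) (at t within T)" for x t T
      unfolding V_def V'_def
    proof (rule DERIV_sum, rule DERIV_cmult)
      fix i assume "i \<in> {..?N}"
      show "((\<lambda>s. U (x s) i) has_real_derivative U' (x t) i) (at t within T)"
      proof (cases "i < ?N")
        case True
        then have k: "m + 1 + i \<in> {1..m + CARD('d)}" by simp
        show ?thesis unfolding U_def U'_def if_P[OF True]
          by (rule leader_error_has_derivative[OF that[unfolded n_def] k])
      next
        case False
        show ?thesis unfolding U_def U'_def if_not_P[OF False]
          by (rule spread_has_derivative[OF that[unfolded n_def] m])
      qed
    qed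
    show "V' p \<le> - (2 * (\<alpha> / 4)) * V p" if "\<And>k. k \<in> {1..n} \<Longrightarrow> norm (p k - ?ps k) \<le> \<rho>" for p
    proof -
      have "near_target m \<rho> p" using that by (simp add: near_iff)
      from cascade_decay[OF \<alpha>0(1) B0 U0 cascade[OF this] \<epsilon>_def] show ?thesis by (simp add: V_def V'_def)
    qed
    show "\<bar>length_error ?ps p i j\<bar> \<le> 8 / sqrt (\<epsilon> ^ ?N) * sqrt (V p)"
      if near: "\<And>k. k \<in> {1..n} \<Longrightarrow> norm (p k - ?ps k) \<le> \<rho>" and ij: "i \<in> {1..n}" "j \<in> {1..n}" for p i j
    proof -
      have nt: "near_target m \<rho> p" using near by (simp add: near_iff)
      have "leader_error m p k \<le> V p / \<epsilon> ^ ?N" if "k \<in> {m+1..m + CARD('d)}" for k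
      proof -
        have "m + 1 \<le> k" using that by simp
        then obtain i where "k = m + 1 + i" using le_Suc_ex by blast
        moreover have "i < ?N" using that calculation by simp
        ultimately show ?thesis using U_le[of i p] by (simp add: U_def)
      qed
      moreover have "spread m p \<le> V p / \<epsilon> ^ ?N" using U_le[of ?N p] by (simp add: U_def)
      ultimately have "\<bar>length_error ?ps p i j\<bar> \<le> 8 * sqrt (V p / \<epsilon> ^ ?N)"
        using ij unfolding n_def by (intro length_error_le[OF m nt \<rho>(3)])
      then show ?thesis by (simp add: real_sqrt_divide)
    qed
    show "\<exists>\<delta>>0. \<forall>p. (\<forall>k\<in>{1..n}. norm (p k - ?ps k) < \<delta>) \<longrightarrow> V p < e" if "0 < e" for e
    proof -
      define M where "M = (real ?N + 1) * (100 * (real ?N + real m))"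
      have M0: "0 \<le> M" by (simp add: M_def)
      define \<delta> where "\<delta> = min (1 / 64) (sqrt (e / (M + 1)))"
      have \<delta>: "0 < \<delta>" "\<delta> \<le> 1 / 64" using that M0 by (simp_all add: \<delta>_def)
      have "\<delta>\<^sup>2 \<le> e / (M + 1)"
        using power_mono[of \<delta> "sqrt (e / (M + 1))" 2] \<delta>(1) that M0 by (simp add: \<delta>_def)
      then have "M * \<delta>\<^sup>2 + \<delta>\<^sup>2 \<le> e" using M0 by (simp add: field_simps)
      then have M\<delta>: "M * \<delta>\<^sup>2 < e" using \<delta>(1) zero_less_power[of \<delta> 2] by linarith
      have "V p < e" if "\<forall>k\<in>{1..n}. norm (p k - ?ps k) < \<delta>" for p
      proof -
        have nt: "near_target m \<delta> p" using that by (auto simp: near_iff intro: less_imp_le)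
        have "\<epsilon> ^ i * U p i \<le> 1 * (100 * (real ?N + real m) * \<delta>\<^sup>2)" if "i \<le> ?N" for i
        proof (intro mult_mono)
          show "\<epsilon> ^ i \<le> 1" using \<epsilon>0 \<epsilon>1 by (intro power_le_one) auto
          show "U p i \<le> 100 * (real ?N + real m) * \<delta>\<^sup>2"
            using leader_error_small[OF m nt \<delta>(2), of "m + 1 + i"] spread_small[OF m nt] by (simp add: U_def)
        qed (use U0 in auto)
        then have "V p \<le> (\<Sum>i\<le>?N. 1 * (100 * (real ?N + real m) * \<delta>\<^sup>2))" unfolding V_def by (intro sum_mono) simp
        also have "\<dots> = M * \<delta>\<^sup>2" by (simp add: M_def algebra_simps)
        finally show ?thesis using M\<delta> by simp
      qed
      then show ?thesis using \<delta>(1) by blast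
    qed
  qed
  moreover have "?S = (\<lambda>k. {j. (k, j) \<in> cyclic_arcs m n})" by (simp add: out_set_def fun_eq_iff)
  ultimately show ?thesis
    using \<alpha>0(1) target_configs[of m, where 'd = 'd] unfolding n_def
    by (intro stable_of_convergence[where c = "\<alpha> / 4"] orientation_cyclic) simp_all
qed

section \<open>The cyclic orientation is not persistent\<close>

text \<open>
  Two points with equal distances from a set of centres differ by a vector orthogonal to all differences
  of the centres, and these differences nearly contain an orthonormal basis.
\<close>

lemma determined_by_near_frame:
  fixes q :: "'i \<Rightarrow> real ^ 'd::finite"
  assumes j0: "norm (q j0) < \<eta>" and frame: "\<And>a. norm (q (f a) - axis a 1) < \<eta>"
    and \<eta>: "4 * (real CARD('d) * \<eta>) \<le> 1"
    and d0: "dist x (q j0) = dist y (q j0)" and d: "\<And>a. dist x (q (f a)) = dist y (q (f a))"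
  shows "x = y"
proof -
  define z where "z = x - y"
  have sq: "x \<bullet> x - y \<bullet> y = 2 * (z \<bullet> c)" if "dist x c = dist y c" for c
  proof -
    have "(x - c) \<bullet> (x - c) = (y - c) \<bullet> (y - c)"
      using that by (simp only: dist_norm norm_eq)
    then show ?thesis by (simp add: z_def inner_diff_left inner_diff_right inner_commute)
  qed
  have comp: "\<bar>z $ a\<bar> \<le> norm z * (2 * \<eta>)" for a
  proof -
    have "z \<bullet> (q (f a) - q j0) = 0"
      using sq[OF d0] sq[OF d[of a]] by (simp add: inner_diff_right)
    then have "z $ a = z \<bullet> (axis a 1 - (q (f a) - q j0))"
      by (simp add: inner_diff_right inner_axis)
    also have "\<bar>\<dots>\<bar> \<le> norm z * norm (axis a 1 - (q (f a) - q j0))" by (rule Cauchy_Schwarz_ineq2)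
    also have "\<dots> \<le> norm z * (2 * \<eta>)"
    proof (intro mult_left_mono)
      have "axis a 1 - (q (f a) - q j0) = q j0 - (q (f a) - axis a 1)" by simp
      then have "norm (axis a 1 - (q (f a) - q j0)) \<le> norm (q j0) + norm (q (f a) - axis a 1)"
        by (simp only: norm_triangle_ineq4)
      then show "norm (axis a 1 - (q (f a) - q j0)) \<le> 2 * \<eta>" using j0 frame[of a] by linarith
    qed simp
    finally show ?thesis .
  qed
  have "norm z \<le> (\<Sum>a\<in>UNIV. \<bar>z $ a\<bar>)" by (rule norm_le_l1_cart)
  also have "\<dots> \<le> (\<Sum>a\<in>(UNIV :: 'd set). norm z * (2 * \<eta>))" by (intro sum_mono comp)
  also have "\<dots> = norm z * (4 * (real CARD('d) * \<eta>)) / 2" by simp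
  also have "\<dots> \<le> norm z * 1 / 2" using \<eta> by (intro divide_right_mono mult_left_mono) auto
  finally have "norm z \<le> 0" by simp
  then show ?thesis by (simp add: z_def)
qed

text \<open>
  A configuration in which every residue class modulo 3 of the followers consists of the origin
  (for the vertices 2, 3, 4) and the basis vectors.
\<close>

definition frames :: "nat \<Rightarrow> real ^ 'd::finite" where
  "frames j = (\<chi> a. if (j - 2) div 3 = Suc (coord_index a) then 1 else 0)"

lemma follower_pinned:
  fixes p :: "'d::finite config"
  assumes m: "m = 3 * CARD('d) + 4" and \<eta>: "4 * (real CARD('d) * \<eta>) \<le> 1"
    and p: "\<And>j. j \<in> {2..m} \<Longrightarrow> norm (p j - frames j) < \<eta>"
    and d: "\<And>j. j \<in> {2..m} \<Longrightarrow> j mod 3 = Suc i mod 3 \<Longrightarrow> dist x (p j) = dist y (p j)"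
  shows "x = y"
proof -
  \<comment> \<open>The vertices \<open>2 + r + 3 t\<close> are those of the class that \<open>i\<close> points to.\<close>
  define r where "r = (Suc i + 1) mod 3"
  define v where "v t = 2 + r + 3 * t" for t
  have r: "r < 3" by (simp add: r_def)
  have v: "v t \<in> {2..m}" "v t mod 3 = Suc i mod 3" "(v t - 2) div 3 = t" if "t \<le> CARD('d)" for t
  proof -
    show "v t \<in> {2..m}" using r that by (simp add: v_def m)
    have "v t mod 3 = (2 + r) mod 3" unfolding v_def by (rule mod_mult_self2)
    also have "\<dots> = (2 + (Suc i + 1)) mod 3" unfolding r_def by (rule mod_add_right_eq)
    also have "2 + (Suc i + 1) = Suc i + 3" by simp
    finally show "v t mod 3 = Suc i mod 3" by (simp only: mod_add_self2)
    show "(v t - 2) div 3 = t" using r by (simp add: v_def)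
  qed
  have ci: "Suc (coord_index a) \<le> CARD('d)" for a :: 'd
  proof -
    have "coord_index a \<in> {0..<CARD('d)}" using bij_coord_index[where 'd = 'd] by (auto simp: bij_betw_def)
    then show ?thesis by simp
  qed
  have "frames (v 0) = (0 :: real ^ 'd)" using v(3)[of 0] by (simp add: frames_def vec_eq_iff)
  moreover have "frames (v (Suc (coord_index a))) = axis a (1 :: real)" for a :: 'd
    using v(3)[OF ci[of a]] by (simp add: frames_def vec_eq_iff axis_def eq_commute)
  ultimately show ?thesis
    using p[OF v(1)] d[OF v(1,2)] ci
    by (intro determined_by_near_frame[of p "v 0" \<eta> "\<lambda>a. v (Suc (coord_index a))" x y] \<eta>) (metis diff_zero le0)+
qed

text \<open>
  Translating the leaders by a small vector keeps all constraints among the leaders and all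
  constraints among the followers, while each follower is already fixed by the latter.
\<close>

lemma not_persistent_config_cyclic:
  fixes p :: "'d::finite config"
  defines "m \<equiv> 3 * CARD('d) + 4" and "n \<equiv> 4 * CARD('d) + 4"
  assumes \<eta>: "4 * (real CARD('d) * \<eta>) \<le> 1"
    and p: "\<And>j. j \<in> {1..n} \<Longrightarrow> norm (p j - frames j) < \<eta>"
  shows "\<not> persistent_config n (cyclic_arcs m n) p"
proof
  let ?D = "cyclic_arcs m n"
  have mn: "m \<le> n" "1 \<le> m" by (simp_all add: m_def n_def)
  have pin: "x = y" if "\<And>j. j \<in> {2..m} \<Longrightarrow> j mod 3 = Suc i mod 3 \<Longrightarrow> dist x (p j) = dist y (p j)" for i x y
    by (rule follower_pinned[of m \<eta> p i]) (use \<eta> p mn that in \<open>auto simp: m_def\<close>)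
  assume "persistent_config n ?D p"
  then obtain \<epsilon> where \<epsilon>: "0 < \<epsilon>" and pers: "\<And>p'. p' \<in> configs n \<Longrightarrow> config_dist n p p' < \<epsilon> \<Longrightarrow>
      fitting n ?D (\<lambda>i j. dist (p i) (p j)) p' \<Longrightarrow> congruent n p p'"
    unfolding persistent_config_def by metis
  obtain u :: "real ^ 'd" where u: "norm u = 1" by (metis norm_axis_1)
  define s where "s = \<epsilon> / (2 * (real n + 1))"
  have s: "0 < s" using \<epsilon> by (simp add: s_def)
  define p' where "p' = (\<lambda>k\<in>{1..n}. if leader m k then p k + s *\<^sub>R u else p k)"
  have follower: "p' k = p k" if "k \<in> {2..m}" for k
    using that mn by (simp add: p'_def leader_def)
  have leader: "p' k = p k + s *\<^sub>R u" if "k \<in> {1..n}" "leader m k" for k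
    using that by (simp add: p'_def)
  have "p' \<in> configs n" by (simp add: p'_def configs_def)
  moreover have "config_dist n p p' < \<epsilon>"
  proof -
    have "config_dist n p p' \<le> (\<Sum>k\<in>{1..n}. dist (p k) (p' k))"
      unfolding config_dist_def by (rule L2_set_le_sum) simp
    also have "\<dots> \<le> (\<Sum>k\<in>{1..n}. s)"
      by (rule sum_mono) (use s u in \<open>auto simp: p'_def dist_norm\<close>)
    also have "\<dots> = \<epsilon> * (real n / (2 * (real n + 1)))" by (simp add: s_def)
    also have "\<dots> < \<epsilon> * 1" using \<epsilon> by (intro mult_strict_left_mono) (simp_all add: field_simps)
    finally show ?thesis by simp
  qed
  moreover have "fitting n ?D (\<lambda>i j. dist (p i) (p j)) p'"
    unfolding fitting_def
  proof (rule notI, elim bexE exE)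
    fix i x
    assume i: "i \<in> {1..n}" and less: "{(k, j) \<in> ?D. k = i \<and> dist (p' i) (p' j) = dist (p i) (p j)} \<subset>
        {(k, j) \<in> ?D. k = i \<and> dist x (p' j) = dist (p i) (p j)}"
    show False
    proof (cases "leader m i")
      case True
      have "dist (p' i) (p' j) = dist (p i) (p j)" if "(i, j) \<in> ?D" for j
      proof -
        have "j \<in> {1..n}" "leader m j" using that True by (simp_all add: cyclic_arcs_def)
        then show ?thesis using leader i True by (simp add: dist_norm)
      qed
      then show False using less by auto
    next
      case False
      have i2: "i \<in> {2..m}" using False i by (auto simp: leader_def)
      have "x = p i"
      proof (rule pin[of i])
        fix j assume j: "j \<in> {2..m}" "j mod 3 = Suc i mod 3"
        have "(i, j) \<in> ?D" using j i False mn by (simp add: cyclic_arcs_def)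
        then have "(i, j) \<in> {(k, j) \<in> ?D. k = i \<and> dist (p' i) (p' j) = dist (p i) (p j)}"
          using follower i2 j(1) by simp
        then have "dist x (p' j) = dist (p i) (p j)" using less by blast
        then show "dist x (p j) = dist (p i) (p j)" using follower[OF j(1)] by simp
      qed
      then show False using less follower[OF i2] by simp
    qed
  qed
  ultimately have cong: "congruent n p p'" by (rule pers)
  have "p 1 + s *\<^sub>R u = p 1"
  proof (rule pin[of 0])
    fix j assume j: "j \<in> {2..m}"
    have "1 \<in> {1..n}" "j \<in> {1..n}" using j mn by auto
    then have "dist (p' 1) (p' j) = dist (p 1) (p j)" using cong unfolding congruent_iff_dist by blast
    moreover have "p' 1 = p 1 + s *\<^sub>R u" using mn by (intro leader) (auto simp: leader_def)
    ultimately show "dist (p 1 + s *\<^sub>R u) (p j) = dist (p 1) (p j)" using follower[OF j] by simp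
  qed
  then show False using s u by auto
qed

lemma not_persistent_cyclic:
  "\<not> persistent TYPE('d::finite) (4 * CARD('d) + 4) (cyclic_arcs (3 * CARD('d) + 4) (4 * CARD('d) + 4))"
proof
  let ?n = "4 * CARD('d) + 4" and ?m = "3 * CARD('d) + 4"
  let ?M = "\<Pi>\<^sub>M i\<in>{1..?n}. (lborel :: (real ^ 'd) measure)"
  define \<eta> where "\<eta> = 1 / (4 * real CARD('d))"
  have \<eta>: "0 < \<eta>" "4 * (real CARD('d) * \<eta>) \<le> 1" by (simp_all add: \<eta>_def)
  define B where "B = (\<Pi>\<^sub>E i\<in>{1..?n}. ball (frames i :: real ^ 'd) \<eta>)"
  assume "persistent TYPE('d) ?n (cyclic_arcs ?m ?n)"
  then have "AE p in ?M. persistent_config ?n (cyclic_arcs ?m ?n) p" by (simp only: persistent_def)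
  then obtain N where N: "{p \<in> space ?M. \<not> persistent_config ?n (cyclic_arcs ?m ?n) p} \<subseteq> N"
    "emeasure ?M N = 0" "N \<in> sets ?M" by (rule AE_E)
  have "B \<subseteq> N"
  proof
    fix p assume p: "p \<in> B"
    have "\<not> persistent_config ?n (cyclic_arcs ?m ?n) p"
    proof (rule not_persistent_config_cyclic[OF \<eta>(2)])
      fix j assume "j \<in> {1..?n}"
      then have "p j \<in> ball (frames j) \<eta>" using p unfolding B_def by (rule PiE_mem[rotated])
      then show "norm (p j - frames j) < \<eta>" by (simp add: dist_norm norm_minus_commute)
    qed
    moreover have "p \<in> space ?M" using p by (auto simp: space_PiM B_def PiE_def)
    ultimately show "p \<in> N" using N(1) by blast
  qed
  then have "emeasure ?M B \<le> emeasure ?M N" by (rule emeasure_mono) (rule N(3))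
  moreover have "emeasure ?M B \<noteq> 0"
  proof -
    interpret product_sigma_finite "\<lambda>_ :: nat. lborel :: (real ^ 'd) measure" ..
    define v where "v = unit_ball_vol (real DIM(real ^ 'd)) * \<eta> ^ DIM(real ^ 'd)"
    have "0 < v" using \<eta>(1) unfolding v_def by (intro mult_pos_pos unit_ball_vol_pos zero_less_power) simp_all
    have "emeasure ?M B = (\<Prod>i\<in>{1..?n}. emeasure lborel (ball (frames i :: real ^ 'd) \<eta>))"
      unfolding B_def by (rule emeasure_PiM) simp_all
    also have "\<dots> = (\<Prod>i\<in>{1..?n}. ennreal v)"
      using \<eta>(1) by (intro prod.cong refl) (simp add: emeasure_ball v_def)
    also have "\<dots> = ennreal (v ^ ?n)"
      using \<open>0 < v\<close> by (simp only: prod_constant card_atLeastAtMost diff_Suc_1 ennreal_power less_imp_le)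
    finally show ?thesis using \<open>0 < v\<close> by simp
  qed
  ultimately show False using N(2) by simp
qed

section \<open>Persistence and stability are independent\<close>

theorem mainTheorem8:
  shows
    "\<not> (\<forall>n E D. \<forall>ps :: 'd::finite config.
          simple_graph n E \<and> rigid_graph TYPE('d) n E \<and> orientation E D \<and>
          ps \<in> regular_configs n E \<and> locally_exponentially_stable n E D ps
          \<longrightarrow> persistent TYPE('d) n D)
     \<and> \<not> (\<forall>n E D. \<forall>ps :: 'd::finite config.
          simple_graph n E \<and> rigid_graph TYPE('d) n E \<and> orientation E D \<and>
          ps \<in> regular_configs n E \<and> persistent TYPE('d) n D
          \<longrightarrow> locally_exponentially_stable n E D ps)"
proof -
  define m n where "m = 3 * CARD('d) + 4" and "n = m + CARD('d)"
  have m: "1 \<le> m" and n: "n = 4 * CARD('d) + 4" by (simp_all add: m_def n_def)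
  let ?E = "complete_edges n" and ?ps = "target m :: 'd config"
  have common: "simple_graph n ?E" "rigid_graph TYPE('d) n ?E" "?ps \<in> regular_configs n ?E"
    unfolding n_def by (rule simple_complete rigid_complete target_regular[OF m])+
  have "card (UNIV :: ('d option \<times> bool \<times> bool) set) = card {1..n}"
  proof -
    have "card (UNIV :: 'd option set) = CARD('d) + 1"
      unfolding UNIV_option_conv by (simp add: card_image)
    then show ?thesis by (simp add: n flip: UNIV_Times_UNIV)
  qed
  then obtain label :: "'d option \<times> bool \<times> bool \<Rightarrow> nat" where "bij_betw label UNIV {1..n}"
    using finite_same_card_bij[OF finite finite_atLeastAtMost] by blast
  then have "locally_exponentially_stable n ?E (cyclic_arcs m n) ?ps"
    unfolding n_def by (rule cyclic_stable[OF m])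
  moreover have "\<not> persistent TYPE('d) n (cyclic_arcs m n)"
    unfolding n m_def by (rule not_persistent_cyclic)
  moreover have "orientation ?E (cyclic_arcs m n)" by (rule orientation_cyclic)
  moreover have "\<not> locally_exponentially_stable n ?E (?E\<inverse>) ?ps"
  proof (rule not_stable_coincident)
    show "2 \<le> n" by (simp add: n)
    have "2 \<in> {1..m}" "1 \<in> {1..m}" by (auto simp: m_def)
    then show "?ps 2 = ?ps 1" by (simp only: target_zero)
  qed
  moreover have "persistent TYPE('d) n (?E\<inverse>)" "orientation ?E (?E\<inverse>)"
    by (rule persistent_transitive orientation_transitive)+
  ultimately show ?thesis using common by blast
qed

end
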